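(* Let $E$ be a Banach space, $1<p<\infty$ and $\gamma_p=(1-\frac1p)^{\frac1p-1}$. For $f\in\mathrm{FVL}[E]$ let $$\rho_{p,\infty}(f)=\sup\Big\{\|(f(x_1^* ),\dots,f(x_n^* ))\|_{p,\infty}\Big\},$$ the supremum taken over all $n\in\mathbb N$ and $x_1^*,\dots,x_n^*\in B_{E^*}$ with $\sup_{x\in B_E}\|(x_1^*(x),\dots,x_n^*(x))\|_{p,\infty}\le1$. Then $\rho_{\mathcal X^\sigma_{p,\infty}}=\rho_{p,\infty}$ on $\mathrm{FVL}[E]$, and $\rho_{p,\infty}\le\rho_{\mathcal C_{p,\infty}}\le\gamma_p\,\rho_{p,\infty}$ on $\mathrm{FVL}[E]$.
   Context: $\mathrm{FVL}[E]$ is the vector sublattice of $C(B_{E^*})$ ($B_{E^*}$ with weak$^*$ topology) generated by the functions $\delta_x(x^* )=x^*(x)$, $x\in E$; each linear $T:E\to Y$ into an Archimedean vector lattice extends uniquely to a vector lattice homomorphism $\widehat T$ on $\mathrm{FVL}[E]$ with $\widehat T\delta_x=Tx$. For a class $\mathcal C$ of Banach lattices, $\rho_{\mathcal C}(f)=\sup\{\|\widehat Tf\|_Y:Y\in\mathcal C,\ T:E\to Y\text{ linear contraction}\}$. For $a\in\mathbb R^n$, $\|a\|_{p,\infty}=\max\{|A|^{\frac1p-1}\sum_{i\in A}|a_i|:\emptyset\ne A\subseteq\{1,\dots,n\}\}$. $L^{p,\infty}(\mu)$ is weak-$L^p$ with norm $\|h\|=\sup\{\mu(A)^{\frac1p-1}\int_A|h|\,d\mu:0<\mu(A)<\infty\}$.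 $\mathcal X^\sigma_{p,\infty}$ is the class of all $L^{p,\infty}(\mu)$ with $\mu$ $\sigma$-finite, and $\mathcal C_{p,\infty}$ the class of all Banach lattices satisfying an upper $p$-estimate with constant $1$, i.e. $\|\sum_k x_k\|\le(\sum_k\|x_k\|^p)^{1/p}$ for pairwise disjoint $x_1,\dots,x_m$. *)

theory Defs
  imports "HOL-Analysis.Analysis" "HOL-Probability.Probability"
begin

text \<open>Every element of FVL[E] is obtained from the generators delta_x by finitely many
 vector-lattice operations (sums, real scalar multiples, binary suprema; infima and zero
 are expressible from these). We represent such a construction by an expression.\<close>

datatype 'e lexpr = Atom 'e | Add "'e lexpr" "'e lexpr" | Scale real "'e lexpr"
  | Sup "'e lexpr" "'e lexpr"

fun eval_real :: "('e \<Rightarrow> real) \<Rightarrow> 'e lexpr \<Rightarrow> real" where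
  "eval_real a (Atom x) = a x"
| "eval_real a (Add e1 e2) = eval_real a e1 + eval_real a e2"
| "eval_real a (Scale c e) = c * eval_real a e"
| "eval_real a (Sup e1 e2) = max (eval_real a e1) (eval_real a e2)"

text \<open>The element of FVL[E] (a function on the dual ball, x^* maps to f(x^*)) denoted by e;
 with Atom x interpreted as delta_x.\<close>
definition fvl_fun :: "'e::banach lexpr \<Rightarrow> ('e \<Rightarrow>\<^sub>L real) \<Rightarrow> real" where
  "fvl_fun e xs = eval_real (blinfun_apply xs) e"

definition is_lsup :: "'y set \<Rightarrow> ('y \<Rightarrow> 'y \<Rightarrow> bool) \<Rightarrow> 'y \<Rightarrow> 'y \<Rightarrow> 'y \<Rightarrow> bool" where
  "is_lsup V le x y s \<longleftrightarrow> s \<in> V \<and> le x s \<and> le y s \<and> (\<forall>z\<in>V. le x z \<and> le y z \<longrightarrow> le s z)"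

definition lsup :: "'y set \<Rightarrow> ('y \<Rightarrow> 'y \<Rightarrow> bool) \<Rightarrow> 'y \<Rightarrow> 'y \<Rightarrow> 'y" where
  "lsup V le x y = (THE s. is_lsup V le x y s)"

definition linf :: "'y::real_vector set \<Rightarrow> ('y \<Rightarrow> 'y \<Rightarrow> bool) \<Rightarrow> 'y \<Rightarrow> 'y \<Rightarrow> 'y" where
  "linf V le x y = - lsup V le (- x) (- y)"

definition labs :: "'y::real_vector set \<Rightarrow> ('y \<Rightarrow> 'y \<Rightarrow> bool) \<Rightarrow> 'y \<Rightarrow> 'y" where
  "labs V le x = lsup V le x (- x)"

definition banach_lattice ::
  "'y::real_vector set \<Rightarrow> ('y \<Rightarrow> 'y \<Rightarrow> bool) \<Rightarrow> ('y \<Rightarrow> real) \<Rightarrow> bool" where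
  "banach_lattice V le nrm \<longleftrightarrow>
     subspace V
   \<and> (\<forall>x\<in>V. le x x)
   \<and> (\<forall>x\<in>V. \<forall>y\<in>V. le x y \<and> le y x \<longrightarrow> x = y)
   \<and> (\<forall>x\<in>V. \<forall>y\<in>V. \<forall>z\<in>V. le x y \<and> le y z \<longrightarrow> le x z)
   \<and> (\<forall>x\<in>V. \<forall>y\<in>V. \<forall>z\<in>V. le x y \<longrightarrow> le (x + z) (y + z))
   \<and> (\<forall>x\<in>V. \<forall>y\<in>V. \<forall>c::real. c \<ge> 0 \<and> le x y \<longrightarrow> le (c *\<^sub>R x) (c *\<^sub>R y))
   \<and> (\<forall>x\<in>V. \<forall>y\<in>V. \<exists>s. is_lsup V le x y s)
   \<and> (\<forall>x\<in>V. nrm x \<ge> 0 \<and> (nrm x = 0 \<longleftrightarrow> x = 0))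
   \<and> (\<forall>x\<in>V. \<forall>c. nrm (c *\<^sub>R x) = \<bar>c\<bar> * nrm x)
   \<and> (\<forall>x\<in>V. \<forall>y\<in>V. nrm (x + y) \<le> nrm x + nrm y)
   \<and> (\<forall>x\<in>V. \<forall>y\<in>V. le (labs V le x) (labs V le y) \<longrightarrow> nrm x \<le> nrm y)
   \<and> (\<forall>X::nat \<Rightarrow> 'y. (\<forall>n. X n \<in> V) \<and>
         (\<forall>\<epsilon>>0. \<exists>N. \<forall>m\<ge>N. \<forall>n\<ge>N. nrm (X m - X n) < \<epsilon>)
       \<longrightarrow> (\<exists>l\<in>V. (\<lambda>n. nrm (X n - l)) \<longlonglongrightarrow> 0))"

definition ldisjoint :: "'y::real_vector set \<Rightarrow> ('y \<Rightarrow> 'y \<Rightarrow> bool) \<Rightarrow> 'y \<Rightarrow> 'y \<Rightarrow> bool" where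
  "ldisjoint V le x y \<longleftrightarrow> linf V le (labs V le x) (labs V le y) = 0"

definition upper_p_estimate1 ::
  "real \<Rightarrow> 'y::real_vector set \<Rightarrow> ('y \<Rightarrow> 'y \<Rightarrow> bool) \<Rightarrow> ('y \<Rightarrow> real) \<Rightarrow> bool" where
  "upper_p_estimate1 p V le nrm \<longleftrightarrow>
     (\<forall>m::nat. \<forall>x::nat \<Rightarrow> 'y. (\<forall>k<m. x k \<in> V) \<and>
        (\<forall>j<m. \<forall>k<m. j \<noteq> k \<longrightarrow> ldisjoint V le (x j) (x k))
      \<longrightarrow> nrm (\<Sum>k<m. x k) \<le> (\<Sum>k<m. nrm (x k) powr p) powr (1 / p))"

text \<open>Evaluation of an expression in a vector lattice Y, atoms x mapped to T x:
 this is the value of the lattice homomorphism extension at the element denoted by e.\<close>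
fun eval_lat :: "'y::real_vector set \<Rightarrow> ('y \<Rightarrow> 'y \<Rightarrow> bool) \<Rightarrow> ('e \<Rightarrow> 'y) \<Rightarrow> 'e lexpr \<Rightarrow> 'y" where
  "eval_lat V le T (Atom x) = T x"
| "eval_lat V le T (Add e1 e2) = eval_lat V le T e1 + eval_lat V le T e2"
| "eval_lat V le T (Scale c e) = c *\<^sub>R eval_lat V le T e"
| "eval_lat V le T (Sup e1 e2) = lsup V le (eval_lat V le T e1) (eval_lat V le T e2)"

definition lin_contraction ::
  "'y::real_vector set \<Rightarrow> ('y \<Rightarrow> real) \<Rightarrow> ('e::banach \<Rightarrow> 'y) \<Rightarrow> bool" where
  "lin_contraction V nrm T \<longleftrightarrow>
     (\<forall>x. T x \<in> V) \<and> (\<forall>x y. T (x + y) = T x + T y) \<and> (\<forall>c x. T (c *\<^sub>R x) = c *\<^sub>R T x)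
   \<and> (\<forall>x. nrm (T x) \<le> norm x)"

text \<open>rho_C for C = C_{p,infty}, restricted to the Banach lattices whose carrier lives in type 'y.
 (The supremum over the whole class is the supremum over all types 'y.)\<close>
definition rho_Cp :: "'y::real_vector itself \<Rightarrow> real \<Rightarrow> 'e::banach lexpr \<Rightarrow> ennreal" where
  "rho_Cp _ p e = (SUP (V, le, nrm, T) \<in>
      {(V :: 'y set, le, nrm, T :: 'e \<Rightarrow> 'y). banach_lattice V le nrm \<and> upper_p_estimate1 p V le nrm
         \<and> lin_contraction V nrm T}.
      ennreal (nrm (eval_lat V le T e)))"

definition wnorm :: "'b measure \<Rightarrow> real \<Rightarrow> ('b \<Rightarrow> real) \<Rightarrow> ennreal" where
  "wnorm M p h = (SUP A \<in> {A \<in> sets M. 0 < emeasure M A \<and> emeasure M A < \<infinity>}.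
      ennreal (measure M A powr (1 / p - 1)) * (\<integral>\<^sup>+ x \<in> A. ennreal \<bar>h x\<bar> \<partial>M))"

text \<open>Linear contractions E -> L^{p,infty}(M), on representatives (linearity up to a.e.).\<close>
definition weakLp_contraction :: "'b measure \<Rightarrow> real \<Rightarrow> ('e::banach \<Rightarrow> 'b \<Rightarrow> real) \<Rightarrow> bool" where
  "weakLp_contraction M p T \<longleftrightarrow>
     (\<forall>x. T x \<in> borel_measurable M \<and> wnorm M p (T x) \<le> ennreal (norm x))
   \<and> (\<forall>x y. AE w in M. T (x + y) w = T x w + T y w)
   \<and> (\<forall>c x. AE w in M. T (c *\<^sub>R x) w = c * T x w)"

text \<open>rho_X for X = X^sigma_{p,infty}, restricted to measures on type 'b. Lattice operations
 in L^{p,infty} are a.e. pointwise, so the extension is computed pointwise on representatives.\<close>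
definition rho_Xp :: "'b itself \<Rightarrow> real \<Rightarrow> 'e::banach lexpr \<Rightarrow> ennreal" where
  "rho_Xp _ p e = (SUP (M, T) \<in>
      {(M :: 'b measure, T :: 'e \<Rightarrow> 'b \<Rightarrow> real). sigma_finite_measure M \<and> weakLp_contraction M p T}.
      wnorm M p (\<lambda>w. eval_real (\<lambda>x. T x w) e))"

definition wnorm_fin :: "real \<Rightarrow> nat \<Rightarrow> (nat \<Rightarrow> real) \<Rightarrow> real" where
  "wnorm_fin p n a = Max {real (card A) powr (1 / p - 1) * (\<Sum>i\<in>A. \<bar>a i\<bar>) | A. A \<noteq> {} \<and> A \<subseteq> {..<n}}"

definition rho_pinf :: "real \<Rightarrow> 'e::banach lexpr \<Rightarrow> ennreal" where
  "rho_pinf p e = (SUP (n, xs) \<in>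
      {(n :: nat, xs :: nat \<Rightarrow> ('e \<Rightarrow>\<^sub>L real)). n \<ge> 1 \<and> (\<forall>i<n. norm (xs i) \<le> 1) \<and>
         (\<forall>x::'e. norm x \<le> 1 \<longrightarrow> wnorm_fin p n (\<lambda>i. blinfun_apply (xs i) x) \<le> 1)}.
      ennreal (wnorm_fin p n (\<lambda>i. fvl_fun e (xs i))))"

definition gamma_p :: "real \<Rightarrow> real" where
  "gamma_p p = (1 - 1 / p) powr (1 / p - 1)"

end

theory Submission
  imports Defs
begin

text \<open>
  Discrete weights. If functionals \<open>a i\<close> and weights \<open>\<mu> i\<close> satisfy
  \<open>(\<Sum>i\<in>S. \<bar>a i x\<bar>) \<le> \<mu>(S) powr (1 - 1/p)\<close> for all \<open>S\<close> and all \<open>x\<close> in the unit ball, then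
  \<open>(\<Sum>i. \<bar>f (a i)\<bar>) \<le> \<mu>(I) powr (1 - 1/p) * \<rho>(f)\<close>: repeat \<open>a i\<close> about \<open>\<mu> i / c\<close> times and let \<open>c\<close> tend to 0.
  For \<open>T\<close> into weak \<open>L\<^sup>p\<close>, apply this to the integrals of \<open>T x\<close> over small pieces on which the finitely
  many functions entering \<open>f\<close> are almost constant.

  For a Banach lattice \<open>Y\<close> with an upper \<open>p\<close>-estimate, let \<open>y\<close> be a positive functional norming the
  modulus of the image of \<open>f\<close>, and \<open>z\<close> the normalised modulus. By Hahn-Banach, \<open>y\<close> can be cut along
  any \<open>h\<close> into a part living on \<open>h > 0\<close> and one living on \<open>h \<le> 0\<close>; iterating, \<open>y\<close> is a sum of pieces
  \<open>y i\<close> that are almost lattice homomorphisms on the finitely many elements entering \<open>f\<close>. Put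
  \<open>\<mu> i = y i z\<close>, a probability. With \<open>q\<close> conjugate to \<open>p\<close> and \<open>b\<close> the sum of the \<open>y i\<close>, \<open>i \<in> S\<close>, the
  upper estimate for \<open>\<alpha> w \<squnion> \<beta> z\<close> yields \<open>b w powr q + (1 - \<mu>(S)) powr q \<le> 1\<close> for \<open>w\<close> in the positive
  unit ball, hence \<open>b w powr q \<le> q \<mu>(S)\<close> by Bernoulli, and \<open>q powr (1/q)\<close> is the constant \<open>\<gamma>\<close>. This is
  Pisier's factorization argument.
\<close>

section \<open>The Hahn-Banach theorem\<close>

text \<open>The upper estimate speaks only of disjoint elements, while the factorization argument
  applies it to a supremum of two arbitrary positive ones. In a general Banach lattice there need
  not be band projections that would cut this supremum into disjoint parts. Instead many different
  pairs of disjoint truncations are averaged: each pair obeys the estimate, and the average almost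
  recovers the supremum. That the average does so is an inequality between two real numbers. It
  reaches the lattice without a representation by functions: seen through a positive functional cut
  into almost homomorphic pieces, a lattice expression behaves like its evaluation at real numbers.
  The same device computes the image of f. The constant is lost only in the abstract lattice. The
  norm of weak \<open>L\<^sup>p\<close> tests sets directly, so the measures of the pieces are
  weights with constant 1; an abstract lattice offers only the dual estimate, from which the weights
  have to be extracted.\<close>

definition sublinear_on :: "'v::real_vector set \<Rightarrow> ('v \<Rightarrow> real) \<Rightarrow> bool" where
  "sublinear_on V q \<longleftrightarrow> (\<forall>x\<in>V. \<forall>y\<in>V. q (x + y) \<le> q x + q y)
     \<and> (\<forall>x\<in>V. \<forall>c>0. q (c *\<^sub>R x) \<le> c * q x)"

definition linear_functional_on :: "'v::real_vector set \<Rightarrow> ('v \<Rightarrow> real) \<Rightarrow> bool" where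
  "linear_functional_on V f \<longleftrightarrow> (\<forall>x\<in>V. \<forall>y\<in>V. f (x + y) = f x + f y)
     \<and> (\<forall>x\<in>V. \<forall>c. f (c *\<^sub>R x) = c * f x)"

text \<open>Subadditivity gives \<open>0 \<le> q 0\<close>; homogeneity, stated as an inequality for
  positive factors, gives \<open>q 0 \<le> q 0 / 2\<close> at the factor 1/2.\<close>

lemma sublinear_on_zero:
  assumes "subspace V" "sublinear_on V q"
  shows "q 0 = 0"
proof -
  have 0: "0 \<in> V" using assms(1) by (rule subspace_0)
  have "q (0 + 0) \<le> q 0 + q 0" using assms(2) 0 unfolding sublinear_on_def by blast
  moreover have "\<forall>c>0. q (c *\<^sub>R 0) \<le> c * q 0" using assms(2) 0 unfolding sublinear_on_def by blast
  then have "q ((1/2) *\<^sub>R 0) \<le> (1/2) * q 0" by (rule allE[of _ "1/2"]) simp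
  ultimately show ?thesis by simp
qed

lemma sublinear_on_minus:
  assumes "subspace V" "sublinear_on V q" "x \<in> V"
  shows "- q (- x) \<le> q x"
proof -
  have "q (x + - x) \<le> q x + q (- x)"
    using assms subspace_neg[of V x] unfolding sublinear_on_def by blast
  then show ?thesis using sublinear_on_zero[OF assms(1,2)] by simp
qed

text \<open>With s = 1/t the bracket is (q (v + s x) - q v) / s, so for sublinear \<open>q\<close>
  this is the one-sided directional derivative of \<open>q\<close> at \<open>v\<close> in direction
  \<open>x\<close>. The value t = 0 is included and gives the bound by \<open>q x\<close>.\<close>

definition sublinear_slope :: "('v::real_vector \<Rightarrow> real) \<Rightarrow> 'v \<Rightarrow> 'v \<Rightarrow> real" where
  "sublinear_slope q v x = (INF t\<in>{0..}. q (x + t *\<^sub>R v) - t * q v)"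

context
  fixes V :: "'v::real_vector set" and q v
  assumes V: "subspace V" and q: "sublinear_on V q" and v: "v \<in> V"
begin

lemma sublinear_scale_eq:
  assumes "x \<in> V" "0 \<le> c"
  shows "q (c *\<^sub>R x) = c * q x"
proof (cases "c = 0")
  case True
  then show ?thesis using sublinear_on_zero[OF V q] by simp
next
  case False
  then have c: "c > 0" using assms by simp
  have cx: "c *\<^sub>R x \<in> V" using V assms(1) by (rule subspace_scale)
  have "q (inverse c *\<^sub>R (c *\<^sub>R x)) \<le> inverse c * q (c *\<^sub>R x)"
    using q cx c unfolding sublinear_on_def by (meson positive_imp_inverse_positive)
  then have "c * q x \<le> q (c *\<^sub>R x)" using c by (simp add: field_simps)
  moreover have "q (c *\<^sub>R x) \<le> c * q x"
    using q assms(1) c unfolding sublinear_on_def by blast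
  ultimately show ?thesis by simp
qed

lemma sublinear_slope_bdd:
  assumes "x \<in> V"
  shows "bdd_below ((\<lambda>t. q (x + t *\<^sub>R v) - t * q v) ` {0..})"
proof (rule bdd_belowI2)
  fix t :: real assume "t \<in> {0..}"
  then have t: "0 \<le> t" by simp
  have tv: "t *\<^sub>R v \<in> V" using V v by (rule subspace_scale)
  have "q ((x + t *\<^sub>R v) + - x) \<le> q (x + t *\<^sub>R v) + q (- x)"
    using q subspace_add[OF V assms tv] subspace_neg[OF V assms] unfolding sublinear_on_def by blast
  then show "- q (- x) \<le> q (x + t *\<^sub>R v) - t * q v"
    using sublinear_scale_eq[OF v t] by simp
qed

lemma sublinear_slope_le:
  assumes "x \<in> V" "0 \<le> t"
  shows "sublinear_slope q v x \<le> q (x + t *\<^sub>R v) - t * q v"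
  unfolding sublinear_slope_def
  by (rule cINF_lower[OF sublinear_slope_bdd[OF assms(1)]]) (use assms in auto)

lemma le_sublinear_slope:
  assumes "\<And>t. 0 \<le> t \<Longrightarrow> b \<le> q (x + t *\<^sub>R v) - t * q v"
  shows "b \<le> sublinear_slope q v x"
  unfolding sublinear_slope_def by (rule cINF_greatest) (use assms in auto)

lemma sublinear_slope_le_self: "x \<in> V \<Longrightarrow> sublinear_slope q v x \<le> q x"
  using sublinear_slope_le[of x 0] by simp

lemma sublinear_slope_sublinear: "sublinear_on V (sublinear_slope q v)"
  unfolding sublinear_on_def
proof (intro conjI ballI allI impI)
  fix x y assume x: "x \<in> V" and y: "y \<in> V"
  \<comment> \<open>The independent parameters s and t are merged into s + t, so that the infima for
    x and for y can be taken one after the other.\<close>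
  have "sublinear_slope q v (x + y) - (q (y + t *\<^sub>R v) - t * q v) \<le> q (x + s *\<^sub>R v) - s * q v"
    if s: "0 \<le> s" and t: "0 \<le> t" for s t
  proof -
    have "sublinear_slope q v (x + y) \<le> q ((x + y) + (s + t) *\<^sub>R v) - (s + t) * q v"
      using sublinear_slope_le[OF subspace_add[OF V x y], of "s + t"] s t by simp
    also have "(x + y) + (s + t) *\<^sub>R v = (x + s *\<^sub>R v) + (y + t *\<^sub>R v)"
      by (simp add: algebra_simps)
    also have "q \<dots> \<le> q (x + s *\<^sub>R v) + q (y + t *\<^sub>R v)"
      using q subspace_add[OF V x subspace_scale[OF V v]] subspace_add[OF V y subspace_scale[OF V v]]
      unfolding sublinear_on_def by blast
    finally show ?thesis by (simp add: algebra_simps)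
  qed
  then have "sublinear_slope q v (x + y) - (q (y + t *\<^sub>R v) - t * q v) \<le> sublinear_slope q v x"
    if "0 \<le> t" for t
    using that by (intro le_sublinear_slope) auto
  then have "sublinear_slope q v (x + y) - sublinear_slope q v x \<le> q (y + t *\<^sub>R v) - t * q v"
    if "0 \<le> t" for t
    using that by (simp add: algebra_simps)
  then have "sublinear_slope q v (x + y) - sublinear_slope q v x \<le> sublinear_slope q v y"
    by (intro le_sublinear_slope) auto
  then show "sublinear_slope q v (x + y) \<le> sublinear_slope q v x + sublinear_slope q v y"
    by simp
next
  fix x and c :: real assume x: "x \<in> V" and c: "0 < c"
  have "sublinear_slope q v (c *\<^sub>R x) / c \<le> q (x + t *\<^sub>R v) - t * q v" if t: "0 \<le> t" for t
  proof -
    have "sublinear_slope q v (c *\<^sub>R x) \<le> q (c *\<^sub>R x + (c * t) *\<^sub>R v) - (c * t) * q v"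
      using sublinear_slope_le[OF subspace_scale[OF V x], of "c * t" c] c t by simp
    also have "c *\<^sub>R x + (c * t) *\<^sub>R v = c *\<^sub>R (x + t *\<^sub>R v)" by (simp add: algebra_simps)
    also have "q \<dots> = c * q (x + t *\<^sub>R v)"
      using sublinear_scale_eq[OF subspace_add[OF V x subspace_scale[OF V v]]] c by simp
    finally show ?thesis using c by (simp add: field_simps)
  qed
  then have "sublinear_slope q v (c *\<^sub>R x) / c \<le> sublinear_slope q v x"
    by (rule le_sublinear_slope)
  then show "sublinear_slope q v (c *\<^sub>R x) \<le> c * sublinear_slope q v x"
    using c by (simp add: field_simps)
qed

end

text \<open>Zorn's lemma for the reversed pointwise order. The infimum of a chain is finite because
  every member is bounded below by \<open>- P (- x)\<close>, and subadditive because of any two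
  members one lies below the other.\<close>

lemma exists_minimal_sublinear:
  assumes V: "subspace V" and P: "sublinear_on V P"
  obtains q where "sublinear_on V q" "\<And>x. x \<in> V \<Longrightarrow> q x \<le> P x"
    "\<And>r x. sublinear_on V r \<Longrightarrow> (\<And>y. y \<in> V \<Longrightarrow> r y \<le> q y) \<Longrightarrow> x \<in> V \<Longrightarrow> r x = q x"
proof -
  \<comment> \<open>Functions are set to 0 off \<open>V\<close>, so that agreement on
    \<open>V\<close> is equality and the order is antisymmetric.\<close>
  define S where "S = {q. sublinear_on V q \<and> (\<forall>x\<in>V. q x \<le> P x) \<and> (\<forall>x. x \<notin> V \<longrightarrow> q x = 0)}"
  define R where "R q r \<longleftrightarrow> (\<forall>x\<in>V. r x \<le> q x)" for q r :: "'a \<Rightarrow> real"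
  have sub_cong: "sublinear_on V (\<lambda>x. if x \<in> V then r x else 0)" if "sublinear_on V r" for r
    using that subspace_add[OF V] subspace_scale[OF V] unfolding sublinear_on_def by auto
  have "\<exists>m\<in>S. \<forall>a\<in>S. R m a \<longrightarrow> a = m"
  proof (rule predicate_Zorn)
    show "partial_order_on S (relation_of R S)"
    proof (rule partial_order_on_relation_ofI)
      show "R a a" for a by (simp add: R_def)
      show "R a c" if "R a b" "R b c" for a b c using that unfolding R_def by force
      show "a = b" if "a \<in> S" "b \<in> S" "R a b" "R b a" for a b
        using that unfolding S_def R_def by (intro ext) (metis (mono_tags, lifting) antisym mem_Collect_eq)
    qed
  next
    fix C assume C: "C \<in> Chains (relation_of R S)"
    have CS: "C \<subseteq> S" using C unfolding Chains_def relation_of_def by auto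
    have tot: "R a b \<or> R b a" if "a \<in> C" "b \<in> C" for a b
      using C that unfolding Chains_def relation_of_def by auto
    show "\<exists>u\<in>S. \<forall>a\<in>C. R a u"
    proof (cases "C = {}")
      case True
      then show ?thesis
        using sub_cong[OF P] by (intro bexI[of _ "\<lambda>x. if x \<in> V then P x else 0"]) (auto simp: S_def)
    next
      case ne: False
      define u where "u x = (if x \<in> V then INF q\<in>C. q x else 0)" for x
      have bdd: "bdd_below ((\<lambda>q. q x) ` C)" if x: "x \<in> V" for x
      proof (rule bdd_belowI2)
        fix q assume "q \<in> C"
        then have q: "sublinear_on V q" "\<forall>x\<in>V. q x \<le> P x" using CS by (auto simp: S_def)
        show "- P (- x) \<le> q x"
          using sublinear_on_minus[OF V q(1) x] q(2) subspace_neg[OF V x] by force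
      qed
      have u_le: "u x \<le> q x" if "x \<in> V" "q \<in> C" for x q
        using that bdd unfolding u_def by (auto intro: cINF_lower)
      have u_ge: "b \<le> u x" if "x \<in> V" "\<And>q. q \<in> C \<Longrightarrow> b \<le> q x" for x b
        using that ne unfolding u_def by (auto intro: cINF_greatest)
      have "sublinear_on V u"
        unfolding sublinear_on_def
      proof (intro conjI ballI allI impI)
        fix x y assume x: "x \<in> V" and y: "y \<in> V"
        have xy: "x + y \<in> V" using V x y by (rule subspace_add)
        have "u (x + y) \<le> q x + r y" if q: "q \<in> C" and r: "r \<in> C" for q r
        proof -
          have s: "s (x + y) \<le> s x + s y" if "s \<in> C" for s
            using that CS x y unfolding S_def sublinear_on_def by blast
          from tot[OF q r] show ?thesis
          proof
            assume "R q r"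
            then show ?thesis using u_le[OF xy r] s[OF r] x unfolding R_def by force
          next
            assume "R r q"
            then show ?thesis using u_le[OF xy q] s[OF q] y unfolding R_def by force
          qed
        qed
        then have "u (x + y) - r y \<le> u x" if "r \<in> C" for r
          using that by (intro u_ge[OF x]) (simp add: algebra_simps)
        then have "u (x + y) - u x \<le> u y"
          by (intro u_ge[OF y]) (simp add: algebra_simps)
        then show "u (x + y) \<le> u x + u y" by simp
      next
        fix x and c :: real assume x: "x \<in> V" and c: "0 < c"
        have cx: "c *\<^sub>R x \<in> V" using V x by (rule subspace_scale)
        have "u (c *\<^sub>R x) / c \<le> q x" if q: "q \<in> C" for q
        proof -
          have "q (c *\<^sub>R x) \<le> c * q x" using q CS x c unfolding S_def sublinear_on_def by blast
          with u_le[OF cx q] show ?thesis using c by (simp add: field_simps)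
        qed
        then have "u (c *\<^sub>R x) / c \<le> u x" by (rule u_ge[OF x])
        then show "u (c *\<^sub>R x) \<le> c * u x" using c by (simp add: field_simps)
      qed
      moreover have "u x \<le> P x" if "x \<in> V" for x
      proof -
        obtain q where "q \<in> C" using ne by blast
        then show ?thesis using u_le[OF that, of q] CS that unfolding S_def by force
      qed
      ultimately have "u \<in> S" by (simp add: S_def u_def)
      then show ?thesis using u_le unfolding R_def by blast
    qed
  qed
  then obtain m where m: "m \<in> S" and min: "\<And>a. a \<in> S \<Longrightarrow> R m a \<Longrightarrow> a = m" by blast
  show thesis
  proof (rule that)
    show "sublinear_on V m" and mP: "\<And>x. x \<in> V \<Longrightarrow> m x \<le> P x" using m by (auto simp: S_def)
    fix r x assume r: "sublinear_on V r" and le: "\<And>y. y \<in> V \<Longrightarrow> r y \<le> m y" and x: "x \<in> V"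
    have "(\<lambda>x. if x \<in> V then r x else 0) = m"
    proof (rule min)
      show "(\<lambda>x. if x \<in> V then r x else 0) \<in> S"
        using sub_cong[OF r] le mP unfolding S_def by force
      show "R m (\<lambda>x. if x \<in> V then r x else 0)" using le by (simp add: R_def)
    qed
    then show "r x = m x" using x by (auto dest: fun_cong[of _ _ x])
  qed
qed

text \<open>A minimal sublinear functional is linear, since it is unchanged by passing to its slopes.\<close>

lemma exists_linear_below_sublinear:
  assumes V: "subspace V" and P: "sublinear_on V P"
  obtains f where "linear_functional_on V f" "\<And>x. x \<in> V \<Longrightarrow> f x \<le> P x"
proof -
  obtain q where q: "sublinear_on V q" and qP: "\<And>x. x \<in> V \<Longrightarrow> q x \<le> P x"
    and min: "\<And>r x. sublinear_on V r \<Longrightarrow> (\<And>y. y \<in> V \<Longrightarrow> r y \<le> q y) \<Longrightarrow> x \<in> V \<Longrightarrow> r x = q x"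
    using exists_minimal_sublinear[OF V P] by blast
  have add: "q (x + v) = q x + q v" if x: "x \<in> V" and v: "v \<in> V" for x v
  proof -
    have "sublinear_slope q v x = q x"
      using sublinear_slope_sublinear[OF V q v] sublinear_slope_le_self[OF V q v] x by (rule min)
    then have "q x + q v \<le> q (x + v)"
      using sublinear_slope_le[OF V q v x, of 1] by simp
    moreover have "q (x + v) \<le> q x + q v" using q x v unfolding sublinear_on_def by blast
    ultimately show ?thesis by simp
  qed
  have neg: "q (- x) = - q x" if "x \<in> V" for x
    using add[OF that subspace_neg[OF V that]] sublinear_on_zero[OF V q] by simp
  have "q (c *\<^sub>R x) = c * q x" if x: "x \<in> V" for c x
  proof (cases "0 \<le> c")
    case True
    then show ?thesis using sublinear_scale_eq[OF V q x x] by simp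
  next
    case False
    then have "q ((- c) *\<^sub>R x) = (- c) * q x" using sublinear_scale_eq[OF V q x x, of "- c"] by simp
    then show ?thesis using neg[OF subspace_scale[OF V x, of c]] by simp
  qed
  then have "linear_functional_on V q" using add unfolding linear_functional_on_def by blast
  then show thesis using qP by (rule that)
qed

text \<open>The directional derivative of \<open>P\<close> at \<open>h\<close> lies below
  \<open>P\<close> and is at most \<open>- P h\<close> in direction \<open>- h\<close>. A linear
  functional below it therefore satisfies both \<open>f h \<le> P h\<close> and
  \<open>f h \<ge> P h\<close>.\<close>

theorem hahn_banach_touching:
  assumes V: "subspace V" and P: "sublinear_on V P" and h: "h \<in> V"
  obtains f where "linear_functional_on V f" "\<And>x. x \<in> V \<Longrightarrow> f x \<le> P x" "f h = P h"
proof -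
  obtain f where f: "linear_functional_on V f" and le: "\<And>x. x \<in> V \<Longrightarrow> f x \<le> sublinear_slope P h x"
    using exists_linear_below_sublinear[OF V sublinear_slope_sublinear[OF V P h]] by blast
  have leP: "f x \<le> P x" if "x \<in> V" for x
    using le[OF that] sublinear_slope_le_self[OF V P h that] by simp
  have nh: "- h \<in> V" using V h by (rule subspace_neg)
  have "f (- h) \<le> - P h"
    using le[OF nh] sublinear_slope_le[OF V P h nh, of 1] sublinear_on_zero[OF V P] by simp
  moreover have "f ((-1) *\<^sub>R h) = (-1) * f h" using f h unfolding linear_functional_on_def by blast
  ultimately have "f h = P h" using leP[OF h] by simp
  with f leP show thesis by (rule that)
qed

section \<open>Positive functionals on vector lattices\<close>

fun lipschitz_const :: "'e lexpr \<Rightarrow> real" where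
  "lipschitz_const (Atom x) = 1"
| "lipschitz_const (Add e1 e2) = lipschitz_const e1 + lipschitz_const e2"
| "lipschitz_const (Scale c e) = \<bar>c\<bar> * lipschitz_const e"
| "lipschitz_const (Sup e1 e2) = lipschitz_const e1 + lipschitz_const e2"

lemma lipschitz_const_nonneg: "0 \<le> lipschitz_const e"
  by (induction e) auto

lemma finite_atoms: "finite (set_lexpr e)"
  by (induction e) auto

lemma eval_real_lipschitz:
  assumes "\<And>x. x \<in> set_lexpr e \<Longrightarrow> \<bar>a x - b x\<bar> \<le> \<epsilon>" "0 \<le> \<epsilon>"
  shows "\<bar>eval_real a e - eval_real b e\<bar> \<le> lipschitz_const e * \<epsilon>"
  using assms(1)
proof (induction e)
  case (Atom x)
  then show ?case by simp
next
  case (Add e1 e2)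
  then have "\<bar>eval_real a e1 - eval_real b e1\<bar> \<le> lipschitz_const e1 * \<epsilon>"
    "\<bar>eval_real a e2 - eval_real b e2\<bar> \<le> lipschitz_const e2 * \<epsilon>" by auto
  then show ?case by (simp add: distrib_right)
next
  case (Scale c e)
  then have "\<bar>eval_real a e - eval_real b e\<bar> \<le> lipschitz_const e * \<epsilon>" by auto
  then have "\<bar>c\<bar> * \<bar>eval_real a e - eval_real b e\<bar> \<le> \<bar>c\<bar> * (lipschitz_const e * \<epsilon>)"
    by (rule mult_left_mono) simp
  then show ?case by (simp add: abs_mult[symmetric] right_diff_distrib mult.assoc)
next
  case (Sup e1 e2)
  then have "\<bar>eval_real a e1 - eval_real b e1\<bar> \<le> lipschitz_const e1 * \<epsilon>"
    "\<bar>eval_real a e2 - eval_real b e2\<bar> \<le> lipschitz_const e2 * \<epsilon>" by auto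
  moreover have "0 \<le> lipschitz_const e1 * \<epsilon>" "0 \<le> lipschitz_const e2 * \<epsilon>"
    using assms(2) by (auto simp: lipschitz_const_nonneg)
  ultimately show ?case unfolding eval_real.simps lipschitz_const.simps distrib_right by linarith
qed

text \<open>Positive homogeneity lets masses of pieces and normalising constants move into the
  functionals. A negative factor would turn \<open>Sup\<close> into an infimum.\<close>

lemma eval_real_scale:
  assumes "0 \<le> c"
  shows "eval_real (\<lambda>x. c * a x) e = c * eval_real a e"
  using assms by (induction e) (auto simp: algebra_simps max_mult_distrib_left)

section \<open>Order arithmetic in a vector lattice given by a carrier set\<close>

locale vector_lattice_on =
  fixes V :: "'y::real_vector set" and le :: "'y \<Rightarrow> 'y \<Rightarrow> bool"
  assumes subspace: "subspace V"
    and le_refl: "x \<in> V \<Longrightarrow> le x x"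
    and le_antisym: "x \<in> V \<Longrightarrow> y \<in> V \<Longrightarrow> le x y \<Longrightarrow> le y x \<Longrightarrow> x = y"
    and le_trans: "x \<in> V \<Longrightarrow> y \<in> V \<Longrightarrow> z \<in> V \<Longrightarrow> le x y \<Longrightarrow> le y z \<Longrightarrow> le x z"
    and le_add: "x \<in> V \<Longrightarrow> y \<in> V \<Longrightarrow> z \<in> V \<Longrightarrow> le x y \<Longrightarrow> le (x + z) (y + z)"
    and le_scale: "x \<in> V \<Longrightarrow> y \<in> V \<Longrightarrow> 0 \<le> c \<Longrightarrow> le x y \<Longrightarrow> le (c *\<^sub>R x) (c *\<^sub>R y)"
    and sup_exists: "x \<in> V \<Longrightarrow> y \<in> V \<Longrightarrow> \<exists>s. is_lsup V le x y s"
begin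

lemma zero_in [simp, intro]: "0 \<in> V"
  and add_in [simp, intro]: "x \<in> V \<Longrightarrow> y \<in> V \<Longrightarrow> x + y \<in> V"
  and diff_in [simp, intro]: "x \<in> V \<Longrightarrow> y \<in> V \<Longrightarrow> x - y \<in> V"
  and neg_in [simp, intro]: "x \<in> V \<Longrightarrow> - x \<in> V"
  and scale_in [simp, intro]: "x \<in> V \<Longrightarrow> c *\<^sub>R x \<in> V"
  using subspace by (auto intro: subspace_0 subspace_add subspace_diff subspace_neg subspace_scale)

lemma is_lsup_unique: "is_lsup V le x y s \<Longrightarrow> is_lsup V le x y t \<Longrightarrow> s = t"
  unfolding is_lsup_def using le_antisym by blast

lemma lsup_eqI: "is_lsup V le x y s \<Longrightarrow> lsup V le x y = s"
  unfolding lsup_def using is_lsup_unique by blast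

lemma is_lsup_lsup: "x \<in> V \<Longrightarrow> y \<in> V \<Longrightarrow> is_lsup V le x y (lsup V le x y)"
  using sup_exists lsup_eqI by blast

lemma lsup_in [simp, intro]: "x \<in> V \<Longrightarrow> y \<in> V \<Longrightarrow> lsup V le x y \<in> V"
  and lsup_ge1: "x \<in> V \<Longrightarrow> y \<in> V \<Longrightarrow> le x (lsup V le x y)"
  and lsup_ge2: "x \<in> V \<Longrightarrow> y \<in> V \<Longrightarrow> le y (lsup V le x y)"
  and lsup_least: "x \<in> V \<Longrightarrow> y \<in> V \<Longrightarrow> z \<in> V \<Longrightarrow> le x z \<Longrightarrow> le y z \<Longrightarrow> le (lsup V le x y) z"
  using is_lsup_lsup unfolding is_lsup_def by blast+

lemma le_add_mono:
  assumes "x \<in> V" "y \<in> V" "z \<in> V" "w \<in> V" "le x y" "le z w"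
  shows "le (x + z) (y + w)"
proof -
  have "le (x + z) (y + z)" using assms by (intro le_add)
  moreover have "le (z + y) (w + y)" using assms by (intro le_add)
  ultimately show ?thesis using assms le_trans[of "x + z" "y + z" "y + w"] by (simp add: add.commute)
qed

lemma le_iff_diff: "x \<in> V \<Longrightarrow> y \<in> V \<Longrightarrow> le x y \<longleftrightarrow> le 0 (y - x)"
  using le_add[of x y "- x"] le_add[of 0 "y - x" x] by auto

lemma le_neg: "x \<in> V \<Longrightarrow> y \<in> V \<Longrightarrow> le x y \<Longrightarrow> le (- y) (- x)"
  using le_iff_diff[of x y] le_iff_diff[of "- y" "- x"] by simp

lemma scale_nonneg: "x \<in> V \<Longrightarrow> 0 \<le> c \<Longrightarrow> le 0 x \<Longrightarrow> le 0 (c *\<^sub>R x)"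
  using le_scale[of 0 x c] by simp

lemma add_nonneg: "x \<in> V \<Longrightarrow> y \<in> V \<Longrightarrow> le 0 x \<Longrightarrow> le 0 y \<Longrightarrow> le 0 (x + y)"
  using le_add_mono[of 0 x 0 y] by simp

lemma scale_mono_coeff: "u \<in> V \<Longrightarrow> le 0 u \<Longrightarrow> a \<le> b \<Longrightarrow> le (a *\<^sub>R u) (b *\<^sub>R u)"
  using scale_nonneg[of u "b - a"] le_iff_diff[of "a *\<^sub>R u" "b *\<^sub>R u"]
  by (simp add: scaleR_diff_left)

abbreviation pos :: "'y \<Rightarrow> 'y" where "pos x \<equiv> lsup V le x 0"

lemma pos_in [simp, intro]: "x \<in> V \<Longrightarrow> pos x \<in> V" by simp

lemma pos_nonneg: "x \<in> V \<Longrightarrow> le 0 (pos x)" by (simp add: lsup_ge2)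

lemma le_pos: "x \<in> V \<Longrightarrow> le x (pos x)" by (simp add: lsup_ge1)

lemma pos_of_nonpos: "x \<in> V \<Longrightarrow> le x 0 \<Longrightarrow> pos x = 0"
  by (rule lsup_eqI) (simp add: is_lsup_def le_refl)

lemma pos_of_nonneg: "x \<in> V \<Longrightarrow> le 0 x \<Longrightarrow> pos x = x"
  by (rule lsup_eqI) (simp add: is_lsup_def le_refl)

lemma pos_add_le: "x \<in> V \<Longrightarrow> y \<in> V \<Longrightarrow> le (pos (x + y)) (pos x + pos y)"
  by (rule lsup_least) (auto intro!: le_add_mono le_pos add_nonneg pos_nonneg)

lemma pos_scale_le: "x \<in> V \<Longrightarrow> 0 \<le> c \<Longrightarrow> le (pos (c *\<^sub>R x)) (c *\<^sub>R pos x)"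
  by (rule lsup_least) (auto intro!: le_scale le_pos scale_nonneg pos_nonneg)

lemma pos_neg: 
  assumes "x \<in> V"
  shows "pos (- x) = pos x - x"
proof (rule lsup_eqI, unfold is_lsup_def, intro conjI ballI impI)
  show "pos x - x \<in> V" using assms by simp
  show "le (- x) (pos x - x)" using assms pos_nonneg[of x] le_iff_diff[of "- x" "pos x - x"] by simp
  show "le 0 (pos x - x)" using assms le_pos[of x] le_iff_diff[of x "pos x"] by simp
  fix z assume z: "z \<in> V" and "le (- x) z \<and> le 0 z"
  then have "le 0 (x + z)" "le x (x + z)"
    using assms le_iff_diff[of "- x" z] le_iff_diff[of x "x + z"] by (auto simp: add.commute)
  then have "le (pos x) (x + z)" using assms z by (intro lsup_least) auto
  then show "le (pos x - x) z"
    using assms z le_iff_diff[of "pos x" "x + z"] le_iff_diff[of "pos x - x" z]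
    by (simp add: algebra_simps)
qed

lemma eval_lat_in:
  assumes "\<And>x. T x \<in> V"
  shows "eval_lat V le T e \<in> V"
  using assms by (induction e) auto

section \<open>Positive functionals and the order modulo their null elements\<close>

definition positive_functional :: "('y \<Rightarrow> real) \<Rightarrow> bool" where
  "positive_functional f \<longleftrightarrow> linear_functional_on V f \<and> (\<forall>x\<in>V. le 0 x \<longrightarrow> 0 \<le> f x)"

lemma positive_functional_add:
    "positive_functional f \<Longrightarrow> x \<in> V \<Longrightarrow> y \<in> V \<Longrightarrow> f (x + y) = f x + f y"
  and positive_functional_scale: "positive_functional f \<Longrightarrow> x \<in> V \<Longrightarrow> f (c *\<^sub>R x) = c * f x"
  and positive_functional_nonneg: "positive_functional f \<Longrightarrow> x \<in> V \<Longrightarrow> le 0 x \<Longrightarrow> 0 \<le> f x"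
  unfolding positive_functional_def linear_functional_on_def by blast+

lemma positive_functional_neg: "positive_functional f \<Longrightarrow> x \<in> V \<Longrightarrow> f (- x) = - f x"
  using positive_functional_scale[of f x "-1"] by simp

lemma positive_functional_diff:
  "positive_functional f \<Longrightarrow> x \<in> V \<Longrightarrow> y \<in> V \<Longrightarrow> f (x - y) = f x - f y"
  using positive_functional_add[of f x "- y"] by (simp add: positive_functional_neg)

lemma positive_functional_zero: "positive_functional f \<Longrightarrow> f 0 = 0"
  using positive_functional_scale[of f 0 0] by simp

lemma positive_functional_mono:
  "positive_functional f \<Longrightarrow> x \<in> V \<Longrightarrow> y \<in> V \<Longrightarrow> le x y \<Longrightarrow> f x \<le> f y"
  using positive_functional_nonneg[of f "y - x"] positive_functional_diff[of f y x] le_iff_diff[of x y]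
  by simp

text \<open>For positive \<open>f\<close> this is the order of the quotient by the null ideal of
  \<open>f\<close>: \<open>s \<le> t\<close> almost everywhere, if \<open>f\<close> is thought of as
  a measure.\<close>

definition le_mod :: "('y \<Rightarrow> real) \<Rightarrow> 'y \<Rightarrow> 'y \<Rightarrow> bool" where
  "le_mod f s t \<longleftrightarrow> f (pos (s - t)) = 0"

lemma le_mod_if_pos_le:
  assumes "positive_functional f" "s \<in> V" "t \<in> V" "w \<in> V" "le (pos (s - t)) w" "f w = 0"
  shows "le_mod f s t"
  using assms positive_functional_mono[of f "pos (s - t)" w]
    positive_functional_nonneg[of f "pos (s - t)"] pos_nonneg[of "s - t"]
  unfolding le_mod_def by simp

lemma le_mod_of_le:
  assumes "positive_functional f" "s \<in> V" "t \<in> V" "le s t"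
  shows "le_mod f s t"
  using assms le_iff_diff[of s t] le_iff_diff[of "s - t" 0] pos_of_nonpos[of "s - t"]
    positive_functional_zero
  unfolding le_mod_def by simp

lemma le_mod_imp_le:
  assumes "positive_functional f" "s \<in> V" "t \<in> V" "le_mod f s t"
  shows "f s \<le> f t"
  using assms positive_functional_mono[of f "s - t" "pos (s - t)"] le_pos[of "s - t"]
    positive_functional_diff[of f s t]
  unfolding le_mod_def by simp

lemma le_mod_add:
  assumes "positive_functional f" "s \<in> V" "t \<in> V" "s' \<in> V" "t' \<in> V" "le_mod f s t" "le_mod f s' t'"
  shows "le_mod f (s + s') (t + t')"
  using assms pos_add_le[of "s - t" "s' - t'"]
  by (intro le_mod_if_pos_le[where w = "pos (s - t) + pos (s' - t')"])
    (auto simp: le_mod_def positive_functional_add algebra_simps)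

lemma le_mod_trans:
  assumes "positive_functional f" "s \<in> V" "t \<in> V" "w \<in> V" "le_mod f s t" "le_mod f t w"
  shows "le_mod f s w"
  using assms le_mod_add[of f s t t w] unfolding le_mod_def by simp

lemma le_mod_scale:
  assumes "positive_functional f" "s \<in> V" "t \<in> V" "0 \<le> c" "le_mod f s t"
  shows "le_mod f (c *\<^sub>R s) (c *\<^sub>R t)"
  using assms pos_scale_le[of "s - t" c]
  by (intro le_mod_if_pos_le[where w = "c *\<^sub>R pos (s - t)"])
    (auto simp: le_mod_def positive_functional_scale scaleR_diff_right)

lemma le_mod_neg:
  assumes "s \<in> V" "t \<in> V" "le_mod f s t"
  shows "le_mod f (- t) (- s)"
  using assms unfolding le_mod_def by simp

text \<open>The supremum of s and t lies below w + (s - w)^+ + (t - w)^+, and both positive parts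
  are null for \<open>f\<close>.\<close>

lemma le_mod_lsup:
  assumes f: "positive_functional f" and V: "s \<in> V" "t \<in> V" "w \<in> V"
    and le: "le_mod f s w" "le_mod f t w"
  shows "le_mod f (lsup V le s t) w"
proof (rule le_mod_if_pos_le[OF f])
  let ?w = "pos (s - w) + pos (t - w)"
  have w: "le 0 ?w" using V by (intro add_nonneg pos_nonneg) auto
  have "le s (?w + w)"
  proof -
    have "le (s - w) (pos (s - w))" "le 0 (pos (t - w))"
      using V by (auto intro: le_pos pos_nonneg)
    from le_add_mono[OF _ _ _ _ this] have "le (s - w + 0) ?w" using V by auto
    then show ?thesis using V le_add[of "s - w" ?w w] by simp
  qed
  moreover have "le t (?w + w)"
  proof -
    have "le (t - w) (pos (t - w))" "le 0 (pos (s - w))"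
      using V by (auto intro: le_pos pos_nonneg)
    from le_add_mono[OF _ _ _ _ this(2,1)] have "le (0 + (t - w)) ?w" using V by auto
    then show ?thesis using V le_add[of "t - w" ?w w] by simp
  qed
  ultimately have "le (lsup V le s t) (?w + w)" using V by (intro lsup_least) auto
  then have "le (lsup V le s t - w) ?w" using V le_add[of "lsup V le s t" "?w + w" "- w"] by simp
  then show "le (pos (lsup V le s t - w)) ?w" using V w by (intro lsup_least) auto
  show "f ?w = 0" using le V by (simp add: positive_functional_add[OF f] le_mod_def)
qed (use V in auto)

section \<open>Cutting a positive functional into localized pieces\<close>

definition dominated :: "('y \<Rightarrow> real) \<Rightarrow> ('y \<Rightarrow> real) \<Rightarrow> bool" where
  "dominated f g \<longleftrightarrow> (\<forall>x\<in>V. le 0 x \<longrightarrow> f x \<le> g x)"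

text \<open>A smaller positive functional has a larger null ideal. Bounds established for a
  functional are thus inherited by all pieces into which it is cut later.\<close>

lemma le_mod_dominated:
  assumes "positive_functional f" "dominated f g" "s \<in> V" "t \<in> V" "le_mod g s t"
  shows "le_mod f s t"
  using assms pos_nonneg[of "s - t"] positive_functional_nonneg[of f "pos (s - t)"]
  unfolding le_mod_def dominated_def by (metis antisym diff_in pos_in)

text \<open>The functional \<open>f\<close> is \<open>y\<close> restricted to the region where \<open>h\<close> is positive.\<close>

lemma split_functional:
  assumes y: "positive_functional y" and h: "h \<in> V"
  obtains f where "positive_functional f" "positive_functional (\<lambda>x. y x - f x)"
    "f (pos (- h)) = 0" "y (pos h) - f (pos h) = 0"
proof -
  have "sublinear_on V (\<lambda>x. y (pos x))"
    unfolding sublinear_on_def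
  proof (intro conjI ballI allI impI)
    fix x z assume "x \<in> V" "z \<in> V"
    then show "y (pos (x + z)) \<le> y (pos x) + y (pos z)"
      using positive_functional_mono[OF y _ _ pos_add_le[of x z]]
      by (simp add: positive_functional_add[OF y])
  next
    fix x and c :: real assume "x \<in> V" "0 < c"
    then show "y (pos (c *\<^sub>R x)) \<le> c * y (pos x)"
      using positive_functional_mono[OF y _ _ pos_scale_le[of x c]]
      by (simp add: positive_functional_scale[OF y])
  qed
  from hahn_banach_touching[OF subspace this h] obtain f where f: "linear_functional_on V f"
    and le: "\<And>x. x \<in> V \<Longrightarrow> f x \<le> y (pos x)" and fh: "f h = y (pos h)" by blast
  have neg: "f (- x) = - f x" if "x \<in> V" for x
  proof -
    have "f ((-1) *\<^sub>R x) = (-1) * f x" using f that unfolding linear_functional_on_def by blast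
    then show ?thesis by simp
  qed
  have nonneg: "0 \<le> f x" if x: "x \<in> V" "le 0 x" for x
  proof -
    have "pos (- x) = 0" using x le_neg[of 0 x] by (intro pos_of_nonpos) auto
    then show ?thesis
      using le[of "- x"] neg[of x] x positive_functional_zero[OF y] by simp
  qed
  then have pf: "positive_functional f" using f by (simp add: positive_functional_def)
  have dom: "f x \<le> y x" if "x \<in> V" "le 0 x" for x
    using le[of x] that by (simp add: pos_of_nonneg)
  have pd: "positive_functional (\<lambda>x. y x - f x)"
    using y f dom unfolding positive_functional_def linear_functional_on_def
    by (auto simp: algebra_simps)
  \<comment> \<open>Since \<open>pos h - h\<close> is \<open>pos (- h)\<close>, the left side is
    nonnegative, while domination by \<open>y\<close> makes the right side nonpositive; both
    vanish.\<close>
  have "f (pos h - h) = f (pos h) - y (pos h)"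
    using positive_functional_diff[OF pf] h fh by simp
  moreover have "f (pos h) \<le> y (pos h)" using h by (intro dom) (auto intro: pos_nonneg)
  moreover have "0 \<le> f (pos (- h))" using h by (intro nonneg) (auto intro: pos_nonneg)
  ultimately have "f (pos (- h)) = 0" "y (pos h) - f (pos h) = 0"
    using h by (auto simp: pos_neg)
  with pf pd show thesis by (rule that)
qed

text \<open>A list rather than a set, because equal pieces have to be counted with multiplicity in
  the sum.\<close>

definition decomposes :: "('y \<Rightarrow> real) list \<Rightarrow> ('y \<Rightarrow> real) \<Rightarrow> bool" where
  "decomposes fs y \<longleftrightarrow> (\<forall>f\<in>set fs. positive_functional f \<and> dominated f y)
     \<and> (\<forall>x\<in>V. y x = (\<Sum>f\<leftarrow>fs. f x))"

lemma dominated_trans: "dominated f g \<Longrightarrow> dominated g h \<Longrightarrow> dominated f h"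
  unfolding dominated_def by (meson order_trans)

lemma decomposes_append:
  assumes "decomposes fs f" "decomposes gs g" "positive_functional f" "positive_functional g"
    "\<And>x. x \<in> V \<Longrightarrow> y x = f x + g x"
  shows "decomposes (fs @ gs) y"
proof -
  have "dominated f y"
    using assms(5) positive_functional_nonneg[OF assms(4)] by (simp add: dominated_def)
  moreover have "dominated g y"
    using assms(5) positive_functional_nonneg[OF assms(3)] by (simp add: dominated_def)
  ultimately show ?thesis using assms(1,2,5) unfolding decomposes_def by (auto intro: dominated_trans)
qed

lemma decomposes_concat:
  assumes "decomposes fs y" "\<And>f. f \<in> set fs \<Longrightarrow> decomposes (D f) f"
  shows "decomposes (concat (map D fs)) y"
proof -
  have "(\<Sum>f\<leftarrow>fs. f x) = (\<Sum>g\<leftarrow>concat (map D fs). g x)" if "x \<in> V" for x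
    using assms(2) that
  proof (induction fs)
    case (Cons f fs)
    then have "f x = (\<Sum>g\<leftarrow>D f. g x)" unfolding decomposes_def by simp
    moreover have "(\<Sum>f\<leftarrow>fs. f x) = (\<Sum>g\<leftarrow>concat (map D fs). g x)" using Cons by simp
    ultimately show ?case by simp
  qed simp
  moreover have "positive_functional g \<and> dominated g y" if g: "g \<in> set (concat (map D fs))" for g
  proof -
    obtain f where "f \<in> set fs" "g \<in> set (D f)" using g by auto
    then show ?thesis
      using assms(1) assms(2)[of f] dominated_trans[of g f y] unfolding decomposes_def by blast
  qed
  ultimately show ?thesis using assms(1) unfolding decomposes_def by simp
qed

text \<open>Bisection of the range of t relative to u: the functional is split along
  \<open>t - m u\<close> at the midpoint m, so that one part sees only t \<ge> m u and the other
  only t \<le> m u. Each round halves the interval.\<close>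

lemma bisect_functional:
  assumes u: "u \<in> V" "le 0 u" and t: "t \<in> V"
    and y: "positive_functional y" and "le_mod y (a *\<^sub>R u) t" "le_mod y t (b *\<^sub>R u)"
  shows "\<exists>fs. decomposes fs y \<and>
    (\<forall>f\<in>set fs. \<exists>c. le_mod f (c *\<^sub>R u) t \<and> le_mod f t ((c + (b - a) / 2 ^ k) *\<^sub>R u))"
  using y assms(5,6)
proof (induction k arbitrary: y a b)
  case 0
  then show ?case by (intro exI[of _ "[y]"]) (auto simp: decomposes_def dominated_def)
next
  case (Suc k)
  define m where "m = (a + b) / 2"
  obtain f where f: "positive_functional f" and g: "positive_functional (\<lambda>x. y x - f x)"
    and f0: "f (pos (- (t - m *\<^sub>R u))) = 0" and g0: "y (pos (t - m *\<^sub>R u)) - f (pos (t - m *\<^sub>R u)) = 0"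
    using split_functional[OF Suc.prems(1), of "t - m *\<^sub>R u"] u t by blast
  define g where "g = (\<lambda>x. y x - f x)"
  have gp: "positive_functional g" using g by (simp add: g_def)
  have df: "dominated f y" using positive_functional_nonneg[OF gp] by (auto simp: dominated_def g_def)
  have dg: "dominated g y" using positive_functional_nonneg[OF f] by (auto simp: dominated_def g_def)
  have "le_mod f (m *\<^sub>R u) t" using f0 by (simp add: le_mod_def)
  moreover have "le_mod f t (b *\<^sub>R u)" using le_mod_dominated[OF f df _ _ Suc.prems(3)] u t by simp
  ultimately obtain fs where fs: "decomposes fs f"
    "\<forall>h\<in>set fs. \<exists>c. le_mod h (c *\<^sub>R u) t \<and> le_mod h t ((c + (b - m) / 2 ^ k) *\<^sub>R u)"
    using Suc.IH[OF f] by blast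
  have "le_mod g t (m *\<^sub>R u)" using g0 by (simp add: le_mod_def g_def)
  moreover have "le_mod g (a *\<^sub>R u) t" using le_mod_dominated[OF gp dg _ _ Suc.prems(2)] u t by simp
  ultimately obtain gs where gs: "decomposes gs g"
    "\<forall>h\<in>set gs. \<exists>c. le_mod h (c *\<^sub>R u) t \<and> le_mod h t ((c + (m - a) / 2 ^ k) *\<^sub>R u)"
    using Suc.IH[OF gp] by blast
  have eq: "(b - m) / 2 ^ k = (b - a) / 2 ^ Suc k" "(m - a) / 2 ^ k = (b - a) / 2 ^ Suc k"
    by (auto simp: m_def field_simps)
  have "decomposes (fs @ gs) y"
    using fs(1) gs(1) f gp by (rule decomposes_append) (simp add: g_def)
  then show ?case using fs(2) gs(2) unfolding eq by (intro exI[of _ "fs @ gs"]) auto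
qed

text \<open>The elements \<open>T x\<close> are localized one after the other. Earlier bounds
  survive later cuts, since \<open>le_mod\<close> passes to dominated functionals.\<close>

lemma localize_functional:
  assumes u: "u \<in> V" "le 0 u" and T: "\<And>x. T x \<in> V" and "finite X"
    and bound: "\<And>x. x \<in> X \<Longrightarrow> le (- u) (T x) \<and> le (T x) u"
    and y: "positive_functional y" and "0 < \<epsilon>"
  shows "\<exists>fs. decomposes fs y \<and> (\<forall>f\<in>set fs. \<exists>c. \<forall>x\<in>X.
    le_mod f ((c x - \<epsilon>) *\<^sub>R u) (T x) \<and> le_mod f (T x) ((c x + \<epsilon>) *\<^sub>R u))"
  using \<open>finite X\<close> bound
proof (induction X rule: finite_induct)
  case empty
  then show ?case using y by (intro exI[of _ "[y]"]) (auto simp: decomposes_def dominated_def)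
next
  case (insert z X)
  then obtain fs where fs: "decomposes fs y" and loc: "\<And>f. f \<in> set fs \<Longrightarrow> \<exists>c. \<forall>x\<in>X.
    le_mod f ((c x - \<epsilon>) *\<^sub>R u) (T x) \<and> le_mod f (T x) ((c x + \<epsilon>) *\<^sub>R u)" by auto
  obtain k :: nat where "1 / \<epsilon> < 2 ^ k" using real_arch_pow[of 2 "1 / \<epsilon>"] by auto
  then have k: "(1 - (-1)) / 2 ^ k \<le> 2 * \<epsilon>" using \<open>0 < \<epsilon>\<close> by (simp add: field_simps)
  have "\<exists>gs. decomposes gs f \<and> (\<forall>g\<in>set gs. \<exists>c. le_mod g (c *\<^sub>R u) (T z) \<and>
      le_mod g (T z) ((c + (1 - (-1)) / 2 ^ k) *\<^sub>R u))" if "f \<in> set fs" for f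
  proof (rule bisect_functional[OF u T[of z]])
    show f: "positive_functional f" using that fs by (auto simp: decomposes_def)
    show "le_mod f ((-1) *\<^sub>R u) (T z)" "le_mod f (T z) (1 *\<^sub>R u)"
      using insert.prems[of z] u T by (auto intro!: le_mod_of_le[OF f])
  qed
  then obtain D where D: "\<And>f. f \<in> set fs \<Longrightarrow> decomposes (D f) f"
    and Dl: "\<And>f g. f \<in> set fs \<Longrightarrow> g \<in> set (D f) \<Longrightarrow> \<exists>c. le_mod g (c *\<^sub>R u) (T z) \<and>
      le_mod g (T z) ((c + (1 - (-1)) / 2 ^ k) *\<^sub>R u)"
    by metis
  have "\<exists>c. \<forall>x\<in>insert z X. le_mod g ((c x - \<epsilon>) *\<^sub>R u) (T x) \<and> le_mod g (T x) ((c x + \<epsilon>) *\<^sub>R u)"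
    if gD: "g \<in> set (concat (map D fs))" for g
  proof -
    obtain f where f: "f \<in> set fs" "g \<in> set (D f)" using gD by auto
    have g: "positive_functional g" "dominated g f"
      using D[OF f(1)] f(2) by (auto simp: decomposes_def)
    obtain c where c: "\<forall>x\<in>X. le_mod f ((c x - \<epsilon>) *\<^sub>R u) (T x) \<and> le_mod f (T x) ((c x + \<epsilon>) *\<^sub>R u)"
      using loc[OF f(1)] by blast
    obtain d where d: "le_mod g (d *\<^sub>R u) (T z)" "le_mod g (T z) ((d + (1 - (-1)) / 2 ^ k) *\<^sub>R u)"
      using Dl[OF f] by blast
    \<comment> \<open>The interval found for \<open>T z\<close> is widened to [d, d + 2 \<epsilon>]
      and recorded by its centre \<open>d + \<epsilon>\<close>.\<close>
    have "le_mod g ((d + (1 - (-1)) / 2 ^ k) *\<^sub>R u) ((d + \<epsilon> + \<epsilon>) *\<^sub>R u)"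
      using u k by (intro le_mod_of_le[OF g(1)] scale_mono_coeff) auto
    then have d2: "le_mod g (T z) ((d + \<epsilon> + \<epsilon>) *\<^sub>R u)"
      using le_mod_trans[OF g(1) _ _ _ d(2)] u T by simp
    have "le_mod g ((c x - \<epsilon>) *\<^sub>R u) (T x) \<and> le_mod g (T x) ((c x + \<epsilon>) *\<^sub>R u)" if "x \<in> X" for x
      using c that u T le_mod_dominated[OF g] by simp
    with d(1) d2 \<open>z \<notin> X\<close> show ?thesis
      by (intro exI[of _ "c(z := d + \<epsilon>)"]) auto
  qed
  then show ?case using decomposes_concat[OF fs D] by blast
qed

text \<open>Addition, scaling and suprema all respect the order modulo null elements of
  \<open>f\<close>, so the atoms may be replaced by multiples of \<open>u\<close>; the error grows
  exactly as in the real Lipschitz bound.\<close>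

lemma eval_lat_localized:
  assumes u: "u \<in> V" "le 0 u" and T: "\<And>x. T x \<in> V" and f: "positive_functional f"
    and \<epsilon>: "0 \<le> \<epsilon>"
    and c: "\<And>x. x \<in> set_lexpr e \<Longrightarrow>
      le_mod f ((c x - \<epsilon>) *\<^sub>R u) (T x) \<and> le_mod f (T x) ((c x + \<epsilon>) *\<^sub>R u)"
  shows "le_mod f ((eval_real c e - lipschitz_const e * \<epsilon>) *\<^sub>R u) (eval_lat V le T e) \<and>
    le_mod f (eval_lat V le T e) ((eval_real c e + lipschitz_const e * \<epsilon>) *\<^sub>R u)"
  using c
proof (induction e)
  case (Atom x)
  then show ?case by simp
next
  case (Add e1 e2)
  have in_V: "eval_lat V le T e \<in> V" for e using T by (rule eval_lat_in)
  have 1: "le_mod f ((eval_real c e1 - lipschitz_const e1 * \<epsilon>) *\<^sub>R u) (eval_lat V le T e1)"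
    "le_mod f (eval_lat V le T e1) ((eval_real c e1 + lipschitz_const e1 * \<epsilon>) *\<^sub>R u)"
    and 2: "le_mod f ((eval_real c e2 - lipschitz_const e2 * \<epsilon>) *\<^sub>R u) (eval_lat V le T e2)"
    "le_mod f (eval_lat V le T e2) ((eval_real c e2 + lipschitz_const e2 * \<epsilon>) *\<^sub>R u)"
    using Add by auto
  from le_mod_add[OF f _ _ _ _ 1(1) 2(1)] le_mod_add[OF f _ _ _ _ 1(2) 2(2)]
  show ?case using u in_V by (simp add: algebra_simps)
next
  case (Scale k e)
  have in_V: "eval_lat V le T e \<in> V" for e using T by (rule eval_lat_in)
  have 1: "le_mod f ((eval_real c e - lipschitz_const e * \<epsilon>) *\<^sub>R u) (eval_lat V le T e)"
    "le_mod f (eval_lat V le T e) ((eval_real c e + lipschitz_const e * \<epsilon>) *\<^sub>R u)"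
    using Scale by auto
  show ?case
  proof (cases "0 \<le> k")
    case True
    from le_mod_scale[OF f _ _ True 1(1)] le_mod_scale[OF f _ _ True 1(2)] True
    show ?thesis using u in_V by (simp add: algebra_simps)
  next
    case False
    then have k: "0 \<le> - k" by simp
    from le_mod_neg[OF _ _ le_mod_scale[OF f _ _ k 1(1)]] le_mod_neg[OF _ _ le_mod_scale[OF f _ _ k 1(2)]] False
    show ?thesis using u in_V by (simp add: algebra_simps)
  qed
next
  case (Sup e1 e2)
  have in_V: "eval_lat V le T e \<in> V" for e using T by (rule eval_lat_in)
  have 1: "le_mod f ((eval_real c e1 - lipschitz_const e1 * \<epsilon>) *\<^sub>R u) (eval_lat V le T e1)"
    "le_mod f (eval_lat V le T e1) ((eval_real c e1 + lipschitz_const e1 * \<epsilon>) *\<^sub>R u)"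
    and 2: "le_mod f ((eval_real c e2 - lipschitz_const e2 * \<epsilon>) *\<^sub>R u) (eval_lat V le T e2)"
    "le_mod f (eval_lat V le T e2) ((eval_real c e2 + lipschitz_const e2 * \<epsilon>) *\<^sub>R u)"
    using Sup by auto
  define l where "l = lipschitz_const (Sup e1 e2) * \<epsilon>"
  have l: "lipschitz_const e1 * \<epsilon> \<le> l" "lipschitz_const e2 * \<epsilon> \<le> l"
    using \<epsilon> by (auto simp: l_def distrib_right lipschitz_const_nonneg)
  let ?M = "max (eval_real c e1) (eval_real c e2)" and ?s = "lsup V le (eval_lat V le T e1) (eval_lat V le T e2)"
  have coeff: "le_mod f (a *\<^sub>R u) (b *\<^sub>R u)" if "a \<le> b" for a b
    using u that by (intro le_mod_of_le[OF f] scale_mono_coeff) auto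
  have "le_mod f (eval_lat V le T e1) ((?M + l) *\<^sub>R u)"
    by (rule le_mod_trans[OF f _ _ _ 1(2) coeff]) (use u in_V l in auto)
  moreover have "le_mod f (eval_lat V le T e2) ((?M + l) *\<^sub>R u)"
    by (rule le_mod_trans[OF f _ _ _ 2(2) coeff]) (use u in_V l in auto)
  ultimately have up: "le_mod f ?s ((?M + l) *\<^sub>R u)"
    using u in_V by (intro le_mod_lsup[OF f]) auto
  have "le_mod f ((eval_real c e1 - l) *\<^sub>R u) (eval_lat V le T e1)"
    by (rule le_mod_trans[OF f _ _ _ coeff 1(1)]) (use u in_V l in auto)
  then have s1: "le_mod f ((eval_real c e1 - l) *\<^sub>R u) ?s"
    by (rule le_mod_trans[OF f, rotated 3]) (use u in_V in \<open>auto intro!: le_mod_of_le[OF f] lsup_ge1\<close>)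
  have "le_mod f ((eval_real c e2 - l) *\<^sub>R u) (eval_lat V le T e2)"
    by (rule le_mod_trans[OF f _ _ _ coeff 2(1)]) (use u in_V l in auto)
  then have s2: "le_mod f ((eval_real c e2 - l) *\<^sub>R u) ?s"
    by (rule le_mod_trans[OF f, rotated 3]) (use u in_V in \<open>auto intro!: le_mod_of_le[OF f] lsup_ge2\<close>)
  have "le_mod f ((?M - l) *\<^sub>R u) ?s" using s1 s2 by (simp add: max_def)
  with up show ?case by (simp add: l_def)
qed

lemma exists_order_bound:
  assumes "finite X" "\<And>x. T x \<in> V"
  shows "\<exists>u\<in>V. le 0 u \<and> (\<forall>x\<in>X. le (- u) (T x) \<and> le (T x) u)"
  using assms(1)
proof (induction X rule: finite_induct)
  case empty
  then show ?case by (auto intro: le_refl)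
next
  case (insert z X)
  then obtain u where u: "u \<in> V" "le 0 u" and X: "\<And>x. x \<in> X \<Longrightarrow> le (- u) (T x) \<and> le (T x) u" by blast
  define a where "a = lsup V le (T z) (- T z)"
  have a: "a \<in> V" "le (T z) a" "le (- T z) a"
    using assms(2) by (auto simp: a_def intro: lsup_ge1 lsup_ge2)
  define w where "w = lsup V le u a"
  have w: "w \<in> V" "le u w" "le a w" using u a by (auto simp: w_def intro: lsup_ge1 lsup_ge2)
  have "le (T z) w" "le (- T z) w" using a w assms(2) by (auto intro: le_trans[of _ a w])
  then have "le (- w) (T z)" using le_neg[of "- T z" w] w assms(2) by simp
  moreover have "le (- w) (T x) \<and> le (T x) w" if "x \<in> X" for x
    using X[OF that] w u assms(2) le_neg[of u w] le_trans[of "- w" "- u" "T x"] le_trans[of "T x" u w]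
    by auto
  moreover have "le 0 w" using u w le_trans[of 0 u w] by simp
  ultimately show ?case using w \<open>le (T z) w\<close> by (intro bexI[of _ w]) auto
qed

text \<open>Lattice expressions are evaluated, up to a small error, by real-valued functionals: on each
  sufficiently small piece of \<open>y\<close> all atoms are almost constant multiples of an order unit \<open>u\<close>.\<close>

theorem eval_lat_decomposition:
  assumes T: "\<And>x. T x \<in> V" and y: "positive_functional y" and "0 < \<eta>"
  obtains fs where "decomposes fs y"
    "\<bar>y (eval_lat V le T e) - (\<Sum>f\<leftarrow>fs. eval_real (\<lambda>x. f (T x)) e)\<bar> \<le> \<eta>"
proof -
  obtain u where u: "u \<in> V" "le 0 u"
    and bound: "\<And>x. x \<in> set_lexpr e \<Longrightarrow> le (- u) (T x) \<and> le (T x) u"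
    using exists_order_bound[where T = T, OF finite_atoms T, of e] by blast
  have yu: "0 \<le> y u" using y u by (rule positive_functional_nonneg)
  let ?L = "lipschitz_const e"
  \<comment> \<open>The factor 2 in \<epsilon> pays for two comparisons on each piece: both
    \<open>f (eval_lat V le T e)\<close> and the real evaluation are measured against
    \<open>f u * eval_real c e\<close>. The summand 1 keeps d positive when the Lipschitz constant
    or \<open>y u\<close> vanishes.\<close>
  define d where "d = ?L * y u + 1"
  define \<epsilon> where "\<epsilon> = \<eta> / (2 * d)"
  have den: "0 < d" using lipschitz_const_nonneg[of e] yu by (simp add: d_def add_nonneg_pos)
  then have \<epsilon>: "0 < \<epsilon>" using \<open>0 < \<eta>\<close> by (simp add: \<epsilon>_def)
  obtain fs where fs: "decomposes fs y" and loc: "\<And>f. f \<in> set fs \<Longrightarrow> \<exists>c. \<forall>x\<in>set_lexpr e.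
    le_mod f ((c x - \<epsilon>) *\<^sub>R u) (T x) \<and> le_mod f (T x) ((c x + \<epsilon>) *\<^sub>R u)"
    using localize_functional[where T = T, OF u T finite_atoms bound y \<epsilon>] by blast
  have piece: "\<bar>f (eval_lat V le T e) - eval_real (\<lambda>x. f (T x)) e\<bar> \<le> 2 * ?L * \<epsilon> * f u"
    if ff: "f \<in> set fs" for f
  proof -
    have f: "positive_functional f" using ff fs by (auto simp: decomposes_def)
    have fu: "0 \<le> f u" using f u by (rule positive_functional_nonneg)
    obtain c where c: "\<And>x. x \<in> set_lexpr e \<Longrightarrow>
      le_mod f ((c x - \<epsilon>) *\<^sub>R u) (T x) \<and> le_mod f (T x) ((c x + \<epsilon>) *\<^sub>R u)"
      using loc[OF ff] by blast
    have "le_mod f ((eval_real c e - ?L * \<epsilon>) *\<^sub>R u) (eval_lat V le T e)"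
      "le_mod f (eval_lat V le T e) ((eval_real c e + ?L * \<epsilon>) *\<^sub>R u)"
      using eval_lat_localized[where T = T, OF u T f _ c] \<epsilon> by auto
    from this[THEN le_mod_imp_le[OF f, rotated 2]]
    have "(eval_real c e - ?L * \<epsilon>) * f u \<le> f (eval_lat V le T e)"
      "f (eval_lat V le T e) \<le> (eval_real c e + ?L * \<epsilon>) * f u"
      using u eval_lat_in[where T = T, OF T] by (auto simp: positive_functional_scale[OF f])
    then have 1: "\<bar>f (eval_lat V le T e) - f u * eval_real c e\<bar> \<le> ?L * \<epsilon> * f u"
      by (simp add: abs_le_iff algebra_simps)
    have "\<bar>f (T x) - f u * c x\<bar> \<le> \<epsilon> * f u" if "x \<in> set_lexpr e" for x
    proof -
      have "(c x - \<epsilon>) * f u \<le> f (T x)" "f (T x) \<le> (c x + \<epsilon>) * f u"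
        using c[OF that] le_mod_imp_le[OF f, of "(c x - \<epsilon>) *\<^sub>R u" "T x"]
          le_mod_imp_le[OF f, of "T x" "(c x + \<epsilon>) *\<^sub>R u"] u T
        by (auto simp: positive_functional_scale[OF f])
      then show ?thesis by (simp add: abs_le_iff algebra_simps)
    qed
    then have "\<bar>eval_real (\<lambda>x. f (T x)) e - eval_real (\<lambda>x. f u * c x) e\<bar> \<le> ?L * (\<epsilon> * f u)"
      using \<epsilon> fu by (intro eval_real_lipschitz) auto
    then have "\<bar>eval_real (\<lambda>x. f (T x)) e - f u * eval_real c e\<bar> \<le> ?L * \<epsilon> * f u"
      by (simp add: eval_real_scale[OF fu] mult.assoc)
    with 1 show ?thesis by (simp add: abs_le_iff)
  qed
  have "\<bar>(\<Sum>f\<leftarrow>gs. f (eval_lat V le T e)) - (\<Sum>f\<leftarrow>gs. eval_real (\<lambda>x. f (T x)) e)\<bar>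
    \<le> 2 * ?L * \<epsilon> * (\<Sum>f\<leftarrow>gs. f u)" if "set gs \<subseteq> set fs" for gs
    using that
  proof (induction gs)
    case (Cons f gs)
    then show ?case using piece[of f] by (simp add: distrib_left)
  qed simp
  from this[OF order_refl] have "\<bar>y (eval_lat V le T e) - (\<Sum>f\<leftarrow>fs. eval_real (\<lambda>x. f (T x)) e)\<bar>
    \<le> 2 * ?L * \<epsilon> * y u"
    using fs eval_lat_in[where T = T, OF T] u unfolding decomposes_def by simp
  also have "\<dots> = 2 * \<epsilon> * (?L * y u)" by simp
  also have "\<dots> \<le> 2 * \<epsilon> * d" using \<epsilon> by (simp add: d_def)
  also have "\<dots> = \<eta>" using den by (simp add: \<epsilon>_def)
  finally show thesis using fs that by blast
qed

text \<open>A transfer principle: on each piece the numbers \<open>f (T x)\<close> are nonnegative,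
  so an inequality valid for nonnegative reals holds piecewise, and its sum is \<open>y\<close> of
  the lattice expression up to an arbitrarily small error.\<close>

corollary eval_lat_transfer_nonneg:
  assumes T: "\<And>x. T x \<in> V" "\<And>x. le 0 (T x)" and y: "positive_functional y"
    and e: "\<And>a. (\<And>x. 0 \<le> a x) \<Longrightarrow> 0 \<le> eval_real a e"
  shows "0 \<le> y (eval_lat V le T e)"
proof (rule field_le_epsilon)
  fix \<eta> :: real assume "0 < \<eta>"
  then obtain fs where fs: "decomposes fs y"
    and le: "\<bar>y (eval_lat V le T e) - (\<Sum>f\<leftarrow>fs. eval_real (\<lambda>x. f (T x)) e)\<bar> \<le> \<eta>"
    using eval_lat_decomposition[where T = T, OF T(1) y] by blast
  have "0 \<le> (\<Sum>f\<leftarrow>fs. eval_real (\<lambda>x. f (T x)) e)"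
    using fs T positive_functional_nonneg unfolding decomposes_def
    by (intro sum_list_nonneg) (auto intro!: e)
  with le show "0 \<le> y (eval_lat V le T e) + \<eta>" by simp
qed

end

section \<open>Upper estimates\<close>

text \<open>Young's inequality for the factors 1 - t and 1 with exponents q and q / (q - 1).\<close>

lemma bernoulli_powr:
  fixes t q :: real
  assumes "0 \<le> t" "t \<le> 1" "1 < q"
  shows "1 - q * t \<le> (1 - t) powr q"
proof -
  have "(1 - t) * 1 \<le> (1 - t) powr q / q + 1 powr (q / (q - 1)) / (q / (q - 1))"
    using assms by (intro Youngs_inequality) (auto simp: field_simps)
  then have "q * (1 - t) \<le> q * ((1 - t) powr q / q + (q - 1) / q)"
    using assms by (intro mult_left_mono) auto
  also have "\<dots> = (1 - t) powr q + (q - 1)" using assms by (simp add: distrib_left)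
  finally have "q * (1 - t) \<le> (1 - t) powr q + (q - 1)" .
  then show ?thesis by (simp add: algebra_simps)
qed

text \<open>Duality of the p- and q-norms in the plane. The extremal choice \<alpha> = b^(q-1),
  \<beta> = b'^(q-1) has \<alpha>^p = b^q and \<beta>^p = b'^q, so the hypothesis reads s \<le>
  s^(1/p), which fails for s > 1.\<close>

lemma conjugate_norm_le_one:
  fixes b b' p q :: real
  assumes "1 < p" and q: "q = p / (p - 1)" and nn: "0 \<le> b" "0 \<le> b'"
    and le: "\<And>\<alpha> \<beta>. 0 \<le> \<alpha> \<Longrightarrow> 0 \<le> \<beta> \<Longrightarrow> \<alpha> * b + \<beta> * b' \<le> (\<alpha> powr p + \<beta> powr p) powr (1 / p)"
  shows "b powr q + b' powr q \<le> 1"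
proof (rule ccontr)
  define s where "s = b powr q + b' powr q"
  assume "\<not> ?thesis"
  then have s: "1 < s" by (simp add: s_def)
  have q1: "(q - 1) * p = q" using \<open>1 < p\<close> by (simp add: q field_simps)
  have mul: "x powr (q - 1) * x = x powr q" if "0 \<le> x" for x :: real
    using that powr_mult_base[of x "q - 1"] by (simp add: mult.commute)
  have "s \<le> s powr (1 / p)"
    using le[of "b powr (q - 1)" "b' powr (q - 1)"] nn by (simp add: mul powr_powr q1 s_def)
  moreover have "s powr (1 / p) < s powr 1"
    using s \<open>1 < p\<close> by (intro powr_less_mono) auto
  ultimately show False using s by simp
qed

text \<open>The two truncations are disjointly supported, and their sum fails to dominate
  \<open>max w z / (1 + 1 / K)\<close> only if \<open>z\<close> is close to \<open>c w\<close>, with \<open>c = 1 + k / K\<^sup>2\<close>; this happens for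
  at most one \<open>k\<close>.\<close>

lemma max_le_average_of_truncations:
  fixes w z :: real and K :: nat
  assumes w: "0 \<le> w" and z: "0 \<le> z" and K: "1 \<le> K"
  defines "c \<equiv> \<lambda>k. 1 + real k / (real K)\<^sup>2" and "N \<equiv> 10 * (real K)\<^sup>2"
  shows "(real K - 1) / (1 + 1 / real K) * max w z \<le>
    (\<Sum>k<K. min w (N * max (c k * w - z) 0) + min z (N * max (z - c k * w) 0))"
proof -
  define m where "m = max w z / (1 + 1 / real K)"
  define t where "t k = min w (N * max (c k * w - z) 0) + min z (N * max (z - c k * w) 0)" for k
  have D: "0 < 1 + 1 / real K" by (simp add: add_pos_nonneg)
  have K2: "0 < (real K)\<^sup>2" and N: "0 < N" using K by (auto simp: N_def)
  have t_nonneg: "0 \<le> t k" for k using w z N by (simp add: t_def)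
  have m_nonneg: "0 \<le> m" using w by (simp add: m_def)
  have c_le: "c k \<le> 1 + 1 / real K" if "k < K" for k
    using that K by (simp add: c_def power2_eq_square field_simps)
  have c_le2: "c k \<le> 2" if "k < K" for k using c_le[OF that] K by (simp add: order_trans)
  have c_ge: "1 \<le> c k" for k by (simp add: c_def)
  \<comment> \<open>An index is bad if neither truncation reaches its cap \<open>w\<close> or
    \<open>z\<close>. Otherwise the capped one alone is at least \<open>m\<close>; the factor 1 +
    1/K in \<open>m\<close> absorbs the case where \<open>z\<close> lies between \<open>w\<close>
    and \<open>c k * w\<close>.\<close>
  define bad where "bad k \<longleftrightarrow> N * (c k * w - z) < w \<and> N * (z - c k * w) < z" for k
  have good: "m \<le> t k" if k: "k < K" and "\<not> bad k" for k
  proof -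
    from \<open>\<not> bad k\<close> consider "w \<le> N * (c k * w - z)" | "z \<le> N * (z - c k * w)"
      unfolding bad_def by linarith
    then show ?thesis
    proof cases
      case 1
      then have "0 \<le> c k * w - z" using w N by (metis order_trans zero_le_mult_iff not_less)
      moreover have "min w (N * max (c k * w - z) 0) = w" using 1 calculation by simp
      ultimately have "w \<le> t k" using z N by (simp add: t_def)
      moreover have "max w z \<le> (1 + 1 / real K) * w"
      proof -
        have "z \<le> c k * w" using \<open>0 \<le> c k * w - z\<close> by simp
        also have "\<dots> \<le> (1 + 1 / real K) * w" using c_le[OF k] w by (rule mult_right_mono)
        finally show ?thesis using w by (simp add: distrib_right)
      qed
      then have "m \<le> w" using D by (simp add: m_def pos_divide_le_eq mult.commute)
      ultimately show ?thesis by simp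
    next
      case 2
      then have "0 \<le> z - c k * w" using z N by (metis order_trans zero_le_mult_iff not_less)
      moreover have "min z (N * max (z - c k * w) 0) = z" using 2 calculation by simp
      ultimately have "z \<le> t k" using w N by (simp add: t_def)
      moreover have "w \<le> z"
        using \<open>0 \<le> z - c k * w\<close> mult_right_mono[OF c_ge[of k] w] by simp
      then have "m \<le> z" using z D by (simp add: m_def pos_divide_le_eq distrib_left)
      ultimately show ?thesis by simp
    qed
  qed
  \<comment> \<open>Adding the two failures over a gap of at least 1/K^2, which N = 10 K^2 magnifies
    to 10, gives 10 w < w + z, so z > 9 w. Then z exceeds \<open>c j * w\<close> by far, since
    \<open>c j\<close> is at most 2, and \<open>j\<close> is not bad.\<close>
  have uniq: "False" if "bad j" "bad k" "j < k" "k < K" for j k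
  proof -
    have cc: "1 / (real K)\<^sup>2 \<le> c k - c j"
    proof -
      have "1 / (real K)\<^sup>2 \<le> (real k - real j) / (real K)\<^sup>2" using that by (intro divide_right_mono) auto
      then show ?thesis by (simp add: c_def diff_divide_distrib)
    qed
    have "N * (1 / (real K)\<^sup>2) * w \<le> N * (c k - c j) * w"
      using cc N w by (intro mult_right_mono mult_left_mono) auto
    also have "\<dots> = N * (c k * w - z) + N * (z - c j * w)" by (simp add: algebra_simps)
    also have "\<dots> < w + z" using that unfolding bad_def by (intro add_strict_mono) auto
    finally have 1: "9 * w < z" using K2 by (simp add: N_def)
    have "1 \<le> (real K)\<^sup>2" using K by simp
    then have "10 \<le> N" by (simp add: N_def)
    have "c j * w \<le> 2 * w" using c_le2[of j] that w by (intro mult_right_mono) auto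
    then have "0 < z - c j * w" using 1 w by simp
    then have "10 * (z - c j * w) \<le> N * (z - c j * w)" using \<open>10 \<le> N\<close> by (intro mult_right_mono) auto
    also have "\<dots> < z" using that unfolding bad_def by simp
    finally show False using 1 w \<open>c j * w \<le> 2 * w\<close> by simp
  qed
  \<comment> \<open>If no index is bad, 0 is discarded, so at least K - 1 good indices are available
    in either case.\<close>
  have "\<exists>k0<K. \<forall>k<K. k \<noteq> k0 \<longrightarrow> \<not> bad k"
  proof (cases "\<exists>k<K. bad k")
    case True
    then show ?thesis using uniq by (metis linorder_neqE_nat)
  next
    case False
    then show ?thesis using K by (intro exI[of _ 0]) auto
  qed
  then obtain k0 where k0: "k0 < K" "\<And>k. k < K \<Longrightarrow> k \<noteq> k0 \<Longrightarrow> m \<le> t k" using good by blast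
  have "(real K - 1) * m = (\<Sum>k\<in>{..<K} - {k0}. m)" using k0 K by (simp add: of_nat_diff)
  also have "\<dots> \<le> (\<Sum>k\<in>{..<K} - {k0}. t k)" using k0 by (intro sum_mono) auto
  also have "\<dots> \<le> (\<Sum>k<K. t k)" using t_nonneg by (intro sum_mono2) auto
  finally show ?thesis by (simp add: m_def t_def)
qed

lemma eval_real_foldr_Add:
  "eval_real a (foldr Add es e) = (\<Sum>e\<leftarrow>es. eval_real a e) + eval_real a e"
  by (induction es) auto

section \<open>Absolute values, norming functionals and disjointness in a normed lattice\<close>

locale banach_lattice_on = vector_lattice_on V le for V :: "'y::real_vector set" and le +
  fixes nrm :: "'y \<Rightarrow> real"
  assumes nrm_nonneg: "x \<in> V \<Longrightarrow> 0 \<le> nrm x"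
    and nrm_eq_0: "x \<in> V \<Longrightarrow> nrm x = 0 \<Longrightarrow> x = 0"
    and nrm_scale: "x \<in> V \<Longrightarrow> nrm (c *\<^sub>R x) = \<bar>c\<bar> * nrm x"
    and nrm_add: "x \<in> V \<Longrightarrow> y \<in> V \<Longrightarrow> nrm (x + y) \<le> nrm x + nrm y"
    and nrm_solid: "x \<in> V \<Longrightarrow> y \<in> V \<Longrightarrow> le (labs V le x) (labs V le y) \<Longrightarrow> nrm x \<le> nrm y"

lemma banach_lattice_imp_locale:
  assumes "banach_lattice V le nrm"
  shows "banach_lattice_on V le nrm"
proof -
  have "subspace V" "\<forall>x\<in>V. le x x" "\<forall>x\<in>V. \<forall>y\<in>V. le x y \<and> le y x \<longrightarrow> x = y"
    "\<forall>x\<in>V. \<forall>y\<in>V. \<forall>z\<in>V. le x y \<and> le y z \<longrightarrow> le x z"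
    "\<forall>x\<in>V. \<forall>y\<in>V. \<forall>z\<in>V. le x y \<longrightarrow> le (x + z) (y + z)"
    "\<forall>x\<in>V. \<forall>y\<in>V. \<forall>c::real. c \<ge> 0 \<and> le x y \<longrightarrow> le (c *\<^sub>R x) (c *\<^sub>R y)"
    "\<forall>x\<in>V. \<forall>y\<in>V. \<exists>s. is_lsup V le x y s"
    "\<forall>x\<in>V. nrm x \<ge> 0 \<and> (nrm x = 0 \<longleftrightarrow> x = 0)"
    "\<forall>x\<in>V. \<forall>c. nrm (c *\<^sub>R x) = \<bar>c\<bar> * nrm x"
    "\<forall>x\<in>V. \<forall>y\<in>V. nrm (x + y) \<le> nrm x + nrm y"
    "\<forall>x\<in>V. \<forall>y\<in>V. le (labs V le x) (labs V le y) \<longrightarrow> nrm x \<le> nrm y"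
    by (insert assms[unfolded banach_lattice_def]; elim conjE; assumption)+
  note this[rule_format]
  then show ?thesis by unfold_locales (assumption | metis)+
qed

context banach_lattice_on
begin

lemma labs_in [simp, intro]: "x \<in> V \<Longrightarrow> labs V le x \<in> V"
  by (simp add: labs_def)

lemma le_labs: "x \<in> V \<Longrightarrow> le x (labs V le x)"
  and neg_le_labs: "x \<in> V \<Longrightarrow> le (- x) (labs V le x)"
  by (auto simp: labs_def intro: lsup_ge1 lsup_ge2)

lemma labs_nonneg:
  assumes "x \<in> V"
  shows "le 0 (labs V le x)"
proof -
  have "le (x + - x) (labs V le x + labs V le x)"
    using assms by (intro le_add_mono le_labs neg_le_labs) auto
  then have "le 0 ((1/2) *\<^sub>R (labs V le x + labs V le x))"
    using assms by (intro scale_nonneg) auto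
  then show ?thesis by (simp flip: scaleR_2)
qed

lemma labs_of_nonneg:
  assumes "x \<in> V" "le 0 x"
  shows "labs V le x = x"
  unfolding labs_def
proof (rule lsup_eqI, unfold is_lsup_def, intro conjI ballI impI)
  show "le (- x) x" using assms le_neg[of 0 x] le_trans[of "- x" 0 x] by simp
qed (use assms le_refl in auto)

lemma nrm_labs: "x \<in> V \<Longrightarrow> nrm (labs V le x) = nrm x"
  by (intro antisym nrm_solid) (auto simp: labs_of_nonneg labs_nonneg le_refl)

lemma nrm_mono: "x \<in> V \<Longrightarrow> y \<in> V \<Longrightarrow> le 0 x \<Longrightarrow> le x y \<Longrightarrow> nrm x \<le> nrm y"
  by (rule nrm_solid) (use le_trans[of 0 x y] in \<open>auto simp: labs_of_nonneg\<close>)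

lemma nrm_pos_le: "x \<in> V \<Longrightarrow> nrm (pos x) \<le> nrm x"
  by (rule nrm_solid)
    (auto simp: labs_of_nonneg pos_nonneg intro!: lsup_least le_labs labs_nonneg)

text \<open>Hahn-Banach is applied to the norm of the positive part instead of the norm: this
  vanishes on negative elements, which forces every linear functional below it to be positive, and
  it still equals the norm at z.\<close>

lemma exists_norming_functional:
  assumes z: "z \<in> V" "le 0 z"
  obtains y where "positive_functional y" "\<And>x. x \<in> V \<Longrightarrow> y x \<le> nrm x" "y z = nrm z"
proof -
  have "sublinear_on V (\<lambda>x. nrm (pos x))"
    unfolding sublinear_on_def
  proof (intro conjI ballI allI impI)
    fix x y assume xy: "x \<in> V" "y \<in> V"
    have "nrm (pos (x + y)) \<le> nrm (pos x + pos y)"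
      using xy by (intro nrm_mono pos_add_le pos_nonneg) auto
    also have "\<dots> \<le> nrm (pos x) + nrm (pos y)" using xy by (intro nrm_add) auto
    finally show "nrm (pos (x + y)) \<le> nrm (pos x) + nrm (pos y)" .
  next
    fix x and c :: real assume x: "x \<in> V" and c: "0 < c"
    have "nrm (pos (c *\<^sub>R x)) \<le> nrm (c *\<^sub>R pos x)"
      using x c by (intro nrm_mono pos_scale_le pos_nonneg) auto
    then show "nrm (pos (c *\<^sub>R x)) \<le> c * nrm (pos x)" using x c by (simp add: nrm_scale)
  qed
  from hahn_banach_touching[OF subspace this z(1)] obtain y where y: "linear_functional_on V y"
    and le: "\<And>x. x \<in> V \<Longrightarrow> y x \<le> nrm (pos x)" and yz: "y z = nrm (pos z)" by blast
  have "0 \<le> y x" if x: "x \<in> V" "le 0 x" for x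
  proof -
    have "y ((-1) *\<^sub>R x) = (-1) * y x" using y x unfolding linear_functional_on_def by blast
    moreover have "pos (- x) = 0" using x le_neg[of 0 x] by (intro pos_of_nonpos) auto
    moreover have "nrm 0 = 0" using nrm_scale[of 0 0] by simp
    ultimately show ?thesis using le[of "- x"] x by simp
  qed
  then have "positive_functional y" using y by (simp add: positive_functional_def)
  moreover have "y x \<le> nrm x" if "x \<in> V" for x using le[OF that] nrm_pos_le[OF that] by simp
  moreover have "y z = nrm z" using yz z by (simp add: pos_of_nonneg)
  ultimately show thesis by (rule that)
qed

lemma linf_in [simp, intro]: "x \<in> V \<Longrightarrow> y \<in> V \<Longrightarrow> linf V le x y \<in> V"
  by (simp add: linf_def)

lemma linf_le1: "x \<in> V \<Longrightarrow> y \<in> V \<Longrightarrow> le (linf V le x y) x"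
  and linf_le2: "x \<in> V \<Longrightarrow> y \<in> V \<Longrightarrow> le (linf V le x y) y"
  using le_neg[OF _ _ lsup_ge1[of "- x" "- y"]] le_neg[OF _ _ lsup_ge2[of "- x" "- y"]]
  by (auto simp: linf_def)

lemma linf_greatest:
  "x \<in> V \<Longrightarrow> y \<in> V \<Longrightarrow> z \<in> V \<Longrightarrow> le z x \<Longrightarrow> le z y \<Longrightarrow> le z (linf V le x y)"
  using le_neg[OF _ _ lsup_least[of "- x" "- y" "- z"]] le_neg[of z x] le_neg[of z y]
  by (simp add: linf_def)

text \<open>If v lies below both x^+ and x^- = x^+ - x, then x^+ - v is an upper bound of x and 0,
  hence of x^+, and so v \<le> 0.\<close>

lemma linf_pos_pos_neg:
  assumes V: "a \<in> V" "b \<in> V" "x \<in> V" and nonneg: "le 0 a" "le 0 b"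
    and a: "le a (pos x)" and b: "le b (pos (- x))"
  shows "linf V le a b = 0"
proof (rule le_antisym)
  let ?v = "linf V le a b"
  have v: "?v \<in> V" using V by simp
  have v1: "le ?v (pos x)" using V a linf_le1[of a b] le_trans[of ?v a "pos x"] by simp
  have "le ?v (pos x - x)" using V b linf_le2[of a b] le_trans[of ?v b "pos (- x)"] by (simp add: pos_neg)
  then have "le x (pos x - ?v)" 
    using V v le_iff_diff[of ?v "pos x - x"] le_iff_diff[of x "pos x - ?v"] by (simp add: algebra_simps)
  moreover have "le 0 (pos x - ?v)" using V v v1 le_iff_diff[of ?v "pos x"] by simp
  ultimately have "le (pos x) (pos x - ?v)" using V by (intro lsup_least) auto
  then show "le ?v 0"
    using V v le_iff_diff[of "pos x" "pos x - ?v"] le_iff_diff[of ?v 0] by simp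
  show "le 0 ?v" using V nonneg by (intro linf_greatest) auto
qed (use V in auto)

end

section \<open>Consequences of the upper p-estimate with constant 1\<close>

locale upper_p_lattice = banach_lattice_on +
  fixes p :: real
  assumes p: "1 < p" and upper: "upper_p_estimate1 p V le nrm"
begin

text \<open>The working form of the upper estimate: a single element x certifies disjointness, with
  one summand below its positive part and the other below its negative part.\<close>

lemma nrm_add_disjoint:
  assumes V: "a \<in> V" "b \<in> V" "x \<in> V" and nonneg: "le 0 a" "le 0 b"
    and a: "le a (pos x)" and b: "le b (pos (- x))"
  shows "nrm (a + b) \<le> (nrm a powr p + nrm b powr p) powr (1 / p)"
proof -
  define s where "s k = (if k = (0::nat) then a else b)" for k
  have "linf V le a b = 0" using assms by (rule linf_pos_pos_neg)
  moreover have "linf V le b a = 0"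
    using linf_pos_pos_neg[of b a "- x"] assms by simp
  ultimately have "\<forall>j<2. \<forall>k<2. j \<noteq> k \<longrightarrow> ldisjoint V le (s j) (s k)"
    using V nonneg by (auto simp: ldisjoint_def s_def labs_of_nonneg less_2_cases_iff)
  moreover have "\<forall>k<2. s k \<in> V" using V by (simp add: s_def)
  ultimately have "nrm (\<Sum>k<2. s k) \<le> (\<Sum>k<2. nrm (s k) powr p) powr (1 / p)"
    using upper unfolding upper_p_estimate1_def by blast
  then show ?thesis by (simp add: s_def numeral_2_eq_2)
qed

text \<open>Since w and z may overlap, the upper estimate is applied to K pairs of disjoint
  truncations of them. Each pair contributes at most the right side, and under \<open>y\<close>
  their sum dominates almost K - 1 times the supremum; K tends to infinity.\<close>

lemma functional_lsup_le:
  assumes y: "positive_functional y" and y_le: "\<And>x. x \<in> V \<Longrightarrow> y x \<le> nrm x"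
    and w: "w \<in> V" "le 0 w" and z: "z \<in> V" "le 0 z"
  shows "y (lsup V le w z) \<le> (nrm w powr p + nrm z powr p) powr (1 / p)"
proof -
  define B where "B = (nrm w powr p + nrm z powr p) powr (1 / p)"
  define s where "s = y (lsup V le w z)"
  define T where "T b = (if b then w else z)" for b
  have T: "T b \<in> V" "le 0 (T b)" for b using w z by (auto simp: T_def)
  have est: "(real K - 1) / (1 + 1 / real K) * s \<le> real K * B" if K: "1 \<le> K" for K :: nat
  proof -
    define N where "N = 10 * (real K)\<^sup>2"
    define c where "c k = 1 + real k / (real K)\<^sup>2" for k
    define h where "h k = Add (Scale (c k) (Atom True)) (Scale (-1) (Atom False))" for k
    \<comment> \<open>Expressions contain no constants, so \<open>Scale 0 e\<close> stands for zero;
      infima are negated suprema of negatives.\<close>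
    define posE where "posE e = Sup e (Scale 0 e)" for e :: "bool lexpr"
    define minE where "minE e e' = Scale (-1) (Sup (Scale (-1) e) (Scale (-1) e'))" for e e' :: "bool lexpr"
    define we where "we k = minE (Atom True) (Scale N (posE (h k)))" for k
    define ze where "ze k = minE (Atom False) (Scale N (posE (Scale (-1) (h k))))" for k
    define M where "M = (real K - 1) / (1 + 1 / real K)"
    \<comment> \<open>The right side minus the left side of the scalar truncation inequality, with
      the atoms True and False standing for w and z.\<close>
    define E where "E = foldr Add (map (\<lambda>k. Add (we k) (ze k)) [0..<K]) (Scale (- M) (Sup (Atom True) (Atom False)))"
    have min_eq: "- max (- a) (- b) = min a b" for a b :: real by (simp add: max_def min_def)
    have "0 \<le> y (eval_lat V le T E)"
    proof (rule eval_lat_transfer_nonneg[OF T y])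
      fix a :: "bool \<Rightarrow> real" assume a: "\<And>x. 0 \<le> a x"
      have "M * max (a True) (a False) \<le> (\<Sum>k<K. min (a True) (N * max (c k * a True - a False) 0)
          + min (a False) (N * max (a False - c k * a True) 0))"
        using max_le_average_of_truncations[OF a a K] unfolding M_def N_def c_def by blast
      then show "0 \<le> eval_real a E"
        by (simp add: E_def eval_real_foldr_Add we_def ze_def minE_def posE_def h_def min_eq
            interv_sum_list_conv_sum_set_nat atLeast0LessThan comp_def)
    qed
    have in_V: "eval_lat V le T e \<in> V" for e using T(1) by (rule eval_lat_in)
    have "y (eval_lat V le T (foldr Add es e)) = (\<Sum>e\<leftarrow>es. y (eval_lat V le T e)) + y (eval_lat V le T e)" for es e
      by (induction es) (auto simp: positive_functional_add[OF y] in_V)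
    then have "y (eval_lat V le T E) = (\<Sum>k<K. y (eval_lat V le T (Add (we k) (ze k)))) - M * s"
      using w z by (simp add: E_def interv_sum_list_conv_sum_set_nat atLeast0LessThan comp_def
          s_def T_def positive_functional_scale[OF y] positive_functional_neg[OF y] flip: scaleR_minus_left)
    also have "(\<Sum>k<K. y (eval_lat V le T (Add (we k) (ze k)))) \<le> (\<Sum>k<K. B)"
    proof (rule sum_mono)
      fix k
      define x where "x = c k *\<^sub>R w - z"
      have x: "x \<in> V" using w z by (simp add: x_def)
      have N: "0 \<le> N" by (simp add: N_def)
      \<comment> \<open>With the factor inside the positive part, the two truncations lie below the
        positive and the negative part of the one element N x, which makes them disjoint.\<close>
      have posx: "N *\<^sub>R pos v = pos (N *\<^sub>R v)" if v: "v \<in> V" for v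
      proof (cases "N = 0")
        case True
        then show ?thesis using pos_of_nonneg[of 0] le_refl[of 0] by simp
      next
        case False
        have "le (pos ((1/N) *\<^sub>R (N *\<^sub>R v))) ((1/N) *\<^sub>R pos (N *\<^sub>R v))"
          using v N by (intro pos_scale_le) auto
        then have "le (N *\<^sub>R pos v) (N *\<^sub>R ((1/N) *\<^sub>R pos (N *\<^sub>R v)))"
          using v N False by (intro le_scale) auto
        then show ?thesis using v N False by (intro le_antisym pos_scale_le) auto
      qed
      define w' where "w' = eval_lat V le T (we k)"
      define z' where "z' = eval_lat V le T (ze k)"
      have w': "w' = linf V le w (pos (N *\<^sub>R x))"
        using x by (simp add: w'_def we_def minE_def posE_def h_def T_def linf_def x_def posx)
      have "z' = linf V le z (N *\<^sub>R pos (- x))"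
        by (simp add: z'_def ze_def minE_def posE_def h_def T_def linf_def x_def)
      then have z': "z' = linf V le z (pos (- (N *\<^sub>R x)))" using x posx[of "- x"] by simp
      have V: "w' \<in> V" "z' \<in> V" using w z x by (auto simp: w' z')
      have nonneg: "le 0 w'" "le 0 z'" using w z x by (auto simp: w' z' intro!: linf_greatest pos_nonneg)
      have le: "le w' w" "le z' z" using w z x by (auto simp: w' z' intro!: linf_le1)
      have "y (w' + z') \<le> nrm (w' + z')" using V by (intro y_le) auto
      also have "\<dots> \<le> (nrm w' powr p + nrm z' powr p) powr (1 / p)"
        using V nonneg x w z by (intro nrm_add_disjoint[of _ _ "N *\<^sub>R x"]) (auto simp: w' z' intro!: linf_le2)
      also have "\<dots> \<le> B"
        unfolding B_def using p V w z nonneg le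
        by (intro powr_mono2 add_mono nrm_mono) (auto simp: nrm_nonneg)
      finally show "y (eval_lat V le T (Add (we k) (ze k))) \<le> B" by (simp add: w'_def z'_def)
    qed
    finally show ?thesis using \<open>0 \<le> y (eval_lat V le T E)\<close> by (simp add: M_def)
  qed
  have "s \<le> B"
  proof (rule ccontr)
    assume "\<not> s \<le> B"
    then have sB: "0 < s - B" by simp
    \<comment> \<open>The estimate amounts to (K - 1) s \<le> (K + 1) B, that is K (s - B) \<le> s +
      B, which this K violates.\<close>
    obtain K :: nat where K: "(s + B) / (s - B) < real K" using reals_Archimedean2 by blast
    have B: "0 \<le> B" by (simp add: B_def)
    have "0 \<le> (s + B) / (s - B)" using sB B by simp
    then have K1: "1 \<le> K" using K by (cases K) auto
    have "(real K - 1) * s / (1 + 1 / real K) \<le> real K * B" using est[OF K1] by simp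
    then have "(real K - 1) * s \<le> real K * B * (1 + 1 / real K)" using K1 by (simp add: pos_divide_le_eq add_pos_pos)
    also have "\<dots> = (real K + 1) * B" using K1 by (simp add: field_simps)
    finally have "real K * (s - B) \<le> s + B" by (simp add: algebra_simps)
    then show False using K sB by (simp add: field_simps)
  qed
  then show ?thesis by (simp add: s_def B_def)
qed

text \<open>At the supremum of \<alpha> w and \<beta> z, monotonicity lets b pick the first element
  and b' the second, while b + b' is bounded by the norm. Letting \<alpha> and \<beta> vary, duality
  turns the p-estimate into a q-estimate.\<close>

lemma split_functional_norms:
  assumes b: "positive_functional b" and b': "positive_functional b'"
    and le: "\<And>x. x \<in> V \<Longrightarrow> b x + b' x \<le> nrm x"
    and w: "w \<in> V" "le 0 w" "nrm w \<le> 1" and z: "z \<in> V" "le 0 z" "nrm z \<le> 1"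
    and q: "q = p / (p - 1)"
  shows "b w powr q + b' z powr q \<le> 1"
proof (rule conjugate_norm_le_one[OF p q])
  show "0 \<le> b w" "0 \<le> b' z" using b b' w z by (auto intro: positive_functional_nonneg)
  fix \<alpha> \<beta> :: real assume \<alpha>: "0 \<le> \<alpha>" and \<beta>: "0 \<le> \<beta>"
  let ?w = "\<alpha> *\<^sub>R w" and ?z = "\<beta> *\<^sub>R z"
  have V: "?w \<in> V" "?z \<in> V" using w z by auto
  have nonneg: "le 0 ?w" "le 0 ?z" using w z \<alpha> \<beta> by (auto intro: scale_nonneg)
  have y: "positive_functional (\<lambda>x. b x + b' x)"
    using b b' unfolding positive_functional_def linear_functional_on_def by (auto simp: algebra_simps)
  have "\<alpha> * b w + \<beta> * b' z = b ?w + b' ?z"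
    using w z by (simp add: positive_functional_scale[OF b] positive_functional_scale[OF b'])
  also have "\<dots> \<le> b (lsup V le ?w ?z) + b' (lsup V le ?w ?z)"
    using V by (intro add_mono positive_functional_mono[OF b] positive_functional_mono[OF b'] lsup_ge1 lsup_ge2) auto
  also have "\<dots> \<le> (nrm ?w powr p + nrm ?z powr p) powr (1 / p)"
    by (rule functional_lsup_le[OF y le]) (use V nonneg in auto)
  also have "\<dots> \<le> (\<alpha> powr p + \<beta> powr p) powr (1 / p)"
    using p w z \<alpha> \<beta> by (intro powr_mono2 add_mono) (auto simp: nrm_scale nrm_nonneg mult_left_le)
  finally show "\<alpha> * b w + \<beta> * b' z \<le> (\<alpha> powr p + \<beta> powr p) powr (1 / p)" .
qed

end

section \<open>Discrete weights\<close>

text \<open>The power lies below its tangent at the mean m, which is Young's inequality for u^r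
  m^(1-r). The tangent contains m^(r-1), so a vanishing mean is treated apart.\<close>

lemma powr_concave_real:
  fixes x y t r :: real
  assumes "0 \<le> x" "0 \<le> y" "0 \<le> t" "t \<le> 1" "0 < r" "r < 1"
  shows "(1 - t) * x powr r + t * y powr r \<le> ((1 - t) * x + t * y) powr r"
proof -
  define m where "m = (1 - t) * x + t * y"
  have m0: "0 \<le> m" using assms by (simp add: m_def)
  show ?thesis
  proof (cases "m = 0")
    case True
    then have "(1 - t) * x = 0" "t * y = 0"
      using assms by (auto simp: m_def add_nonneg_eq_0_iff)
    then have "(1 - t) * x powr r = 0" "t * y powr r = 0" by auto
    then show ?thesis by (simp only: add_0 powr_ge_zero)
  next
    case False
    then have m: "0 < m" using m0 by simp
    have tangent: "u powr r \<le> m powr (r - 1) * (r * u + (1 - r) * m)" if "0 \<le> u" for u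
    proof (cases "u = 0")
      case False
      then have "u powr r * m powr (1 - r) \<le> r * u + (1 - r) * m"
        using that m assms by (intro Youngs_inequality_0) auto
      then have "m powr (r - 1) * (u powr r * m powr (1 - r)) \<le> m powr (r - 1) * (r * u + (1 - r) * m)"
        by (intro mult_left_mono) auto
      moreover have "m powr (r - 1) * m powr (1 - r) = 1"
        using m by (simp flip: powr_add)
      then have "m powr (r - 1) * (u powr r * m powr (1 - r)) = u powr r"
        by (metis mult.assoc mult.commute mult.right_neutral)
      ultimately show ?thesis by simp
    qed (use m assms in auto)
    have "(1 - t) * x powr r + t * y powr r \<le> (1 - t) * (m powr (r - 1) * (r * x + (1 - r) * m))
        + t * (m powr (r - 1) * (r * y + (1 - r) * m))"
      using assms by (intro add_mono mult_left_mono tangent) auto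
    also have "\<dots> = m powr (r - 1) * (r * ((1 - t) * x + t * y) + (1 - r) * m)"
      by (simp add: algebra_simps)
    also have "\<dots> = m powr (r - 1) * m" unfolding m_def[symmetric] by (simp add: algebra_simps)
    also have "\<dots> = m powr r" using powr_mult_base[of m "r - 1"] m by (simp add: mult.commute)
    finally show ?thesis by (simp add: m_def)
  qed
qed

text \<open>The difference of the two sides is convex in \<open>\<theta>\<close>, so it is enough to look at the vertices of
  the cube.\<close>

lemma weighted_sum_le_powr:
  fixes b \<mu> \<theta> :: "'i \<Rightarrow> real"
  assumes r: "0 < r" "r < 1" and "finite I" and nn: "\<And>i. i \<in> I \<Longrightarrow> 0 \<le> \<mu> i"
    and \<theta>: "\<And>i. i \<in> I \<Longrightarrow> 0 \<le> \<theta> i \<and> \<theta> i \<le> 1"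
    and "0 \<le> \<beta>" and le: "\<And>S. S \<subseteq> I \<Longrightarrow> \<alpha> + (\<Sum>i\<in>S. b i) \<le> (\<beta> + (\<Sum>i\<in>S. \<mu> i)) powr r"
  shows "\<alpha> + (\<Sum>i\<in>I. \<theta> i * b i) \<le> (\<beta> + (\<Sum>i\<in>I. \<theta> i * \<mu> i)) powr r"
  using \<open>finite I\<close> nn \<theta> \<open>0 \<le> \<beta>\<close> le
proof (induction I arbitrary: \<alpha> \<beta> rule: finite_induct)
  case empty
  then show ?case by (metis sum.empty subset_refl)
next
  case (insert i I)
  define B where "B = (\<Sum>i\<in>I. \<theta> i * b i)"
  define M where "M = (\<Sum>i\<in>I. \<theta> i * \<mu> i)"
  have M: "0 \<le> M" unfolding M_def using insert.prems by (intro sum_nonneg) auto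
  have 0: "\<alpha> + B \<le> (\<beta> + M) powr r"
    unfolding B_def M_def using insert.prems by (intro insert.IH) auto
  \<comment> \<open>On the face where \<theta> i = 1, the terms of i are absorbed into \<alpha> and
    \<beta>, which is why the induction leaves these two arbitrary.\<close>
  have "\<alpha> + b i + (\<Sum>i\<in>S. b i) \<le> (\<beta> + \<mu> i + (\<Sum>i\<in>S. \<mu> i)) powr r" if S: "S \<subseteq> I" for S
  proof -
    have "finite S" "i \<notin> S" using S insert.hyps finite_subset by auto
    then show ?thesis using insert.prems(4)[of "insert i S"] S by (auto simp: algebra_simps)
  qed
  then have 1: "\<alpha> + b i + B \<le> (\<beta> + \<mu> i + M) powr r"
    unfolding B_def M_def using insert.prems by (intro insert.IH) auto
  have t: "0 \<le> \<theta> i" "\<theta> i \<le> 1" using insert.prems by auto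
  have "\<alpha> + (\<theta> i * b i + B) = (1 - \<theta> i) * (\<alpha> + B) + \<theta> i * (\<alpha> + b i + B)" by (simp add: algebra_simps)
  also have "\<dots> \<le> (1 - \<theta> i) * (\<beta> + M) powr r + \<theta> i * (\<beta> + \<mu> i + M) powr r"
    using 0 1 t by (intro add_mono mult_left_mono) auto
  also have "\<dots> \<le> ((1 - \<theta> i) * (\<beta> + M) + \<theta> i * (\<beta> + \<mu> i + M)) powr r"
    using t r M insert.prems(1)[of i] insert.prems(3) by (intro powr_concave_real) auto
  also have "(1 - \<theta> i) * (\<beta> + M) + \<theta> i * (\<beta> + \<mu> i + M) = \<beta> + (\<theta> i * \<mu> i + M)" by (simp add: algebra_simps)
  finally show ?case using insert.hyps by (simp add: B_def M_def)
qed

section \<open>The finite weak norm and admissible families of functionals\<close>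

lemma finite_wnorm_fin_values:
  "finite {real (card A) powr (1 / p - 1) * (\<Sum>i\<in>A. \<bar>a i\<bar>) | A. A \<noteq> {} \<and> A \<subseteq> {..<n::nat}}"
proof -
  have "finite ((\<lambda>A. real (card A) powr (1 / p - 1) * (\<Sum>i\<in>A. \<bar>a i\<bar>)) ` Pow {..<n})" by simp
  then show ?thesis by (rule rev_finite_subset) auto
qed

lemma wnorm_fin_ge:
  assumes "A \<noteq> {}" "A \<subseteq> {..<n}"
  shows "real (card A) powr (1 / p - 1) * (\<Sum>i\<in>A. \<bar>a i\<bar>) \<le> wnorm_fin p n a"
  unfolding wnorm_fin_def by (rule Max_ge[OF finite_wnorm_fin_values]) (use assms in auto)

lemma wnorm_fin_attained:
  assumes "1 \<le> n"
  obtains A where "A \<noteq> {}" "A \<subseteq> {..<n}" "wnorm_fin p n a = real (card A) powr (1 / p - 1) * (\<Sum>i\<in>A. \<bar>a i\<bar>)"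
proof -
  have "{..<n} \<noteq> {}" using assms by (auto simp: lessThan_empty_iff)
  then have "{real (card A) powr (1 / p - 1) * (\<Sum>i\<in>A. \<bar>a i\<bar>) | A. A \<noteq> {} \<and> A \<subseteq> {..<n}} \<noteq> {}"
    by blast
  from Max_in[OF finite_wnorm_fin_values this] show thesis
    using that unfolding wnorm_fin_def by blast
qed

lemma wnorm_fin_le:
  assumes "1 \<le> n"
    and "\<And>A. A \<noteq> {} \<Longrightarrow> A \<subseteq> {..<n} \<Longrightarrow> real (card A) powr (1 / p - 1) * (\<Sum>i\<in>A. \<bar>a i\<bar>) \<le> b"
  shows "wnorm_fin p n a \<le> b"
  using wnorm_fin_attained[OF assms(1), of p a] assms(2) by metis

lemma fvl_fun_scaleR:
  assumes "0 \<le> c"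
  shows "fvl_fun e (c *\<^sub>R f) = c * fvl_fun e f"
proof -
  have "blinfun_apply (c *\<^sub>R f) = (\<lambda>x. c * blinfun_apply f x)" by (simp add: fun_eq_iff blinfun.scaleR_left)
  then show ?thesis by (simp add: fvl_fun_def eval_real_scale[OF assms])
qed

text \<open>The joint bound, tested on singletons and normalised vectors, yields
  \<open>norm (xs i) \<le> 1\<close>.\<close>

lemma rho_pinf_ge:
  assumes "1 \<le> n" "\<And>x. norm x \<le> 1 \<Longrightarrow> wnorm_fin p n (\<lambda>i. blinfun_apply (xs i) x) \<le> 1"
  shows "ennreal (wnorm_fin p n (\<lambda>i. fvl_fun e (xs i))) \<le> rho_pinf p e"
proof -
  have "norm (xs i) \<le> 1" if i: "i < n" for i
  proof (rule norm_blinfun_bound)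
    fix x
    show "norm (xs i x) \<le> 1 * norm x"
    proof (cases "x = 0")
      case False
      have "real (card {i}) powr (1 / p - 1) * (\<Sum>i\<in>{i}. \<bar>xs i (x /\<^sub>R norm x)\<bar>)
          \<le> wnorm_fin p n (\<lambda>i. xs i (x /\<^sub>R norm x))"
        using i by (intro wnorm_fin_ge) auto
      also have "\<dots> \<le> 1" using False by (intro assms(2)) simp
      finally show ?thesis using False
        by (simp add: blinfun.scaleR_right abs_mult field_simps)
    qed simp
  qed simp
  then show ?thesis
    unfolding rho_pinf_def using assms by (intro SUP_upper2[of "(n, xs)"]) auto
qed

text \<open>A discrete measure with arbitrary weights is approximated by a multiple of counting measure
  on a set in which \<open>i\<close> is repeated proportionally to \<open>\<mu> i\<close>.\<close>

lemma weighted_sum_le_rho_pinf_aux: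
  fixes a :: "'i \<Rightarrow> 'e::banach \<Rightarrow>\<^sub>L real"
  assumes p: "1 < p" and I: "finite I" and \<mu>: "\<And>i. i \<in> I \<Longrightarrow> 0 < \<mu> i"
    and bound: "\<And>S x. S \<subseteq> I \<Longrightarrow> norm x \<le> 1 \<Longrightarrow>
      (\<Sum>i\<in>S. \<bar>blinfun_apply (a i) x\<bar>) \<le> (\<Sum>i\<in>S. \<mu> i) powr (1 - 1 / p)"
    and R: "rho_pinf p e \<le> ennreal R" "0 \<le> R" and c: "0 < c"
  shows "(\<Sum>i\<in>I. (1 - c / \<mu> i) * \<bar>fvl_fun e (a i)\<bar>) \<le> (\<Sum>i\<in>I. \<mu> i) powr (1 - 1 / p) * R"
proof -
  define r where "r = 1 - 1 / p"
  have r: "0 < r" "r < 1" using p by (auto simp: r_def)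
  \<comment> \<open>Here c is the mass of one copy. Rounding down keeps the total mass of the copies
    of i between \<open>\<mu> i - c\<close> and \<open>\<mu> i\<close>.\<close>
  define k where "k i = nat \<lfloor>\<mu> i / c\<rfloor>" for i
  have k_le: "real (k i) * c \<le> \<mu> i" if "i \<in> I" for i
  proof -
    have "0 \<le> \<mu> i / c" using \<mu>[OF that] c by simp
    then have "real (k i) \<le> \<mu> i / c" by (simp add: k_def)
    then show ?thesis using c by (simp add: field_simps)
  qed
  have k_ge: "1 - c / \<mu> i \<le> real (k i) * c / \<mu> i" if "i \<in> I" for i
  proof -
    have "\<mu> i / c \<le> real (k i) + 1" unfolding k_def by linarith
    then have "\<mu> i \<le> real (k i) * c + c" using c by (simp add: field_simps)
    then have "\<mu> i / \<mu> i \<le> (real (k i) * c + c) / \<mu> i" using \<mu>[OF that] by (intro divide_right_mono) auto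
    then show ?thesis using \<mu>[OF that] by (simp add: add_divide_distrib)
  qed
  define J where "J = (SIGMA i:I. {..<k i})"
  have J: "finite J" using I by (simp add: J_def)
  define n where "n = card J"
  obtain h where h: "bij_betw h {..<n} J"
    using ex_bij_betw_nat_finite[OF J] by (auto simp: n_def atLeast0LessThan)
  define g where "g = fst \<circ> h"
  have gI: "g j \<in> I" if "j < n" for j
    using bij_betwE[OF h] that by (force simp: g_def J_def)
  define l where "l A i = card {j\<in>A. g j = i}" for A i
  have l_le: "l A i \<le> k i" if A: "A \<subseteq> {..<n}" for A i
  proof -
    have "inj_on h {j\<in>A. g j = i}" using h A by (auto simp: bij_betw_def intro: inj_on_subset)
    moreover have "h ` {j\<in>A. g j = i} \<subseteq> {i} \<times> {..<k i}"
      using bij_betwE[OF h] A by (force simp: g_def J_def)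
    ultimately have "l A i \<le> card ({i} \<times> {..<k i})" unfolding l_def by (intro card_inj_on_le) auto
    then show ?thesis by simp
  qed
  have l_full: "l {..<n} i = k i" if i: "i \<in> I" for i
  proof -
    have "h ` {j\<in>{..<n}. g j = i} = {i} \<times> {..<k i}"
    proof
      show "h ` {j\<in>{..<n}. g j = i} \<subseteq> {i} \<times> {..<k i}"
        using bij_betwE[OF h] by (force simp: g_def J_def)
      show "{i} \<times> {..<k i} \<subseteq> h ` {j\<in>{..<n}. g j = i}"
      proof
        fix s assume s: "s \<in> {i} \<times> {..<k i}"
        then have "s \<in> J" using i by (auto simp: J_def)
        then obtain j where "j < n" "s = h j" using h by (auto simp: bij_betw_def)
        then show "s \<in> h ` {j\<in>{..<n}. g j = i}" using s by (auto simp: g_def)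
      qed
    qed
    moreover have "inj_on h {j\<in>{..<n}. g j = i}" using h by (auto simp: bij_betw_def intro: inj_on_subset)
    ultimately have "l {..<n} i = card ({i} \<times> {..<k i})" unfolding l_def by (metis card_image)
    then show ?thesis by simp
  qed
  have regroup: "(\<Sum>j\<in>A. F (g j)) = (\<Sum>i\<in>I. real (l A i) * F i)" if A: "A \<subseteq> {..<n}" for A and F :: "'i \<Rightarrow> real"
  proof -
    have "(\<Sum>j\<in>A. F (g j)) = (\<Sum>i\<in>I. \<Sum>j\<in>{j\<in>A. g j = i}. F (g j))"
      by (rule sum.group[symmetric]) (use A I gI finite_subset in auto)
    also have "\<dots> = (\<Sum>i\<in>I. real (l A i) * F i)" by (simp add: l_def)
    finally show ?thesis .
  qed
  \<comment> \<open>A copy takes the share c / \<mu> of the functional; the remaining factor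
    c^(1/p-1) passes from c times counting measure to counting measure.\<close>
  define xs where "xs j = (c powr (1 / p) / \<mu> (g j)) *\<^sub>R a (g j)" for j
  show ?thesis
  proof (cases "n = 0")
    \<comment> \<open>There are no copies at all when c is too large; then every coefficient 1 - c /
      \<mu> is nonpositive.\<close>
    case True
    then have "k i = 0" if "i \<in> I" for i using l_full[OF that] by (simp add: l_def)
    then have "(\<Sum>i\<in>I. (1 - c / \<mu> i) * \<bar>fvl_fun e (a i)\<bar>) \<le> (\<Sum>i\<in>I. 0)"
      using k_ge by (intro sum_mono mult_nonpos_nonneg) force+
    then show ?thesis using R by (simp add: order_trans[OF _ mult_nonneg_nonneg])
  next
    case False
    have unit: "wnorm_fin p n (\<lambda>j. blinfun_apply (xs j) x) \<le> 1" if x: "norm x \<le> 1" for x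
    proof (rule wnorm_fin_le)
      fix A assume "A \<noteq> {}" and A: "A \<subseteq> {..<n}"
      have finA: "finite A" using A finite_subset by auto
      have cA: "0 < real (card A)" using \<open>A \<noteq> {}\<close> finA by (simp add: card_gt_0_iff)
      \<comment> \<open>A set A of copies selects only the fraction l c / \<mu> of each index,
        whereas the hypothesis covers full subsets of I; the interpolation between vertices of the
        cube bridges this.\<close>
      have "0 + (\<Sum>i\<in>I. (real (l A i) * c / \<mu> i) * \<bar>a i x\<bar>) \<le> (0 + (\<Sum>i\<in>I. (real (l A i) * c / \<mu> i) * \<mu> i)) powr r"
      proof (rule weighted_sum_le_powr[OF r I])
        fix i assume i: "i \<in> I"
        show "0 \<le> \<mu> i" using \<mu>[OF i] by simp
        have "real (l A i) * c \<le> \<mu> i"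
          using l_le[OF A, of i] k_le[OF i] c by (meson mult_right_mono of_nat_mono order_trans less_imp_le)
        then show "0 \<le> real (l A i) * c / \<mu> i \<and> real (l A i) * c / \<mu> i \<le> 1"
          using \<mu>[OF i] c by simp
      next
        fix S assume "S \<subseteq> I"
        then show "0 + (\<Sum>i\<in>S. \<bar>a i x\<bar>) \<le> (0 + (\<Sum>i\<in>S. \<mu> i)) powr r" using bound[OF _ x] by (simp add: r_def)
      qed simp
      also have "0 + (\<Sum>i\<in>I. (real (l A i) * c / \<mu> i) * \<mu> i) = (\<Sum>i\<in>I. real (l A i) * c)"
        using \<mu> by (force intro!: sum.cong)
      also have "\<dots> = real (card A) * c" using regroup[OF A, of "\<lambda>_. c"] by simp
      finally have *: "(\<Sum>i\<in>I. (real (l A i) * c / \<mu> i) * \<bar>a i x\<bar>) \<le> (real (card A) * c) powr r" by simp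
      have "(\<Sum>j\<in>A. \<bar>xs j x\<bar>) = (\<Sum>j\<in>A. c powr (1 / p) / \<mu> (g j) * \<bar>a (g j) x\<bar>)"
      proof (rule sum.cong[OF refl])
        fix j assume "j \<in> A"
        then have "0 < \<mu> (g j)" using A gI \<mu> by auto
        then show "\<bar>xs j x\<bar> = c powr (1 / p) / \<mu> (g j) * \<bar>a (g j) x\<bar>"
          by (simp add: xs_def blinfun.scaleR_left abs_mult)
      qed
      also have "\<dots> = (\<Sum>i\<in>I. real (l A i) * (c powr (1 / p) / \<mu> i * \<bar>a i x\<bar>))" by (rule regroup[OF A])
      also have "\<dots> = c powr (- r) * (\<Sum>i\<in>I. (real (l A i) * c / \<mu> i) * \<bar>a i x\<bar>)"
      proof -
        have "c powr (1 / p) = c powr (- r) * c"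
          using powr_mult_base[of c "- r"] c by (simp add: r_def mult.commute)
        then show ?thesis by (simp add: sum_distrib_left algebra_simps)
      qed
      also have "\<dots> \<le> c powr (- r) * (real (card A) * c) powr r" using * by (intro mult_left_mono) auto
      also have "\<dots> = real (card A) powr r"
        using c cA by (simp add: powr_mult powr_minus)
      finally have "real (card A) powr (1 / p - 1) * (\<Sum>j\<in>A. \<bar>xs j x\<bar>)
        \<le> real (card A) powr (1 / p - 1) * real (card A) powr r"
        by (intro mult_left_mono) auto
      also have "\<dots> = 1" using cA by (simp flip: powr_add add: r_def)
      finally show "real (card A) powr (1 / p - 1) * (\<Sum>j\<in>A. \<bar>xs j x\<bar>) \<le> 1" .
    qed (use False in simp)
    have "ennreal (wnorm_fin p n (\<lambda>j. fvl_fun e (xs j))) \<le> rho_pinf p e"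
      using False unit by (intro rho_pinf_ge) auto
    then have le_R: "wnorm_fin p n (\<lambda>j. fvl_fun e (xs j)) \<le> R" using R by (metis ennreal_le_iff order_trans)
    have n: "0 < real n" using False by simp
    have "(\<Sum>i\<in>I. (1 - c / \<mu> i) * \<bar>fvl_fun e (a i)\<bar>) \<le> (\<Sum>i\<in>I. real (k i) * c / \<mu> i * \<bar>fvl_fun e (a i)\<bar>)"
      by (intro sum_mono mult_right_mono k_ge) auto
    also have "\<dots> = c powr r * (\<Sum>i\<in>I. real (l {..<n} i) * (c powr (1 / p) / \<mu> i * \<bar>fvl_fun e (a i)\<bar>))"
    proof -
      have "c = c powr r * c powr (1 / p)" using c by (simp flip: powr_add add: r_def)
      then have "real (k i) * c / \<mu> i * \<bar>fvl_fun e (a i)\<bar>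
        = c powr r * (real (k i) * (c powr (1 / p) / \<mu> i * \<bar>fvl_fun e (a i)\<bar>))" for i
        by (metis (no_types, lifting) mult.assoc mult.left_commute times_divide_eq_left times_divide_eq_right)
      then show ?thesis unfolding sum_distrib_left by (intro sum.cong) (auto simp: l_full)
    qed
    also have "(\<Sum>i\<in>I. real (l {..<n} i) * (c powr (1 / p) / \<mu> i * \<bar>fvl_fun e (a i)\<bar>))
      = (\<Sum>j<n. c powr (1 / p) / \<mu> (g j) * \<bar>fvl_fun e (a (g j))\<bar>)" by (rule regroup[symmetric]) simp
    also have "\<dots> = (\<Sum>j<n. \<bar>fvl_fun e (xs j)\<bar>)"
    proof (rule sum.cong[OF refl])
      fix j assume "j \<in> {..<n}"
      then have "0 < \<mu> (g j)" using \<mu> gI by simp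
      then show "c powr (1 / p) / \<mu> (g j) * \<bar>fvl_fun e (a (g j))\<bar> = \<bar>fvl_fun e (xs j)\<bar>"
        by (simp add: xs_def fvl_fun_scaleR abs_mult)
    qed
    also have "c powr r * \<dots> = (c * real n) powr r * (real n powr (1 / p - 1) * (\<Sum>j<n. \<bar>fvl_fun e (xs j)\<bar>))"
    proof -
      have "real n powr r * real n powr (1 / p - 1) = 1" using n by (simp flip: powr_add add: r_def)
      then show ?thesis using c n by (simp add: powr_mult mult.assoc[symmetric])
    qed
    also have "\<dots> \<le> (c * real n) powr r * R"
    proof (rule mult_left_mono)
      show "real n powr (1 / p - 1) * (\<Sum>j<n. \<bar>fvl_fun e (xs j)\<bar>) \<le> R"
        using wnorm_fin_ge[of "{..<n}" n p "\<lambda>j. fvl_fun e (xs j)"] False le_R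
        by (auto simp: lessThan_empty_iff)
    qed simp
    also have "\<dots> \<le> (\<Sum>i\<in>I. \<mu> i) powr r * R"
    proof (intro mult_right_mono powr_mono2)
      have "c * real n = (\<Sum>i\<in>I. real (k i) * c)" using regroup[of "{..<n}" "\<lambda>_. c"] l_full by (simp add: mult.commute)
      also have "\<dots> \<le> (\<Sum>i\<in>I. \<mu> i)" by (intro sum_mono k_le)
      finally show "c * real n \<le> (\<Sum>i\<in>I. \<mu> i)" .
    qed (use r c R in auto)
    finally show ?thesis by (simp add: r_def)
  qed
qed

text \<open>The copy mass c tends to 0 from the right, and the rounding losses c / \<mu> vanish.
  Indices of weight 0 are removed beforehand.\<close>

lemma weighted_sum_le_rho_pinf:
  fixes a :: "'i \<Rightarrow> 'e::banach \<Rightarrow>\<^sub>L real"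
  assumes p: "1 < p" and I: "finite I" and \<mu>: "\<And>i. i \<in> I \<Longrightarrow> 0 \<le> \<mu> i"
    and bound: "\<And>S x. S \<subseteq> I \<Longrightarrow> norm x \<le> 1 \<Longrightarrow>
      (\<Sum>i\<in>S. \<bar>blinfun_apply (a i) x\<bar>) \<le> (\<Sum>i\<in>S. \<mu> i) powr (1 - 1 / p)"
    and R: "rho_pinf p e \<le> ennreal R" "0 \<le> R"
  shows "(\<Sum>i\<in>I. \<bar>fvl_fun e (a i)\<bar>) \<le> (\<Sum>i\<in>I. \<mu> i) powr (1 - 1 / p) * R"
proof -
  define I' where "I' = {i\<in>I. 0 < \<mu> i}"
  have I': "finite I'" "I' \<subseteq> I" using I by (auto simp: I'_def)
  \<comment> \<open>The singleton bound at weight 0 forces the functional itself to be 0, because 0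
    raised to any power with \<open>powr\<close> is 0.\<close>
  have zero: "fvl_fun e (a i) = 0" if i: "i \<in> I - I'" for i
  proof -
    have \<mu>0: "\<mu> i = 0" using i \<mu>[of i] by (auto simp: I'_def)
    have "a i x = 0" for x
    proof (cases "x = 0")
      case False
      have "(\<Sum>i\<in>{i}. \<bar>a i (x /\<^sub>R norm x)\<bar>) \<le> (\<Sum>i\<in>{i}. \<mu> i) powr (1 - 1 / p)"
        using i False by (intro bound) auto
      then show ?thesis using \<mu>0 False by (simp add: blinfun.scaleR_right)
    qed simp
    then have "a i = 0 *\<^sub>R a i" by (intro blinfun_eqI) simp
    then show ?thesis by (metis fvl_fun_scaleR mult_zero_left order_refl)
  qed
  have "(\<lambda>c. \<Sum>i\<in>I'. (1 - c / \<mu> i) * \<bar>fvl_fun e (a i)\<bar>) \<midarrow>0\<rightarrow> (\<Sum>i\<in>I'. (1 - 0 / \<mu> i) * \<bar>fvl_fun e (a i)\<bar>)"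
    by (intro tendsto_intros) (auto simp: I'_def)
  then have lim: "((\<lambda>c. \<Sum>i\<in>I'. (1 - c / \<mu> i) * \<bar>fvl_fun e (a i)\<bar>) \<longlongrightarrow> (\<Sum>i\<in>I'. (1 - 0 / \<mu> i) * \<bar>fvl_fun e (a i)\<bar>)) (at_right 0)"
    by (rule filterlim_mono) (auto simp: at_le)
  have "(\<Sum>i\<in>I'. (1 - c / \<mu> i) * \<bar>fvl_fun e (a i)\<bar>) \<le> (\<Sum>i\<in>I'. \<mu> i) powr (1 - 1 / p) * R" if "0 < c" for c
    by (rule weighted_sum_le_rho_pinf_aux[OF p I'(1) _ bound R that]) (use I' in \<open>auto simp: I'_def\<close>)
  then have "eventually (\<lambda>c. (\<Sum>i\<in>I'. (1 - c / \<mu> i) * \<bar>fvl_fun e (a i)\<bar>) \<le> (\<Sum>i\<in>I'. \<mu> i) powr (1 - 1 / p) * R) (at_right 0)"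
    by (auto simp: eventually_at_filter)
  from tendsto_upperbound[OF lim this] have "(\<Sum>i\<in>I'. \<bar>fvl_fun e (a i)\<bar>) \<le> (\<Sum>i\<in>I'. \<mu> i) powr (1 - 1 / p) * R"
    by simp
  moreover have "(\<Sum>i\<in>I. \<bar>fvl_fun e (a i)\<bar>) = (\<Sum>i\<in>I'. \<bar>fvl_fun e (a i)\<bar>)"
    using I I' zero by (intro sum.mono_neutral_right) auto
  moreover have "(\<Sum>i\<in>I. \<mu> i) = (\<Sum>i\<in>I'. \<mu> i)"
    using I I' \<mu> by (intro sum.mono_neutral_right) (force simp: I'_def)+
  ultimately show ?thesis by simp
qed

section \<open>Operators into lattices with an upper estimate\<close>

lemma gamma_p_eq:
  assumes "1 < p" "q = p / (p - 1)"
  shows "gamma_p p = q powr (1 - 1 / p)"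
proof -
  have q: "1 - 1 / p = inverse q" "0 < q" using assms(1) by (auto simp: assms(2) field_simps)
  have "gamma_p p = (inverse q) powr (- (1 - 1 / p))"
    by (simp only: gamma_p_def q(1)[symmetric] minus_diff_eq)
  also have "\<dots> = inverse (inverse q powr (1 - 1 / p))" by (rule powr_minus)
  also have "\<dots> = q powr (1 - 1 / p)" using q(2) by (simp only: inverse_powr less_imp_le inverse_inverse_eq)
  finally show ?thesis .
qed

lemma gamma_p_pos: "1 < p \<Longrightarrow> 0 < gamma_p p"
  by (simp add: gamma_p_def)

lemma (in vector_lattice_on) positive_functional_sum:
  assumes "\<And>i. i \<in> S \<Longrightarrow> positive_functional (f i)"
  shows "positive_functional (\<lambda>x. \<Sum>i\<in>S. f i x)"
  unfolding positive_functional_def linear_functional_on_def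
  using assms by (auto simp: positive_functional_add positive_functional_scale sum.distrib
      sum_distrib_left positive_functional_nonneg intro!: sum_nonneg)

context upper_p_lattice
begin

text \<open>The weak-type bound for a partial sum b of pieces: b z acts as the measure of the
  corresponding set of indices, and b' as the sum over its complement.\<close>

lemma sum_functionals_le:
  assumes b: "positive_functional b" and b': "positive_functional b'"
    and le: "\<And>x. x \<in> V \<Longrightarrow> b x + b' x \<le> nrm x"
    and w: "w \<in> V" "le 0 w" "nrm w \<le> 1" and z: "z \<in> V" "le 0 z" "nrm z \<le> 1" "b z + b' z = 1"
  shows "b w \<le> gamma_p p * b z powr (1 - 1 / p)"
proof -
  define q where "q = p / (p - 1)"
  have q: "1 < q" "1 - 1 / p = 1 / q" using p by (auto simp: q_def field_simps)
  have bz: "0 \<le> b z" "0 \<le> b' z" "0 \<le> b w" using b b' w z by (auto intro: positive_functional_nonneg)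
  have "b w powr q + b' z powr q \<le> 1"
    using split_functional_norms[OF b b' le w z(1-3) q_def] by simp
  moreover have "1 - q * b z \<le> (1 - b z) powr q" using bz z q by (intro bernoulli_powr) auto
  moreover have "b' z = 1 - b z" using z by simp
  ultimately have "b w powr q \<le> q * b z" by simp
  then have "(b w powr q) powr (1 / q) \<le> (q * b z) powr (1 / q)" using q by (intro powr_mono2) auto
  moreover have "(b w powr q) powr (1 / q) = b w" using bz q by (simp add: powr_powr)
  ultimately show ?thesis using gamma_p_eq[OF p q_def] q bz by (simp add: powr_mult)
qed

theorem nrm_eval_lat_le:
  fixes T :: "'e::banach \<Rightarrow> 'a"
  assumes T: "lin_contraction V nrm T" and R: "rho_pinf p e \<le> ennreal R" "0 \<le> R"
  shows "nrm (eval_lat V le T e) \<le> gamma_p p * R"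
proof (cases "eval_lat V le T e = 0")
  case True
  then show ?thesis using nrm_scale[of 0 0] R gamma_p_pos[OF p] by simp
next
  case False
  have TV: "T x \<in> V" and T_add: "T (x + x') = T x + T x'" and T_scale: "T (c *\<^sub>R x) = c *\<^sub>R T x"
    and T_le: "nrm (T x) \<le> norm x" for x x' c
    using T by (auto simp: lin_contraction_def)
  define v where "v = eval_lat V le T e"
  have v: "v \<in> V" unfolding v_def using TV by (rule eval_lat_in)
  define t where "t = labs V le v"
  have t: "t \<in> V" "le 0 t" "nrm t = nrm v" using v by (auto simp: t_def labs_nonneg nrm_labs)
  have nv: "0 < nrm v" using False nrm_nonneg[OF v] nrm_eq_0[OF v] by (force simp: v_def)
  define z where "z = (1 / nrm v) *\<^sub>R t"
  have z: "z \<in> V" "le 0 z" "nrm z = 1" using t nv by (auto simp: z_def nrm_scale intro: scale_nonneg)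
  obtain y where y: "positive_functional y" and y_le: "\<And>x. x \<in> V \<Longrightarrow> y x \<le> nrm x" and yt: "y t = nrm t"
    using exists_norming_functional[OF t(1,2)] by blast
  have yz: "y z = 1" using yt t nv by (simp add: z_def positive_functional_scale[OF y])
  define g where "g = gamma_p p"
  have g: "0 < g" using p by (simp add: g_def gamma_p_pos)
  \<comment> \<open>The functional \<open>y\<close> norms the modulus of the image, so the
    expression of the modulus is the one to be evaluated through the pieces.\<close>
  define abse where "abse = Sup e (Scale (-1) e)"
  have te: "t = eval_lat V le T abse" by (simp add: t_def abse_def labs_def v_def)
  have "nrm v \<le> g * R + \<eta>" if \<eta>: "0 < \<eta>" for \<eta>
  proof -
    obtain fs where fs: "decomposes fs y"
      and le: "\<bar>y (eval_lat V le T abse) - (\<Sum>f\<leftarrow>fs. eval_real (\<lambda>x. f (T x)) abse)\<bar> \<le> \<eta>"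
      using eval_lat_decomposition[where T = T, OF TV y \<eta>] by blast
    define I where "I = {..<length fs}"
    define f where "f i = fs ! i" for i
    have f: "positive_functional (f i)" if "i \<in> I" for i
      using fs that by (auto simp: decomposes_def I_def f_def)
    have f_le: "dominated (f i) y" if "i \<in> I" for i
      using fs that by (auto simp: decomposes_def I_def f_def)
    have sum_f: "(\<Sum>i\<in>I. f i x) = y x" if "x \<in> V" for x
      using fs that by (simp add: decomposes_def I_def f_def sum_list_sum_nth atLeast0LessThan)
    have abs_f: "\<bar>f i x\<bar> \<le> f i (labs V le x)" if "i \<in> I" "x \<in> V" for i x
      using positive_functional_mono[OF f[OF that(1)] _ _ le_labs[OF that(2)]]
        positive_functional_mono[OF f[OF that(1)] _ _ neg_le_labs[OF that(2)]]
        positive_functional_neg[OF f[OF that(1)] that(2)] that(2) by simp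
    have "bounded_linear (\<lambda>x. f i (T x) / g)" if i: "i \<in> I" for i
    proof (rule bounded_linear_intro)
      fix x
      have "\<bar>f i (T x)\<bar> \<le> f i (labs V le (T x))" using i TV by (rule abs_f)
      also have "\<dots> \<le> y (labs V le (T x))"
        using f_le[OF i] TV labs_nonneg[OF TV] by (simp add: dominated_def)
      also have "\<dots> \<le> nrm (T x)" using y_le[of "labs V le (T x)"] TV by (simp add: nrm_labs)
      also have "\<dots> \<le> norm x" by (rule T_le)
      finally show "norm (f i (T x) / g) \<le> norm x * (1 / g)" using g by (simp add: divide_right_mono)
    qed (use TV in \<open>simp_all add: T_add T_scale positive_functional_add[OF f[OF i]]
        positive_functional_scale[OF f[OF i]] add_divide_distrib\<close>)
    then have a_apply: "blinfun_apply (Blinfun (\<lambda>x. f i (T x) / g)) x = f i (T x) / g" if "i \<in> I" for i x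
      using that by (simp add: bounded_linear_Blinfun_apply)
    \<comment> \<open>Division by \<open>g\<close> brings the weak-type bound, which carries the
      constant \<open>gamma_p p\<close>, to the normalised form expected of weights; the factor
      returns by homogeneity.\<close>
    define a where "a i = Blinfun (\<lambda>x. f i (T x) / g)" for i
    have "(\<Sum>i\<in>I. \<bar>fvl_fun e (a i)\<bar>) \<le> (\<Sum>i\<in>I. f i z) powr (1 - 1 / p) * R"
    proof (rule weighted_sum_le_rho_pinf[OF p _ _ _ R])
      show "finite I" by (simp add: I_def)
      show "0 \<le> f i z" if "i \<in> I" for i using f[OF that] z(1,2) by (rule positive_functional_nonneg)
      fix S and x :: 'e assume S: "S \<subseteq> I" and x: "norm x \<le> 1"
      define b where "b v = (\<Sum>i\<in>S. f i v)" for v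
      define b' where "b' v = (\<Sum>i\<in>I - S. f i v)" for v
      have b: "positive_functional b" "positive_functional b'"
        unfolding b_def b'_def using S f by (auto intro!: positive_functional_sum)
      have sum_b: "b v + b' v = y v" if "v \<in> V" for v
        unfolding b_def b'_def using S sum_f[OF that] sum.subset_diff[of S I "\<lambda>i. f i v"]
        by (simp add: I_def add.commute)
      let ?w = "labs V le (T x)"
      have "b ?w \<le> g * b z powr (1 - 1 / p)"
        unfolding g_def
      proof (rule sum_functionals_le[OF b])
        show "b x + b' x \<le> nrm x" if "x \<in> V" for x using sum_b[OF that] y_le[OF that] by simp
        show "?w \<in> V" "le 0 ?w" "nrm ?w \<le> 1"
          using TV T_le[of x] x by (auto simp: nrm_labs labs_nonneg)
        show "b z + b' z = 1" using sum_b z yz by simp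
      qed (use z in auto)
      moreover have "(\<Sum>i\<in>S. \<bar>a i x\<bar>) = (\<Sum>i\<in>S. \<bar>f i (T x)\<bar>) / g"
        using S g by (auto simp: a_def a_apply sum_divide_distrib subset_iff intro!: sum.cong)
      moreover have "(\<Sum>i\<in>S. \<bar>f i (T x)\<bar>) \<le> b ?w"
        unfolding b_def using S TV by (intro sum_mono abs_f) auto
      ultimately show "(\<Sum>i\<in>S. \<bar>a i x\<bar>) \<le> (\<Sum>i\<in>S. f i z) powr (1 - 1 / p)"
        using g by (simp add: b_def pos_divide_le_eq mult.commute)
    qed
    \<comment> \<open>The total weight is \<open>y z = 1\<close>, so the power of it
      disappears.\<close>
    then have "(\<Sum>i\<in>I. \<bar>fvl_fun e (a i)\<bar>) \<le> R" using sum_f[OF z(1)] yz by simp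
    moreover have "(\<Sum>f\<leftarrow>fs. eval_real (\<lambda>x. f (T x)) abse) = g * (\<Sum>i\<in>I. \<bar>fvl_fun e (a i)\<bar>)"
    proof -
      have "eval_real (\<lambda>x. f i (T x)) abse = g * \<bar>fvl_fun e (a i)\<bar>" if i: "i \<in> I" for i
      proof -
        have "(\<lambda>x. f i (T x)) = (\<lambda>x. g * blinfun_apply (a i) x)" using g i by (simp add: a_def a_apply)
        then have "eval_real (\<lambda>x. f i (T x)) e = g * fvl_fun e (a i)"
          using eval_real_scale[of g "blinfun_apply (a i)" e] g by (simp add: fvl_fun_def)
        moreover have "max s (- s) = \<bar>s\<bar>" for s :: real by (simp add: abs_if max_def)
        ultimately show ?thesis using g by (simp add: abse_def abs_mult)
      qed
      then show ?thesis
        by (simp add: sum_list_sum_nth atLeast0LessThan sum_distrib_left I_def f_def)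
    qed
    ultimately have "(\<Sum>f\<leftarrow>fs. eval_real (\<lambda>x. f (T x)) abse) \<le> g * R" using g by simp
    with le show ?thesis using yt t by (simp add: te)
  qed
  then show ?thesis unfolding v_def g_def by (rule field_le_epsilon)
qed

end

theorem rho_Cp_le:
  fixes e :: "'e::banach lexpr"
  assumes p: "1 < p"
  shows "rho_Cp TYPE('y::real_vector) p e \<le> ennreal (gamma_p p) * rho_pinf p e"
proof (cases "rho_pinf p e = \<infinity>")
  case True
  then show ?thesis using gamma_p_pos[OF p] by (simp add: ennreal_mult_top)
next
  case False
  then obtain R where R: "rho_pinf p e = ennreal R" "0 \<le> R" by (cases "rho_pinf p e") auto
  show ?thesis
    unfolding rho_Cp_def
  proof (rule SUP_least, clarify)
    fix V :: "'y set" and le nrm and T :: "'e \<Rightarrow> 'y"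
    assume V: "banach_lattice V le nrm" "upper_p_estimate1 p V le nrm" and T: "lin_contraction V nrm T"
    interpret banach_lattice_on V le nrm using V(1) by (rule banach_lattice_imp_locale)
    interpret upper_p_lattice V le nrm p using p V(2) by unfold_locales
    have "nrm (eval_lat V le T e) \<le> gamma_p p * R" using T R by (intro nrm_eval_lat_le) auto
    then show "ennreal (nrm (eval_lat V le T e)) \<le> ennreal (gamma_p p) * rho_pinf p e"
      using gamma_p_pos[OF p] R by (simp add: ennreal_mult[symmetric] ennreal_leI)
  qed
qed

section \<open>Operators into weak Lebesgue spaces\<close>

text \<open>For counting measure on finitely many points the sets of positive finite measure are the
  nonempty subsets, so the finite weak norm is an honest weak \<open>L\<^sup>p\<close> norm.\<close>

lemma wnorm_count_space:
  assumes n: "1 \<le> n"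
  shows "wnorm (count_space {..<n}) p h = ennreal (wnorm_fin p n h)"
proof -
  let ?M = "count_space {..<n}"
  have eq: "ennreal (measure ?M A powr (1 / p - 1)) * (\<integral>\<^sup>+ x \<in> A. ennreal \<bar>h x\<bar> \<partial>?M)
      = ennreal (real (card A) powr (1 / p - 1) * (\<Sum>i\<in>A. \<bar>h i\<bar>))" if A: "A \<subseteq> {..<n}" for A
  proof -
    have "(\<integral>\<^sup>+ x \<in> A. ennreal \<bar>h x\<bar> \<partial>?M) = (\<Sum>i<n. ennreal \<bar>h i\<bar> * indicator A i)"
      by (simp add: nn_integral_count_space_finite)
    also have "\<dots> = (\<Sum>i\<in>A. ennreal \<bar>h i\<bar>)"
      using A by (intro sum.mono_neutral_cong_right) auto
    also have "\<dots> = ennreal (\<Sum>i\<in>A. \<bar>h i\<bar>)" by simp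
    finally show ?thesis using A by (simp add: measure_count_space ennreal_mult sum_nonneg finite_subset)
  qed
  show ?thesis
  proof (rule antisym)
    show "wnorm ?M p h \<le> ennreal (wnorm_fin p n h)"
      unfolding wnorm_def
    proof (rule SUP_least)
      fix A assume "A \<in> {A \<in> sets ?M. 0 < emeasure ?M A \<and> emeasure ?M A < \<infinity>}"
      then have A: "A \<subseteq> {..<n}" "A \<noteq> {}" by auto
      show "ennreal (measure ?M A powr (1 / p - 1)) * (\<integral>\<^sup>+ x \<in> A. ennreal \<bar>h x\<bar> \<partial>?M) \<le> ennreal (wnorm_fin p n h)"
        unfolding eq[OF A(1)] using wnorm_fin_ge[OF A(2,1)] by (rule ennreal_leI)
    qed
    obtain A where A: "A \<noteq> {}" "A \<subseteq> {..<n}"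
      "wnorm_fin p n h = real (card A) powr (1 / p - 1) * (\<Sum>i\<in>A. \<bar>h i\<bar>)"
      using wnorm_fin_attained[OF n] by blast
    have "finite A" using A(2) finite_subset by auto
    then show "ennreal (wnorm_fin p n h) \<le> wnorm ?M p h"
      unfolding A(3) eq[OF A(2), symmetric] wnorm_def using A
      by (intro SUP_upper) (auto simp: emeasure_count_space card_gt_0_iff ennreal_of_nat_eq_real_of_nat)
  qed
qed

lemma wnorm_fin_le_norm:
  fixes xs :: "nat \<Rightarrow> 'e::banach \<Rightarrow>\<^sub>L real"
  assumes n: "1 \<le> n" and xs: "\<And>x. norm x \<le> 1 \<Longrightarrow> wnorm_fin p n (\<lambda>i. xs i x) \<le> 1"
  shows "wnorm_fin p n (\<lambda>i. xs i x) \<le> norm x"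
proof (rule wnorm_fin_le[OF n])
  fix A assume A: "A \<noteq> {}" "A \<subseteq> {..<n}"
  show "real (card A) powr (1 / p - 1) * (\<Sum>i\<in>A. \<bar>xs i x\<bar>) \<le> norm x"
  proof (cases "x = 0")
    case False
    have "real (card A) powr (1 / p - 1) * (\<Sum>i\<in>A. \<bar>xs i (x /\<^sub>R norm x)\<bar>) \<le> 1"
      using wnorm_fin_ge[OF A, of p] xs[of "x /\<^sub>R norm x"] False by (fastforce intro: order_trans)
    moreover have "(\<Sum>i\<in>A. \<bar>xs i (x /\<^sub>R norm x)\<bar>) = (\<Sum>i\<in>A. \<bar>xs i x\<bar>) / norm x"
      by (simp add: blinfun.scaleR_right abs_mult sum_divide_distrib divide_inverse mult.commute sum_distrib_left)
    ultimately show ?thesis using False by (simp add: pos_divide_le_eq)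
  qed simp
qed

text \<open>An admissible family of n functionals is the same thing as a contraction into weak
  \<open>L\<^sup>p\<close> of n points, where the extension acts coordinatewise.\<close>

theorem rho_pinf_le_rho_Xp: "rho_pinf p (e :: 'e::banach lexpr) \<le> rho_Xp TYPE(nat) p e"
  unfolding rho_pinf_def
proof (rule SUP_least, clarify)
  fix n :: nat and xs :: "nat \<Rightarrow> 'e \<Rightarrow>\<^sub>L real"
  assume n: "1 \<le> n" and xs: "\<forall>x. norm x \<le> 1 \<longrightarrow> wnorm_fin p n (\<lambda>i. xs i x) \<le> 1"
  let ?M = "count_space {..<n}" and ?T = "\<lambda>x i. blinfun_apply (xs i) x"
  have "weakLp_contraction ?M p ?T"
    unfolding weakLp_contraction_def using wnorm_fin_le_norm[OF n] xs
    by (auto simp: wnorm_count_space[OF n] blinfun.add_right blinfun.scaleR_right intro!: ennreal_leI)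
  moreover have "sigma_finite_measure ?M" by (rule sigma_finite_measure_count_space_finite) simp
  ultimately have "wnorm ?M p (\<lambda>i. eval_real (\<lambda>x. ?T x i) e) \<le> rho_Xp TYPE(nat) p e"
    unfolding rho_Xp_def by (intro SUP_upper2[of "(?M, ?T)"]) auto
  then show "ennreal (wnorm_fin p n (\<lambda>i. fvl_fun e (xs i))) \<le> rho_Xp TYPE(nat) p e"
    by (simp add: wnorm_count_space[OF n] fvl_fun_def)
qed

text \<open>The supremum in \<open>wnorm\<close> leaves out null sets, over which the integral
  vanishes anyway; for the others the measure factor is inverted.\<close>

lemma nn_integral_le_of_wnorm_le:
  assumes h: "wnorm M p h \<le> ennreal c" "0 \<le> c" and A: "A \<in> sets M" "emeasure M A < \<infinity>"
  shows "(\<integral>\<^sup>+ x \<in> A. ennreal \<bar>h x\<bar> \<partial>M) \<le> ennreal (measure M A powr (1 - 1 / p) * c)"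
proof (cases "emeasure M A = 0")
  case True
  then have "A \<in> null_sets M" using A by auto
  then show ?thesis by (simp add: nn_integral_null_set)
next
  case False
  let ?m = "measure M A" and ?I = "\<integral>\<^sup>+ x \<in> A. ennreal \<bar>h x\<bar> \<partial>M"
  have m: "0 < ?m" using False A by (simp add: measure_def enn2real_positive_iff zero_less_iff_neq_zero)
  have "ennreal (?m powr (1 / p - 1)) * ?I \<le> wnorm M p h"
    unfolding wnorm_def using A False by (intro SUP_upper) (auto simp: zero_less_iff_neq_zero)
  then have le: "ennreal (?m powr (1 / p - 1)) * ?I \<le> ennreal c" using h(1) by (rule order_trans)
  have "?m powr (1 - 1 / p) * ?m powr (1 / p - 1) = 1" using m by (simp flip: powr_add)
  then have "ennreal (?m powr (1 - 1 / p)) * ennreal (?m powr (1 / p - 1)) = 1"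
    by (simp flip: ennreal_mult)
  then have "?I = ennreal (?m powr (1 - 1 / p)) * (ennreal (?m powr (1 / p - 1)) * ?I)"
    by (simp flip: mult.assoc)
  also have "\<dots> \<le> ennreal (?m powr (1 - 1 / p)) * ennreal c" using le by (rule mult_left_mono) simp
  also have "\<dots> = ennreal (?m powr (1 - 1 / p) * c)" using h by (simp add: ennreal_mult)
  finally show ?thesis .
qed

lemma eval_real_measurable:
  assumes "\<And>x. T x \<in> borel_measurable M"
  shows "(\<lambda>w. eval_real (\<lambda>x. T x w) e) \<in> borel_measurable M"
  using assms by (induction e) auto

section \<open>Discretizing an operator into weak Lebesgue spaces by integrals over small
  sets\<close>

locale weakLp_operator =
  fixes M :: "'b measure" and p :: real and T :: "'e::banach \<Rightarrow> 'b \<Rightarrow> real"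
  assumes p: "1 < p" and T: "weakLp_contraction M p T"
begin

lemma T_measurable [measurable]: "T x \<in> borel_measurable M"
  and wnorm_T_le: "wnorm M p (T x) \<le> ennreal (norm x)"
  and T_add: "AE w in M. T (x + y) w = T x w + T y w"
  and T_scale: "AE w in M. T (c *\<^sub>R x) w = c * T x w"
  using T by (auto simp: weakLp_contraction_def)

lemma nn_integral_T_le:
  "A \<in> sets M \<Longrightarrow> emeasure M A < \<infinity> \<Longrightarrow>
    (\<integral>\<^sup>+ w \<in> A. ennreal \<bar>T x w\<bar> \<partial>M) \<le> ennreal (measure M A powr (1 - 1 / p) * norm x)"
  by (rule nn_integral_le_of_wnorm_le[OF wnorm_T_le]) auto

text \<open>Since \<open>T\<close> is linear only almost everywhere, evaluation at a point need not
  be a linear functional of x. Integration over a set of finite measure turns the a.e. identities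
  into identities and gives a bounded functional.\<close>

definition integral_over :: "'b set \<Rightarrow> 'e \<Rightarrow>\<^sub>L real" where
  "integral_over B = Blinfun (\<lambda>x. \<integral>w. indicator B w * T x w \<partial>M)"

context
  fixes B assumes B [measurable]: "B \<in> sets M" and B_fin: "emeasure M B < \<infinity>"
begin

lemma T_integrable: "integrable M (\<lambda>w. indicator B w * T x w)"
proof (rule integrableI_bounded)
  have "(\<integral>\<^sup>+ w. ennreal (norm (indicator B w * T x w)) \<partial>M) = (\<integral>\<^sup>+ w \<in> B. ennreal \<bar>T x w\<bar> \<partial>M)"
    by (intro nn_integral_cong) (auto simp: indicator_def)
  also have "\<dots> < \<infinity>" using nn_integral_T_le[OF B B_fin, of x] by (auto simp: order_le_less_trans)
  finally show "(\<integral>\<^sup>+ w. ennreal (norm (indicator B w * T x w)) \<partial>M) < \<infinity>" .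
qed measurable

lemma abs_integral_T_le:
  "ennreal \<bar>\<integral>w. indicator B w * T x w \<partial>M\<bar> \<le> (\<integral>\<^sup>+ w \<in> B. ennreal \<bar>T x w\<bar> \<partial>M)"
proof -
  have "ennreal (norm (\<integral>w. indicator B w * T x w \<partial>M)) \<le> (\<integral>\<^sup>+ w. ennreal (norm (indicator B w * T x w)) \<partial>M)"
    by (rule integral_norm_bound_ennreal[OF T_integrable])
  also have "\<dots> = (\<integral>\<^sup>+ w \<in> B. ennreal \<bar>T x w\<bar> \<partial>M)"
    by (intro nn_integral_cong) (auto simp: indicator_def)
  finally show ?thesis by simp
qed

lemma integral_over_apply: "blinfun_apply (integral_over B) x = (\<integral>w. indicator B w * T x w \<partial>M)"
proof -
  have "bounded_linear (\<lambda>x. \<integral>w. indicator B w * T x w \<partial>M)"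
  proof (rule bounded_linear_intro)
    fix x y
    have "(\<integral>w. indicator B w * T (x + y) w \<partial>M) = (\<integral>w. indicator B w * T x w + indicator B w * T y w \<partial>M)"
      using T_add[of x y] by (intro integral_cong_AE) (auto simp: algebra_simps)
    then show "(\<integral>w. indicator B w * T (x + y) w \<partial>M) = (\<integral>w. indicator B w * T x w \<partial>M) + (\<integral>w. indicator B w * T y w \<partial>M)"
      by (simp add: T_integrable)
  next
    fix c x
    have "(\<integral>w. indicator B w * T (c *\<^sub>R x) w \<partial>M) = (\<integral>w. c * (indicator B w * T x w) \<partial>M)"
      using T_scale[of c x] by (intro integral_cong_AE) (auto simp: algebra_simps)
    then show "(\<integral>w. indicator B w * T (c *\<^sub>R x) w \<partial>M) = c *\<^sub>R (\<integral>w. indicator B w * T x w \<partial>M)" by simp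
  next
    fix x
    have "ennreal \<bar>\<integral>w. indicator B w * T x w \<partial>M\<bar> \<le> ennreal (measure M B powr (1 - 1 / p) * norm x)"
      using abs_integral_T_le nn_integral_T_le[OF B B_fin] by (rule order_trans)
    then show "norm (\<integral>w. indicator B w * T x w \<partial>M) \<le> norm x * (measure M B powr (1 - 1 / p))"
      by (simp add: ennreal_le_iff mult.commute)
  qed
  then show ?thesis by (simp add: integral_over_def bounded_linear_Blinfun_apply)
qed

lemma integral_over_approx:
  assumes "\<And>w. w \<in> B \<Longrightarrow> \<bar>T x w - c\<bar> \<le> \<epsilon>"
  shows "\<bar>integral_over B x - measure M B * c\<bar> \<le> measure M B * \<epsilon>"
proof -
  have ind: "integrable M (\<lambda>w. indicator B w * d)" for d :: real
    using B_fin by (intro integrable_mult_left) (simp add: integrable_indicator_iff)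
  have "integral_over B x - measure M B * c = (\<integral>w. indicator B w * T x w - indicator B w * c \<partial>M)"
    using ind[of c] by (simp add: integral_over_apply T_integrable)
  then have "\<bar>integral_over B x - measure M B * c\<bar> \<le> (\<integral>w. \<bar>indicator B w * T x w - indicator B w * c\<bar> \<partial>M)"
    using integral_abs_bound[of M "\<lambda>w. indicator B w * T x w - indicator B w * c"] by simp
  also have "\<dots> \<le> (\<integral>w. indicator B w * \<epsilon> \<partial>M)"
    using assms by (intro integral_mono integrable_abs ind Bochner_Integration.integrable_diff T_integrable)
      (auto simp: indicator_def)
  finally show ?thesis by simp
qed

end

lemma nn_integral_disjoint_UN:
  fixes B :: "'i \<Rightarrow> 'b set"
  assumes "finite I" "\<And>i. i \<in> I \<Longrightarrow> B i \<in> sets M" "disjoint_family_on B I" "h \<in> borel_measurable M"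
  shows "(\<integral>\<^sup>+ w \<in> (\<Union>i\<in>I. B i). ennreal \<bar>h w\<bar> \<partial>M) = (\<Sum>i\<in>I. \<integral>\<^sup>+ w \<in> B i. ennreal \<bar>h w\<bar> \<partial>M)"
proof -
  have "(\<integral>\<^sup>+ w \<in> (\<Union>i\<in>I. B i). ennreal \<bar>h w\<bar> \<partial>M) = (\<integral>\<^sup>+ w. (\<Sum>i\<in>I. ennreal \<bar>h w\<bar> * indicator (B i) w) \<partial>M)"
    using assms by (simp add: indicator_UN_disjoint sum_distrib_left)
  also have "\<dots> = (\<Sum>i\<in>I. \<integral>\<^sup>+ w \<in> B i. ennreal \<bar>h w\<bar> \<partial>M)"
    using assms by (intro nn_integral_sum) auto
  finally show ?thesis .
qed

text \<open>On a piece the integrand is within L \<epsilon> of the evaluation at the constants, and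
  the integral functional is close to the measure times these constants. Homogeneity matches the
  two, at the cost of two errors per unit of measure. The measures of the pieces serve as
  weights.\<close>

lemma nn_integral_eval_le_on_pieces:
  assumes I: "finite I" and B: "\<And>i. i \<in> I \<Longrightarrow> B i \<in> sets M" "\<And>i. i \<in> I \<Longrightarrow> emeasure M (B i) < \<infinity>"
    and disj: "disjoint_family_on B I" and \<epsilon>: "0 \<le> \<epsilon>"
    and approx: "\<And>i x w. i \<in> I \<Longrightarrow> x \<in> set_lexpr e \<Longrightarrow> w \<in> B i \<Longrightarrow> \<bar>T x w - c i x\<bar> \<le> \<epsilon>"
    and R: "rho_pinf p e \<le> ennreal R" "0 \<le> R"
  shows "(\<integral>\<^sup>+ w \<in> (\<Union>i\<in>I. B i). ennreal \<bar>eval_real (\<lambda>x. T x w) e\<bar> \<partial>M)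
    \<le> ennreal (measure M (\<Union>i\<in>I. B i) powr (1 - 1 / p) * R
        + 2 * lipschitz_const e * \<epsilon> * measure M (\<Union>i\<in>I. B i))"
proof -
  define L where "L = lipschitz_const e"
  define \<mu> where "\<mu> i = measure M (B i)" for i
  have \<mu>_sum: "(\<Sum>i\<in>S. \<mu> i) = measure M (\<Union>i\<in>S. B i)" if S: "S \<subseteq> I" for S
    unfolding \<mu>_def using S I B disj
    by (intro measure_finite_Union[symmetric]) (auto intro: finite_subset disjoint_family_on_mono simp: less_top[symmetric])
  have main: "(\<Sum>i\<in>I. \<bar>fvl_fun e (integral_over (B i))\<bar>) \<le> (\<Sum>i\<in>I. \<mu> i) powr (1 - 1 / p) * R"
  proof (rule weighted_sum_le_rho_pinf[OF p I _ _ R])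
    show "0 \<le> \<mu> i" for i by (simp add: \<mu>_def)
    fix S and x :: 'e assume S: "S \<subseteq> I" and x: "norm x \<le> 1"
    have finS: "finite S" using S I finite_subset by blast
    have fin: "emeasure M (\<Union>i\<in>S. B i) < \<infinity>"
    proof -
      have "emeasure M (\<Union>i\<in>S. B i) \<le> (\<Sum>i\<in>S. emeasure M (B i))"
        using S B finS by (intro emeasure_subadditive_finite) auto
      also have "\<dots> < \<infinity>" using S B finS by (auto simp: ennreal_sum_less_top)
      finally show ?thesis .
    qed
    \<comment> \<open>By disjointness the integrals over the pieces in S add up to one integral over
      their union, a single set on which the weak norm can be tested.\<close>
    have "ennreal (\<Sum>i\<in>S. \<bar>integral_over (B i) x\<bar>) = (\<Sum>i\<in>S. ennreal \<bar>integral_over (B i) x\<bar>)" by simp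
    also have "\<dots> \<le> (\<Sum>i\<in>S. \<integral>\<^sup>+ w \<in> B i. ennreal \<bar>T x w\<bar> \<partial>M)"
      using S B abs_integral_T_le by (intro sum_mono) (auto simp: integral_over_apply)
    also have "\<dots> = (\<integral>\<^sup>+ w \<in> (\<Union>i\<in>S. B i). ennreal \<bar>T x w\<bar> \<partial>M)"
      using S B finS disj by (intro nn_integral_disjoint_UN[symmetric]) (auto intro: disjoint_family_on_mono)
    also have "\<dots> \<le> ennreal (measure M (\<Union>i\<in>S. B i) powr (1 - 1 / p) * norm x)"
      using S B finS fin by (intro nn_integral_T_le) auto
    also have "\<dots> \<le> ennreal (measure M (\<Union>i\<in>S. B i) powr (1 - 1 / p))"
      using x by (intro ennreal_leI mult_left_le) auto
    finally show "(\<Sum>i\<in>S. \<bar>integral_over (B i) x\<bar>) \<le> (\<Sum>i\<in>S. \<mu> i) powr (1 - 1 / p)"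
      unfolding \<mu>_sum[OF S] by (simp add: ennreal_le_iff)
  qed
  have piece: "(\<integral>\<^sup>+ w \<in> B i. ennreal \<bar>eval_real (\<lambda>x. T x w) e\<bar> \<partial>M)
      \<le> ennreal (\<bar>fvl_fun e (integral_over (B i))\<bar> + 2 * L * \<epsilon> * \<mu> i)" if i: "i \<in> I" for i
  proof -
    have L: "0 \<le> L" by (simp add: L_def lipschitz_const_nonneg)
    have "(\<integral>\<^sup>+ w \<in> B i. ennreal \<bar>eval_real (\<lambda>x. T x w) e\<bar> \<partial>M)
        \<le> (\<integral>\<^sup>+ w \<in> B i. ennreal (\<bar>eval_real (c i) e\<bar> + L * \<epsilon>) \<partial>M)"
    proof (rule nn_integral_mono)
      fix w
      have "\<bar>eval_real (\<lambda>x. T x w) e\<bar> \<le> \<bar>eval_real (c i) e\<bar> + L * \<epsilon>" if "w \<in> B i"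
        using eval_real_lipschitz[of e "\<lambda>x. T x w" "c i" \<epsilon>] approx[OF i _ that] \<epsilon> by (force simp: L_def)
      then show "ennreal \<bar>eval_real (\<lambda>x. T x w) e\<bar> * indicator (B i) w
          \<le> ennreal (\<bar>eval_real (c i) e\<bar> + L * \<epsilon>) * indicator (B i) w"
        by (auto simp: indicator_def intro: ennreal_leI)
    qed
    also have "\<dots> = ennreal (\<bar>eval_real (c i) e\<bar> + L * \<epsilon>) * emeasure M (B i)"
      using B i by (simp add: nn_integral_cmult_indicator)
    also have "\<dots> = ennreal ((\<bar>eval_real (c i) e\<bar> + L * \<epsilon>) * \<mu> i)"
      using B(2)[OF i] L \<epsilon> by (simp add: \<mu>_def emeasure_eq_ennreal_measure ennreal_mult)
    also have "(\<bar>eval_real (c i) e\<bar> + L * \<epsilon>) * \<mu> i \<le> \<bar>fvl_fun e (integral_over (B i))\<bar> + 2 * L * \<epsilon> * \<mu> i"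
    proof -
      have "\<bar>fvl_fun e (integral_over (B i)) - eval_real (\<lambda>x. \<mu> i * c i x) e\<bar> \<le> L * (\<mu> i * \<epsilon>)"
        unfolding fvl_fun_def L_def \<mu>_def using \<epsilon> approx i
        by (intro eval_real_lipschitz integral_over_approx B) auto
      moreover have "eval_real (\<lambda>x. \<mu> i * c i x) e = \<mu> i * eval_real (c i) e"
        by (rule eval_real_scale) (simp add: \<mu>_def)
      moreover have "\<bar>\<mu> i * eval_real (c i) e\<bar> = \<mu> i * \<bar>eval_real (c i) e\<bar>"
        by (simp add: abs_mult \<mu>_def)
      ultimately have "\<mu> i * \<bar>eval_real (c i) e\<bar> \<le> \<bar>fvl_fun e (integral_over (B i))\<bar> + L * (\<mu> i * \<epsilon>)" by linarith
      then show ?thesis by (simp add: algebra_simps)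
    qed
    finally show ?thesis by (simp add: ennreal_leI)
  qed
  have "(\<integral>\<^sup>+ w \<in> (\<Union>i\<in>I. B i). ennreal \<bar>eval_real (\<lambda>x. T x w) e\<bar> \<partial>M)
    = (\<Sum>i\<in>I. \<integral>\<^sup>+ w \<in> B i. ennreal \<bar>eval_real (\<lambda>x. T x w) e\<bar> \<partial>M)"
    using I B disj by (intro nn_integral_disjoint_UN eval_real_measurable) auto
  also have "\<dots> \<le> (\<Sum>i\<in>I. ennreal (\<bar>fvl_fun e (integral_over (B i))\<bar> + 2 * L * \<epsilon> * \<mu> i))"
    by (intro sum_mono piece)
  also have "\<dots> = ennreal (\<Sum>i\<in>I. \<bar>fvl_fun e (integral_over (B i))\<bar> + 2 * L * \<epsilon> * \<mu> i)"
    using \<epsilon> by (intro sum_ennreal) (auto simp: L_def \<mu>_def lipschitz_const_nonneg)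
  also have "(\<Sum>i\<in>I. \<bar>fvl_fun e (integral_over (B i))\<bar> + 2 * L * \<epsilon> * \<mu> i)
    = (\<Sum>i\<in>I. \<bar>fvl_fun e (integral_over (B i))\<bar>) + 2 * L * \<epsilon> * (\<Sum>i\<in>I. \<mu> i)"
    by (simp add: sum.distrib sum_distrib_left)
  also have "\<dots> \<le> (\<Sum>i\<in>I. \<mu> i) powr (1 - 1 / p) * R + 2 * L * \<epsilon> * (\<Sum>i\<in>I. \<mu> i)"
    using main by simp
  finally show ?thesis using \<mu>_sum[OF order_refl] by (simp add: L_def ennreal_leI)
qed

text \<open>A grid of mesh \<epsilon> in the values of the finitely many functions
  \<open>T x\<close> makes them almost constant on each cell. These functions may be unbounded, so A
  is exhausted by finite unions of cells, and monotone convergence concludes.\<close>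

lemma nn_integral_eval_le:
  assumes A [measurable]: "A \<in> sets M" and fin: "emeasure M A < \<infinity>" and \<epsilon>: "0 < \<epsilon>"
    and R: "rho_pinf p e \<le> ennreal R" "0 \<le> R"
  shows "(\<integral>\<^sup>+ w \<in> A. ennreal \<bar>eval_real (\<lambda>x. T x w) e\<bar> \<partial>M)
    \<le> ennreal (measure M A powr (1 - 1 / p) * R + 2 * lipschitz_const e * \<epsilon> * measure M A)"
    (is "_ \<le> ennreal ?D")
proof -
  let ?X = "set_lexpr e" and ?h = "\<lambda>w. eval_real (\<lambda>x. T x w) e"
  define k where "k x w = \<lfloor>T x w / \<epsilon>\<rfloor>" for x w
  define B where "B \<kappa> = {w \<in> space M. w \<in> A \<and> (\<forall>x\<in>?X. k x w = \<kappa> x)}" for \<kappa>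
  \<comment> \<open>The index functions are extensional, so two different ones differ at some atom
    and their cells are disjoint. The bound m keeps the index set finite.\<close>
  define I where "I m = (\<Pi>\<^sub>E x\<in>?X. {- int m..int m})" for m
  define U where "U m = {w \<in> A. \<forall>x\<in>?X. k x w \<in> {- int m..int m}}" for m
  have AM: "A \<subseteq> space M" using A by (rule sets.sets_into_space)
  have B_sets: "B \<kappa> \<in> sets M" for \<kappa>
    unfolding B_def k_def using finite_atoms[of e] by measurable
  have BA: "B \<kappa> \<subseteq> A" for \<kappa> by (auto simp: B_def)
  have U_eq: "(\<Union>\<kappa>\<in>I m. B \<kappa>) = U m" for m
  proof
    show "(\<Union>\<kappa>\<in>I m. B \<kappa>) \<subseteq> U m" by (auto simp: U_def I_def B_def PiE_iff)
    show "U m \<subseteq> (\<Union>\<kappa>\<in>I m. B \<kappa>)"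
    proof
      fix w assume w: "w \<in> U m"
      then have "restrict (\<lambda>x. k x w) ?X \<in> I m" "w \<in> B (restrict (\<lambda>x. k x w) ?X)"
        using AM by (auto simp: U_def I_def B_def)
      then show "w \<in> (\<Union>\<kappa>\<in>I m. B \<kappa>)" by blast
    qed
  qed
  have finI: "finite (I m)" for m unfolding I_def using finite_atoms by (intro finite_PiE) auto
  have U_sets [measurable]: "U m \<in> sets M" for m
    unfolding U_eq[symmetric] using finI B_sets by auto
  have step: "(\<integral>\<^sup>+ w \<in> U m. ennreal \<bar>?h w\<bar> \<partial>M) \<le> ennreal ?D" for m
  proof -
    have "(\<integral>\<^sup>+ w \<in> (\<Union>\<kappa>\<in>I m. B \<kappa>). ennreal \<bar>?h w\<bar> \<partial>M)
      \<le> ennreal (measure M (\<Union>\<kappa>\<in>I m. B \<kappa>) powr (1 - 1 / p) * R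
        + 2 * lipschitz_const e * \<epsilon> * measure M (\<Union>\<kappa>\<in>I m. B \<kappa>))"
    proof (rule nn_integral_eval_le_on_pieces[where c = "\<lambda>\<kappa> x. \<epsilon> * of_int (\<kappa> x)", OF finI B_sets _ _ _ _ R])
      show "emeasure M (B \<kappa>) < \<infinity>" for \<kappa>
        using emeasure_mono[OF BA A] fin by (rule order_le_less_trans)
      show "disjoint_family_on B (I m)"
        unfolding disjoint_family_on_def
      proof (intro ballI impI)
        fix \<kappa> \<kappa>' assume I: "\<kappa> \<in> I m" "\<kappa>' \<in> I m" and "\<kappa> \<noteq> \<kappa>'"
        then obtain x where "x \<in> ?X" "\<kappa> x \<noteq> \<kappa>' x" unfolding I_def by (metis PiE_ext)
        then show "B \<kappa> \<inter> B \<kappa>' = {}" by (auto simp: B_def)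
      qed
      fix \<kappa> x w assume "x \<in> ?X" "w \<in> B \<kappa>"
      then have k: "\<kappa> x = \<lfloor>T x w / \<epsilon>\<rfloor>" by (auto simp: B_def k_def)
      have "of_int (\<kappa> x) \<le> T x w / \<epsilon>" "T x w / \<epsilon> \<le> of_int (\<kappa> x) + 1" unfolding k by linarith+
      then show "\<bar>T x w - \<epsilon> * of_int (\<kappa> x)\<bar> \<le> \<epsilon>"
        using \<epsilon> by (simp add: field_simps abs_le_iff)
    qed (use \<epsilon> in auto)
    also have "\<dots> \<le> ennreal ?D"
    proof (intro ennreal_leI add_mono mult_right_mono mult_left_mono powr_mono2)
      show "measure M (\<Union>\<kappa>\<in>I m. B \<kappa>) \<le> measure M A"
        unfolding U_eq using fin A U_sets[of m]
        by (intro measure_mono_fmeasurable) (auto simp: fmeasurable_def U_def[of m])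
      then show "measure M (\<Union>\<kappa>\<in>I m. B \<kappa>) \<le> measure M A" .
    qed (use p R \<epsilon> in \<open>auto simp: lipschitz_const_nonneg\<close>)
    finally show ?thesis by (simp add: U_eq)
  qed
  have h_meas [measurable]: "?h \<in> borel_measurable M" by (rule eval_real_measurable) simp
  have "(\<integral>\<^sup>+ w \<in> A. ennreal \<bar>?h w\<bar> \<partial>M) = (\<integral>\<^sup>+ w. (SUP m. ennreal \<bar>?h w\<bar> * indicator (U m) w) \<partial>M)"
  proof (rule nn_integral_cong)
    fix w
    show "ennreal \<bar>?h w\<bar> * indicator A w = (SUP m. ennreal \<bar>?h w\<bar> * indicator (U m) w)"
    proof (cases "w \<in> A")
      case True
      \<comment> \<open>The sum over all atoms bounds each single grid index, so this level already
        contains w.\<close>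
      define m where "m = nat (\<Sum>x\<in>?X. \<bar>k x w\<bar>)"
      have "k x w \<in> {- int m..int m}" if "x \<in> ?X" for x
      proof -
        have "\<bar>k x w\<bar> \<le> int m"
          using member_le_sum[OF that, of "\<lambda>x. \<bar>k x w\<bar>"] finite_atoms[of e] by (simp add: m_def sum_nonneg)
        then show ?thesis unfolding atLeastAtMost_iff by arith
      qed
      then have "w \<in> U m" using True by (simp add: U_def)
      then have "ennreal \<bar>?h w\<bar> * indicator A w \<le> (SUP m. ennreal \<bar>?h w\<bar> * indicator (U m) w)"
        using True by (intro SUP_upper2[of m]) auto
      moreover have "(SUP m. ennreal \<bar>?h w\<bar> * indicator (U m) w) \<le> ennreal \<bar>?h w\<bar> * indicator A w"
        using True by (intro SUP_least mult_left_mono) (auto simp: indicator_def)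
      ultimately show ?thesis by (rule antisym)
    next
      case False
      then have "indicator (U m) w = (0::ennreal)" for m by (auto simp: U_def indicator_def)
      then show ?thesis using False by simp
    qed
  qed
  also have "\<dots> = (SUP m. \<integral>\<^sup>+ w \<in> U m. ennreal \<bar>?h w\<bar> \<partial>M)"
  proof (rule nn_integral_monotone_convergence_SUP)
    show "incseq (\<lambda>m w. ennreal \<bar>?h w\<bar> * indicator (U m) w)"
      by (intro incseq_SucI le_funI mult_left_mono) (auto simp: U_def indicator_def)
  qed measurable
  also have "\<dots> \<le> ennreal ?D" by (intro SUP_least step)
  finally show ?thesis .
qed

text \<open>For a fixed set A the discretization error is proportional to the mesh, so it can be
  made smaller than any \<eta>.\<close>

lemma wnorm_eval_le:
  assumes R: "rho_pinf p e \<le> ennreal R" "0 \<le> R"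
  shows "wnorm M p (\<lambda>w. eval_real (\<lambda>x. T x w) e) \<le> ennreal R"
  unfolding wnorm_def
proof (rule SUP_least, clarify)
  fix A assume A: "A \<in> sets M" "0 < emeasure M A" "emeasure M A < \<infinity>"
  let ?m = "measure M A" and ?I = "\<integral>\<^sup>+ w \<in> A. ennreal \<bar>eval_real (\<lambda>x. T x w) e\<bar> \<partial>M"
  define D where "D = ?m powr (1 - 1 / p) * R"
  have D: "0 \<le> D" using R by (simp add: D_def)
  have m: "0 < ?m" using A by (simp add: measure_def enn2real_positive_iff)
  have "?I \<le> ennreal D"
  proof (rule ennreal_le_epsilon)
    fix \<eta> :: real assume \<eta>: "0 < \<eta>"
    define d where "d = 2 * lipschitz_const e * ?m + 1"
    have d: "0 < d" by (simp add: d_def lipschitz_const_nonneg add_nonneg_pos)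
    have "?I \<le> ennreal (D + 2 * lipschitz_const e * (\<eta> / d) * ?m)"
      unfolding D_def using A \<eta> d R by (intro nn_integral_eval_le) auto
    also have "\<dots> \<le> ennreal (D + \<eta>)"
    proof (intro ennreal_leI add_left_mono)
      have "2 * lipschitz_const e * (\<eta> / d) * ?m = (\<eta> / d) * (d - 1)" by (simp add: d_def)
      also have "\<dots> \<le> (\<eta> / d) * d" using \<eta> d by (intro mult_left_mono) auto
      finally show "2 * lipschitz_const e * (\<eta> / d) * ?m \<le> \<eta>" using d by simp
    qed
    finally show "?I \<le> ennreal D + ennreal \<eta>" using D \<eta> by simp
  qed
  then have "ennreal (?m powr (1 / p - 1)) * ?I \<le> ennreal (?m powr (1 / p - 1)) * ennreal D"
    by (rule mult_left_mono) simp
  also have "\<dots> = ennreal (?m powr (1 / p - 1) * ?m powr (1 - 1 / p) * R)"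
    using D by (simp add: D_def ennreal_mult mult.assoc)
  also have "?m powr (1 / p - 1) * ?m powr (1 - 1 / p) = 1" using m by (simp flip: powr_add)
  finally show "ennreal (?m powr (1 / p - 1)) * ?I \<le> ennreal R" by simp
qed

end

theorem rho_Xp_le:
  fixes e :: "'e::banach lexpr"
  assumes p: "1 < p"
  shows "rho_Xp TYPE('b) p e \<le> rho_pinf p e"
proof (cases "rho_pinf p e = \<infinity>")
  case False
  then obtain R where R: "rho_pinf p e = ennreal R" "0 \<le> R" by (cases "rho_pinf p e") auto
  show ?thesis
    unfolding rho_Xp_def
  proof (rule SUP_least, clarify)
    fix M :: "'b measure" and T :: "'e \<Rightarrow> 'b \<Rightarrow> real"
    assume T: "weakLp_contraction M p T"
    interpret weakLp_operator M p T using p T by unfold_locales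
    show "wnorm M p (\<lambda>w. eval_real (\<lambda>x. T x w) e) \<le> rho_pinf p e"
      using wnorm_eval_le[of e R] R by simp
  qed
qed simp

section \<open>Finite-dimensional weak Lebesgue spaces\<close>

text \<open>Hoelder's inequality, by Young's inequality for each term after dividing by the two
  total sums; if one of these is 0, all terms on the left vanish.\<close>

lemma holder_sum_powr:
  fixes c a :: "'i \<Rightarrow> real"
  assumes p: "1 < p" and c: "\<And>k. k \<in> K \<Longrightarrow> 0 \<le> c k" and a: "\<And>k. k \<in> K \<Longrightarrow> 0 \<le> a k" and "finite K"
  shows "(\<Sum>k\<in>K. c k powr (1 - 1 / p) * a k) \<le> (\<Sum>k\<in>K. c k) powr (1 - 1 / p) * (\<Sum>k\<in>K. a k powr p) powr (1 / p)"
proof -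
  define C where "C = (\<Sum>k\<in>K. c k)"
  define S where "S = (\<Sum>k\<in>K. a k powr p)"
  have C: "0 \<le> C" and S: "0 \<le> S" using c by (auto simp: C_def S_def sum_nonneg)
  show ?thesis
  proof (cases "C = 0 \<or> S = 0")
    case True
    then have "c k powr (1 - 1 / p) * a k = 0" if "k \<in> K" for k
    proof
      assume "C = 0"
      then have "c k = 0" using that c \<open>finite K\<close> by (simp add: C_def sum_nonneg_eq_0_iff)
      then show ?thesis by simp
    next
      assume "S = 0"
      then have "a k powr p = 0" using that \<open>finite K\<close> by (simp add: S_def sum_nonneg_eq_0_iff)
      then show ?thesis by simp
    qed
    then have "(\<Sum>k\<in>K. c k powr (1 - 1 / p) * a k) = 0" by (intro sum.neutral) blast
    then show ?thesis by (simp only: mult_nonneg_nonneg powr_ge_zero)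
  next
    case False
    then have CS: "0 < C" "0 < S" using C S by auto
    define q where "q = p / (p - 1)"
    have q: "1 < q" "1 - 1 / p = 1 / q" "1 / q + 1 / p = 1" using p by (auto simp: q_def field_simps)
    have "(c k / C) powr (1 / q) * (a k / S powr (1 / p)) \<le> (c k / C) / q + (a k powr p / S) / p"
      if k: "k \<in> K" for k
    proof -
      have "(c k / C) powr (1 / q) * (a k / S powr (1 / p))
          \<le> ((c k / C) powr (1 / q)) powr q / q + (a k / S powr (1 / p)) powr p / p"
        using q p a[OF k] CS by (intro Youngs_inequality) auto
      also have "((c k / C) powr (1 / q)) powr q = c k / C" using q c[OF k] CS by (simp add: powr_powr)
      also have "(a k / S powr (1 / p)) powr p = a k powr p / S"
        using p a[OF k] CS by (simp add: powr_divide powr_powr)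
      finally show ?thesis .
    qed
    then have "(\<Sum>k\<in>K. (c k / C) powr (1 / q) * (a k / S powr (1 / p)))
        \<le> (\<Sum>k\<in>K. (c k / C) / q + (a k powr p / S) / p)" by (rule sum_mono)
    also have "\<dots> = (C / C) / q + (S / S) / p"
      by (simp only: sum.distrib sum_divide_distrib[symmetric] C_def S_def)
    also have "\<dots> = 1" using CS q by simp
    finally have "(\<Sum>k\<in>K. c k powr (1 / q) * a k) / (C powr (1 / q) * S powr (1 / p)) \<le> 1"
      using c CS by (simp add: powr_divide sum_divide_distrib)
    then show ?thesis unfolding q(2) C_def[symmetric] S_def[symmetric] using CS by (simp add: pos_divide_le_eq)
  qed
qed

section \<open>The finite weak norm as a lattice norm with an upper p-estimate\<close>

context
  fixes p :: real and n :: nat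
  assumes p: "1 < p" and n: "1 \<le> n"
begin

lemma wnorm_fin_mono:
  assumes "\<And>i. i < n \<Longrightarrow> \<bar>a i\<bar> \<le> \<bar>b i\<bar>"
  shows "wnorm_fin p n a \<le> wnorm_fin p n b"
proof (rule wnorm_fin_le[OF n])
  fix A assume A: "A \<noteq> {}" "A \<subseteq> {..<n}"
  have "real (card A) powr (1 / p - 1) * (\<Sum>i\<in>A. \<bar>a i\<bar>) \<le> real (card A) powr (1 / p - 1) * (\<Sum>i\<in>A. \<bar>b i\<bar>)"
    using A assms by (intro mult_left_mono sum_mono) auto
  also have "\<dots> \<le> wnorm_fin p n b" using A by (rule wnorm_fin_ge)
  finally show "real (card A) powr (1 / p - 1) * (\<Sum>i\<in>A. \<bar>a i\<bar>) \<le> wnorm_fin p n b" .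
qed

lemma abs_le_wnorm_fin: "i < n \<Longrightarrow> \<bar>a i\<bar> \<le> wnorm_fin p n a"
  using wnorm_fin_ge[of "{i}" n p a] by simp

lemma wnorm_fin_nonneg: "0 \<le> wnorm_fin p n a"
  using abs_le_wnorm_fin[of 0 a] n by simp

lemma wnorm_fin_le_sum: "wnorm_fin p n a \<le> (\<Sum>i<n. \<bar>a i\<bar>)"
proof (rule wnorm_fin_le[OF n])
  fix A assume A: "A \<noteq> {}" "A \<subseteq> {..<n}"
  have "finite A" using A finite_subset by auto
  then have "1 \<le> real (card A)" using A by (simp add: Suc_leI card_gt_0_iff)
  then have "real (card A) powr (1 / p - 1) \<le> real (card A) powr 0" using p by (intro powr_mono) auto
  then have "real (card A) powr (1 / p - 1) * (\<Sum>i\<in>A. \<bar>a i\<bar>) \<le> 1 * (\<Sum>i\<in>A. \<bar>a i\<bar>)"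
    using \<open>1 \<le> real (card A)\<close> by (intro mult_right_mono) (auto simp: sum_nonneg)
  also have "\<dots> \<le> (\<Sum>i<n. \<bar>a i\<bar>)" using A by (simp add: sum_mono2)
  finally show "real (card A) powr (1 / p - 1) * (\<Sum>i\<in>A. \<bar>a i\<bar>) \<le> (\<Sum>i<n. \<bar>a i\<bar>)" .
qed

lemma wnorm_fin_add: "wnorm_fin p n (\<lambda>i. a i + b i) \<le> wnorm_fin p n a + wnorm_fin p n b"
proof (rule wnorm_fin_le[OF n])
  fix A assume A: "A \<noteq> {}" "A \<subseteq> {..<n}"
  have "real (card A) powr (1 / p - 1) * (\<Sum>i\<in>A. \<bar>a i + b i\<bar>)
      \<le> real (card A) powr (1 / p - 1) * (\<Sum>i\<in>A. \<bar>a i\<bar> + \<bar>b i\<bar>)"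
    by (intro mult_left_mono sum_mono abs_triangle_ineq) auto
  also have "\<dots> \<le> wnorm_fin p n a + wnorm_fin p n b"
    using wnorm_fin_ge[OF A, of p a] wnorm_fin_ge[OF A, of p b] by (simp add: sum.distrib distrib_left)
  finally show "real (card A) powr (1 / p - 1) * (\<Sum>i\<in>A. \<bar>a i + b i\<bar>) \<le> wnorm_fin p n a + wnorm_fin p n b" .
qed

lemma wnorm_fin_scale_le: "wnorm_fin p n (\<lambda>i. c * a i) \<le> \<bar>c\<bar> * wnorm_fin p n a"
proof (rule wnorm_fin_le[OF n])
  fix A assume A: "A \<noteq> {}" "A \<subseteq> {..<n}"
  show "real (card A) powr (1 / p - 1) * (\<Sum>i\<in>A. \<bar>c * a i\<bar>) \<le> \<bar>c\<bar> * wnorm_fin p n a"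
    using mult_left_mono[OF wnorm_fin_ge[OF A, of p a], of "\<bar>c\<bar>"]
    by (simp add: abs_mult sum_distrib_left mult.left_commute)
qed

lemma wnorm_fin_scale: "wnorm_fin p n (\<lambda>i. c * a i) = \<bar>c\<bar> * wnorm_fin p n a"
proof (cases "c = 0")
  case True
  then show ?thesis using wnorm_fin_scale_le[of 0 a] wnorm_fin_nonneg[of "\<lambda>_. 0"] by simp
next
  case False
  have "wnorm_fin p n (\<lambda>i. (1 / c) * (c * a i)) \<le> \<bar>1 / c\<bar> * wnorm_fin p n (\<lambda>i. c * a i)"
    by (rule wnorm_fin_scale_le)
  then have "\<bar>c\<bar> * wnorm_fin p n a \<le> wnorm_fin p n (\<lambda>i. c * a i)" using False by (simp add: field_simps)
  then show ?thesis using wnorm_fin_scale_le[of c a] by simp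
qed

text \<open>A test set A is divided among the supports of the x k. Each share obeys its own weak
  bound with the power 1 - 1/p of its cardinality, and Hoelder's inequality recombines them because
  the cardinalities add up to at most that of A.\<close>

lemma wnorm_fin_disjoint_sum:
  fixes x :: "nat \<Rightarrow> nat \<Rightarrow> real"
  assumes disj: "\<And>i j k. i < n \<Longrightarrow> j < m \<Longrightarrow> k < m \<Longrightarrow> j \<noteq> k \<Longrightarrow> x j i = 0 \<or> x k i = 0"
  shows "wnorm_fin p n (\<lambda>i. \<Sum>k<m. x k i) \<le> (\<Sum>k<m. wnorm_fin p n (x k) powr p) powr (1 / p)"
proof (rule wnorm_fin_le[OF n])
  fix A assume A: "A \<noteq> {}" "A \<subseteq> {..<n}"
  have finA: "finite A" using A finite_subset by auto
  have cA: "0 < real (card A)" using A finA by (simp add: card_gt_0_iff)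
  define B where "B k = {i\<in>A. x k i \<noteq> 0}" for k
  have finB: "finite (B k)" for k using finA by (simp add: B_def)
  define r where "r = 1 - 1 / p"
  have r: "0 < r" using p by (simp add: r_def)
  let ?S = "(\<Sum>k<m. wnorm_fin p n (x k) powr p) powr (1 / p)"
  have B_le: "(\<Sum>i\<in>A. \<bar>x k i\<bar>) \<le> real (card (B k)) powr r * wnorm_fin p n (x k)" for k
  proof -
    have eq: "(\<Sum>i\<in>A. \<bar>x k i\<bar>) = (\<Sum>i\<in>B k. \<bar>x k i\<bar>)"
      using finA by (intro sum.mono_neutral_right) (auto simp: B_def)
    show ?thesis
    proof (cases "B k = {}")
      case True
      then show ?thesis unfolding eq by simp
    next
      case False
      then have c: "0 < real (card (B k))" using finB by (simp add: card_gt_0_iff)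
      have "real (card (B k)) powr (1 / p - 1) * (\<Sum>i\<in>B k. \<bar>x k i\<bar>) \<le> wnorm_fin p n (x k)"
        using False A by (intro wnorm_fin_ge) (auto simp: B_def)
      then have "real (card (B k)) powr r * (real (card (B k)) powr (1 / p - 1) * (\<Sum>i\<in>B k. \<bar>x k i\<bar>))
          \<le> real (card (B k)) powr r * wnorm_fin p n (x k)" by (intro mult_left_mono) auto
      moreover have "real (card (B k)) powr r * real (card (B k)) powr (1 / p - 1) = 1"
        using c by (simp flip: powr_add add: r_def)
      ultimately show ?thesis unfolding eq by (simp flip: mult.assoc)
    qed
  qed
  have "(\<Sum>i\<in>A. \<bar>\<Sum>k<m. x k i\<bar>) \<le> (\<Sum>i\<in>A. \<Sum>k<m. \<bar>x k i\<bar>)" by (intro sum_mono sum_abs)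
  also have "\<dots> = (\<Sum>k<m. \<Sum>i\<in>A. \<bar>x k i\<bar>)" by (rule sum.swap)
  also have "\<dots> \<le> (\<Sum>k<m. real (card (B k)) powr r * wnorm_fin p n (x k))" by (intro sum_mono B_le)
  also have "\<dots> \<le> (\<Sum>k<m. real (card (B k))) powr r * ?S"
    unfolding r_def by (rule holder_sum_powr[OF p]) (auto simp: wnorm_fin_nonneg)
  also have "\<dots> \<le> real (card A) powr r * ?S"
  proof (intro mult_right_mono powr_mono2)
    have "(\<Sum>k<m. card (B k)) = card (\<Union>k<m. B k)"
      using finB disj A by (intro card_UN_disjoint[symmetric]) (fastforce simp: B_def)+
    also have "\<dots> \<le> card A" using finA by (intro card_mono) (auto simp: B_def)
    finally show "(\<Sum>k<m. real (card (B k))) \<le> real (card A)" by (simp flip: of_nat_sum)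
  qed (use r in \<open>auto simp: sum_nonneg\<close>)
  finally have "real (card A) powr (1 / p - 1) * (\<Sum>i\<in>A. \<bar>\<Sum>k<m. x k i\<bar>)
    \<le> real (card A) powr (1 / p - 1) * (real (card A) powr r * ?S)" by (intro mult_left_mono) auto
  also have "\<dots> = ?S"
  proof -
    have "real (card A) powr (1 / p - 1) * real (card A) powr r = 1" using cA by (simp flip: powr_add add: r_def)
    then show ?thesis by (simp flip: mult.assoc)
  qed
  finally show "real (card A) powr (1 / p - 1) * (\<Sum>i\<in>A. \<bar>\<Sum>k<m. x k i\<bar>) \<le> ?S" .
qed

end

text \<open>The \<open>n\<close>-dimensional space \<open>\<ell>\<^sup>p\<^sup>,\<^sup>\<infinity>\<close> is realised on the bounded functions on \<open>nat\<close> that vanish from \<open>n\<close> on.\<close>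

definition trunc_fun :: "nat \<Rightarrow> (nat \<Rightarrow> real) \<Rightarrow> nat \<Rightarrow>\<^sub>C real" where
  "trunc_fun n a = Bcontfun (\<lambda>i. if i < n then a i else 0)"

lemma trunc_fun_apply [simp]: "apply_bcontfun (trunc_fun n a) i = (if i < n then a i else 0)"
proof -
  have "finite (range (\<lambda>i. if i < n then a i else 0))"
    by (rule finite_subset[of _ "insert 0 (a ` {..<n})"]) auto
  then have "(\<lambda>i. if i < n then a i else 0) \<in> bcontfun"
    by (auto simp: bcontfun_def finite_imp_bounded)
  then show ?thesis by (simp add: trunc_fun_def Bcontfun_inverse)
qed

definition fin_carrier :: "nat \<Rightarrow> (nat \<Rightarrow>\<^sub>C real) set" where
  "fin_carrier n = {g. \<forall>i\<ge>n. apply_bcontfun g i = 0}"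

definition fin_le :: "nat \<Rightarrow>\<^sub>C real \<Rightarrow> nat \<Rightarrow>\<^sub>C real \<Rightarrow> bool" where
  "fin_le g h \<longleftrightarrow> (\<forall>i. apply_bcontfun g i \<le> apply_bcontfun h i)"

lemma trunc_fun_in: "trunc_fun n a \<in> fin_carrier n"
  by (simp add: fin_carrier_def)

lemma is_lsup_fin:
  assumes "g \<in> fin_carrier n" "h \<in> fin_carrier n"
  shows "is_lsup (fin_carrier n) fin_le g h (trunc_fun n (\<lambda>i. max (g i) (h i)))"
  using assms by (auto simp: is_lsup_def fin_carrier_def fin_le_def not_less)

lemma fin_vector_lattice: "vector_lattice_on (fin_carrier n) fin_le"
proof
  show "subspace (fin_carrier n)" by (auto simp: subspace_def fin_carrier_def)
  show "fin_le x z" if "fin_le x y" "fin_le y z" for x y z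
    using that unfolding fin_le_def by (meson order_trans)
  show "x = y" if "fin_le x y" "fin_le y x" for x y
    using that unfolding fin_le_def by (intro bcontfun_eqI antisym) auto
qed (auto simp: fin_le_def mult_left_mono intro: is_lsup_fin)

lemma lsup_fin:
  assumes "g \<in> fin_carrier n" "h \<in> fin_carrier n"
  shows "lsup (fin_carrier n) fin_le g h = trunc_fun n (\<lambda>i. max (g i) (h i))"
  using vector_lattice_on.lsup_eqI[OF fin_vector_lattice is_lsup_fin[OF assms]] .

lemma fin_carrier_neg: "g \<in> fin_carrier n \<Longrightarrow> - g \<in> fin_carrier n"
  by (simp add: fin_carrier_def)

lemma labs_fin:
  "g \<in> fin_carrier n \<Longrightarrow> labs (fin_carrier n) fin_le g = trunc_fun n (\<lambda>i. \<bar>g i\<bar>)"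
  by (simp add: labs_def lsup_fin fin_carrier_neg abs_real_def max_def cong: if_cong)
    (rule bcontfun_eqI, auto)

text \<open>Completeness is coordinatewise: the norm dominates every coordinate, so Cauchy sequences
  converge there, and it is dominated by the sum of the coordinates, so the limit is a limit in
  norm.\<close>

lemma banach_lattice_fin:
  assumes p: "1 < p" and n: "1 \<le> n"
  shows "banach_lattice (fin_carrier n) fin_le (wnorm_fin p n \<circ> apply_bcontfun)"
proof -
  interpret vector_lattice_on "fin_carrier n" fin_le by (rule fin_vector_lattice)
  let ?nrm = "wnorm_fin p n \<circ> apply_bcontfun"
  have zero: "g = 0" if "g \<in> fin_carrier n" "?nrm g = 0" for g
  proof (rule bcontfun_eqI)
    fix i
    show "g i = (0 :: nat \<Rightarrow>\<^sub>C real) i"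
      using that abs_le_wnorm_fin[OF p n, of i "apply_bcontfun g"] by (cases "i < n") (auto simp: fin_carrier_def)
  qed
  have zero': "?nrm 0 = 0"
    using wnorm_fin_scale[OF p n, of 0 "\<lambda>_. 0"] by (simp add: zero_bcontfun.rep_eq[abs_def] comp_def)
  have complete: "\<exists>l\<in>fin_carrier n. (\<lambda>m. ?nrm (X m - l)) \<longlonglongrightarrow> 0"
    if X: "\<forall>m. X m \<in> fin_carrier n" and cauchy: "\<forall>\<epsilon>>0. \<exists>N. \<forall>m\<ge>N. \<forall>k\<ge>N. ?nrm (X m - X k) < \<epsilon>"
    for X :: "nat \<Rightarrow> nat \<Rightarrow>\<^sub>C real"
  proof -
    have "convergent (\<lambda>m. X m i)" if i: "i < n" for i
    proof -
      have "Cauchy (\<lambda>m. X m i)"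
      proof (rule metric_CauchyI)
        fix \<epsilon> :: real assume "0 < \<epsilon>"
        then obtain N where N: "\<And>m k. m \<ge> N \<Longrightarrow> k \<ge> N \<Longrightarrow> ?nrm (X m - X k) < \<epsilon>" using cauchy by blast
        have "dist (X m i) (X k i) < \<epsilon>" if "m \<ge> N" "k \<ge> N" for m k
          using abs_le_wnorm_fin[OF p n i, of "apply_bcontfun (X m - X k)"] N[OF that]
          by (simp add: dist_real_def)
        then show "\<exists>N. \<forall>m\<ge>N. \<forall>k\<ge>N. dist (X m i) (X k i) < \<epsilon>" by blast
      qed
      then show ?thesis by (simp add: Cauchy_convergent_iff)
    qed
    then obtain L where L: "\<And>i. i < n \<Longrightarrow> (\<lambda>m. X m i) \<longlonglongrightarrow> L i" unfolding convergent_def by metis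
    define l where "l = trunc_fun n L"
    have "(\<lambda>m. \<Sum>i<n. \<bar>X m i - L i\<bar>) \<longlonglongrightarrow> (\<Sum>i<n. \<bar>L i - L i\<bar>)"
      by (intro tendsto_intros L) auto
    then have lim: "(\<lambda>m. \<Sum>i<n. \<bar>X m i - L i\<bar>) \<longlonglongrightarrow> 0" by simp
    have "?nrm (X m - l) \<le> (\<Sum>i<n. \<bar>X m i - L i\<bar>)" for m
      using wnorm_fin_le_sum[OF p n, of "apply_bcontfun (X m - l)"] by (simp add: l_def)
    moreover have "0 \<le> ?nrm (X m - l)" for m using wnorm_fin_nonneg[OF p n] by simp
    ultimately have "(\<lambda>m. ?nrm (X m - l)) \<longlonglongrightarrow> 0"
      using lim by (intro tendsto_sandwich[OF _ _ tendsto_const lim]) auto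
    moreover have "l \<in> fin_carrier n" by (simp add: l_def trunc_fun_in)
    ultimately show ?thesis by blast
  qed
  have solid: "?nrm g \<le> ?nrm h"
    if "g \<in> fin_carrier n" "h \<in> fin_carrier n" "fin_le (labs (fin_carrier n) fin_le g) (labs (fin_carrier n) fin_le h)" for g h
    using that wnorm_fin_mono[OF p n, of "apply_bcontfun g" "apply_bcontfun h"]
    by (auto simp: labs_fin fin_le_def split: if_splits)
  have add: "?nrm (g + h) \<le> ?nrm g + ?nrm h" for g h
    using wnorm_fin_add[OF p n, of "apply_bcontfun g" "apply_bcontfun h"]
    by (simp add: plus_bcontfun.rep_eq[abs_def] comp_def)
  have scale: "?nrm (c *\<^sub>R g) = \<bar>c\<bar> * ?nrm g" for c g
    using wnorm_fin_scale[OF p n, of c "apply_bcontfun g"]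
    by (simp add: scaleR_bcontfun.rep_eq[abs_def] comp_def)
  have nonneg: "0 \<le> ?nrm g" for g using wnorm_fin_nonneg[OF p n] by simp
  show ?thesis
    unfolding banach_lattice_def
    apply (intro conjI)
    subgoal by (rule subspace)
    subgoal using le_refl by blast
    subgoal using le_antisym by blast
    subgoal using le_trans by blast
    subgoal using le_add by blast
    subgoal using le_scale by blast
    subgoal using sup_exists by blast
    subgoal using nonneg zero zero' by blast
    subgoal using scale by blast
    subgoal using add by blast
    subgoal using solid by blast
    subgoal using complete by blast
    done
qed

lemma apply_bcontfun_sum:
  "apply_bcontfun (\<Sum>k\<in>K. x k) i = (\<Sum>k\<in>K. apply_bcontfun (x k :: nat \<Rightarrow>\<^sub>C real) i)"
  by (induction K rule: infinite_finite_induct) auto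

lemma upper_p_estimate_fin:
  assumes p: "1 < p" and n: "1 \<le> n"
  shows "upper_p_estimate1 p (fin_carrier n) fin_le (wnorm_fin p n \<circ> apply_bcontfun)"
  unfolding upper_p_estimate1_def
proof (intro allI impI, elim conjE)
  fix m and x :: "nat \<Rightarrow> nat \<Rightarrow>\<^sub>C real"
  assume x: "\<forall>k<m. x k \<in> fin_carrier n"
    and disj: "\<forall>j<m. \<forall>k<m. j \<noteq> k \<longrightarrow> ldisjoint (fin_carrier n) fin_le (x j) (x k)"
  have "x j i = 0 \<or> x k i = 0" if i: "i < n" and jk: "j < m" "k < m" "j \<noteq> k" for i j k
  proof -
    have "linf (fin_carrier n) fin_le (trunc_fun n (\<lambda>i. \<bar>x j i\<bar>)) (trunc_fun n (\<lambda>i. \<bar>x k i\<bar>)) = 0"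
      using disj x jk by (simp add: ldisjoint_def labs_fin)
    then have "apply_bcontfun (linf (fin_carrier n) fin_le (trunc_fun n (\<lambda>i. \<bar>x j i\<bar>)) (trunc_fun n (\<lambda>i. \<bar>x k i\<bar>))) i = 0"
      by simp
    \<comment> \<open>The lattice infimum of the moduli, written as a negated supremum, is read off
      at coordinate i.\<close>
    then have "max (- \<bar>x j i\<bar>) (- \<bar>x k i\<bar>) = 0"
      using i by (simp add: linf_def lsup_fin fin_carrier_neg trunc_fun_in)
    then show ?thesis by (auto simp: max_def split: if_splits)
  qed
  then have "wnorm_fin p n (\<lambda>i. \<Sum>k<m. x k i) \<le> (\<Sum>k<m. wnorm_fin p n (apply_bcontfun (x k)) powr p) powr (1 / p)"
    by (intro wnorm_fin_disjoint_sum[OF p n]) auto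
  moreover have "apply_bcontfun (\<Sum>k<m. x k) = (\<lambda>i. \<Sum>k<m. x k i)" by (simp add: fun_eq_iff apply_bcontfun_sum)
  ultimately show "(wnorm_fin p n \<circ> apply_bcontfun) (\<Sum>k<m. x k)
      \<le> (\<Sum>k<m. (wnorm_fin p n \<circ> apply_bcontfun) (x k) powr p) powr (1 / p)" by simp
qed

lemma eval_lat_fin:
  "eval_lat (fin_carrier n) fin_le (\<lambda>x. trunc_fun n (a x)) e = trunc_fun n (\<lambda>i. eval_real (\<lambda>x. a x i) e)"
  by (induction e) (auto simp: lsup_fin trunc_fun_in intro!: bcontfun_eqI)

text \<open>The n-dimensional weak space itself satisfies the upper p-estimate with constant 1, so
  an admissible family is a contraction into a member of the class and no constant is lost.\<close>

theorem rho_pinf_le_rho_Cp: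
  fixes e :: "'e::banach lexpr"
  assumes p: "1 < p"
  shows "rho_pinf p e \<le> rho_Cp TYPE(nat \<Rightarrow>\<^sub>C real) p e"
  unfolding rho_pinf_def
proof (rule SUP_least, clarify)
  fix n :: nat and xs :: "nat \<Rightarrow> 'e \<Rightarrow>\<^sub>L real"
  assume n: "1 \<le> n" and xs: "\<forall>x. norm x \<le> 1 \<longrightarrow> wnorm_fin p n (\<lambda>i. xs i x) \<le> 1"
  let ?V = "fin_carrier n" and ?nrm = "wnorm_fin p n \<circ> apply_bcontfun"
  let ?T = "\<lambda>x. trunc_fun n (\<lambda>i. xs i x)"
  have nrm_trunc: "wnorm_fin p n (apply_bcontfun (trunc_fun n a)) = wnorm_fin p n a" for a
    by (intro antisym wnorm_fin_mono[OF p n]) auto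
  have "lin_contraction ?V ?nrm ?T"
    unfolding lin_contraction_def using wnorm_fin_le_norm[OF n] xs
    by (auto simp: trunc_fun_in nrm_trunc blinfun.add_right blinfun.scaleR_right intro!: bcontfun_eqI)
  then have "ennreal (?nrm (eval_lat ?V fin_le ?T e)) \<le> rho_Cp TYPE(nat \<Rightarrow>\<^sub>C real) p e"
    unfolding rho_Cp_def using banach_lattice_fin[OF p n] upper_p_estimate_fin[OF p n]
    by (intro SUP_upper2[of "(?V, fin_le, ?nrm, ?T)"]) auto
  then show "ennreal (wnorm_fin p n (\<lambda>i. fvl_fun e (xs i))) \<le> rho_Cp TYPE(nat \<Rightarrow>\<^sub>C real) p e"
    by (simp add: eval_lat_fin nrm_trunc fvl_fun_def)
qed

text \<open>A supremum over a class of lattices is rendered type by type: the upper bounds hold for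
  arbitrary \<open>'b\<close> and \<open>'y\<close>, while single types, \<open>nat\<close> for the
  measures and bounded functions on \<open>nat\<close> for the lattices, already reach the lower
  bounds.\<close>

theorem theorem3p5:
  fixes p :: real and e :: "'e::banach lexpr"
  assumes "1 < p"
  shows "rho_Xp TYPE(nat) p e = rho_pinf p e
     \<and> rho_Xp TYPE('b) p e \<le> rho_pinf p e
     \<and> rho_pinf p e \<le> rho_Cp TYPE(nat \<Rightarrow>\<^sub>C real) p e
     \<and> rho_Cp TYPE('y::real_vector) p e \<le> ennreal (gamma_p p) * rho_pinf p e"
  by (intro conjI antisym rho_Xp_le[OF assms] rho_pinf_le_rho_Xp rho_pinf_le_rho_Cp[OF assms]
      rho_Cp_le[OF assms])

end
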